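(* Let $\Gamma$ be a unimodular Gaussian lattice of rank $2g$ over $\mathbb{Z}$. The number of $i$-invariant theta divisors $\Theta$ of $A_\Gamma$ with $m_0(\Theta)\equiv 2\pmod 4$ is $$2^{\frac g2-1}\bigl(2^{\frac g2}-(-1)^{\frac g4}\bigr)\quad\text{if }\Gamma\text{ is even},\qquad\text{and}\qquad 2^{g-2}-2^{\frac g2-1}\cos\frac{\pi g}{4}\quad\text{if }\Gamma\text{ is odd}.$$ Each of these divisors corresponds to a vanishing thetanull.
   Context: **Gaussian lattices.** A Gaussian lattice is a free finitely generated $\mathbb{Z}[i]$-module $\Gamma$ with a positive (definite) hermitian form $H:\Gamma\times\Gamma\to\mathbb{Z}[i]$, $\mathbb{C}$-linear in the second variable. Write $H=S+iE$ with $S,E$ $\mathbb{Z}$-valued; $S$ is symmetric, $E$ is skew-symmetric, $S$ and $E$ are invariant under multiplication by $i$, and $E(x,y)=S(ix,y)$. $\Gamma$ is unimodular if $\det S=\det E=(\det H)^2=1$. $\Gamma$ is even if $S(x,x)$ is even for all $x\in\Gamma$ (for $\Gamma$ unimodular this forces $g$ to be divisible by $4$), and odd otherwise. **The abelian variety.** For $\Gamma$ unimodular of $\mathbb{Z}$-rank $2g$, put $\Gamma_{\mathbb{R}}=\Gamma\otimes_{\mathbb{Z}}\mathbb{R}$, a complex vector space via $i$, and $A_\Gamma=\Gamma_{\mathbb{R}}/\Gamma$; with the polarization given by $H$ it is a principally polarized abelian variety of dimension $g$. Multiplication by $i$ induces an automorphism of $A_\Gamma$, also denoted $i$. Let $A_2=\Gamma/2\Gamma$,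 identified with the 2-torsion subgroup of $A_\Gamma$ by $\gamma\mapsto\gamma/2$, and let $e:A_2\times A_2\to\mathbb{F}_2$ be the symplectic form induced by $E$. **Theta divisors.** A theta divisor of $A_\Gamma$ is an effective divisor defining the principal polarization; it is symmetric if invariant under $-1$, and $i$-invariant if invariant under the automorphism $i$ (it is then symmetric, since $i^2=-1$). Explicitly, a quadratic form on $A_2$ associated to $e$ is a function $q:A_2\to\mathbb{Z}/4$ with $q(x+y)=q(x)+q(y)+2e(x,y)$ (multiplication by 2 being $\mathbb{Z}/2\cong2\mathbb{Z}/4\mathbb{Z}$). For such $q$, put $e_\gamma(z)=i^{q(\bar\gamma)}e^{\pi H(\gamma,z+\gamma/2)}$ for $\gamma\in\Gamma$ with class $\bar\gamma\in A_2$ and $z\in\Gamma_{\mathbb{R}}$; up to scalar there is a unique nonzero holomorphic function $\theta$ on $\Gamma_{\mathbb{R}}$ with $\theta(z+\gamma)=e_\gamma(z)\theta(z)$ for all $\gamma\in\Gamma$, and $\Theta_q$ is the divisor on $A_\Gamma$ defined by $\theta$. The map $q\mapsto\Theta_q$ is a bijection onto the set of symmetric theta divisors; the $i$-invariant theta divisors are the $\Theta_q$ with $q(i\alpha)=q(\alpha)$ for all $\alpha\in A_2$. $m_0(\Theta)$ is the multiplicity of $\Theta$ at the origin $0$ of $A_\Gamma$ ($0$ if $0\notin\Theta$). A vanishing thetanull is an even theta function vanishing at $0$: $\Theta_q$ corresponds to a vanishing thetanull if the function $\theta$ defining it satisfies $\theta(-z)=\theta(z)$ and $\theta(0)=0$.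 *)

theory Defs
  imports "HOL-Analysis.Analysis" "HOL-Number_Theory.Cong"
begin

text \<open>
  A free \<open>\<int>[i]\<close>-module \<open>\<Gamma>\<close> of rank \<open>g = CARD('n)\<close> is represented inside
  \<open>\<Gamma>\<^sub>\<real> = \<Gamma> \<otimes> \<real>\<close>, which is identified with \<^typ>\<open>complex ^ 'n\<close>: it is the
  \<open>\<int>[i]\<close>-span of a \<open>\<complex>\<close>-basis. The form \<open>H\<close> is given through its unique
  sesquilinear extension to \<open>\<Gamma>\<^sub>\<real>\<close>. Multiplication by \<open>i\<close> is \<open>(*s) \<i>\<close>.
\<close>

definition gaussian_ints :: "complex set" where
  "gaussian_ints = {z. Re z \<in> \<int> \<and> Im z \<in> \<int>}"

definition gaussian_basis :: "('n \<Rightarrow> complex ^ 'n) \<Rightarrow> (complex ^ 'n) set \<Rightarrow> bool" where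
  "gaussian_basis b \<Gamma> \<longleftrightarrow>
     inj b \<and> vec.independent (range b) \<and>
     \<Gamma> = {\<Sum>k\<in>UNIV. c k *s b k | c. \<forall>k. c k \<in> gaussian_ints}"

definition gaussian_lattice ::
  "(complex ^ 'n) set \<Rightarrow> (complex ^ 'n \<Rightarrow> complex ^ 'n \<Rightarrow> complex) \<Rightarrow> bool" where
  "gaussian_lattice \<Gamma> H \<longleftrightarrow>
     (\<exists>b. gaussian_basis b \<Gamma>) \<and>
     (\<forall>x y z. H x (y + z) = H x y + H x z) \<and>
     (\<forall>c x y. H x (c *s y) = c * H x y) \<and>
     (\<forall>x y. H y x = cnj (H x y)) \<and>
     (\<forall>x\<in>\<Gamma>. \<forall>y\<in>\<Gamma>. H x y \<in> gaussian_ints) \<and>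
     (\<forall>x\<in>\<Gamma>. x \<noteq> 0 \<longrightarrow> 0 < Re (H x x))"

definition form_S :: "('v \<Rightarrow> 'v \<Rightarrow> complex) \<Rightarrow> 'v \<Rightarrow> 'v \<Rightarrow> real" where
  "form_S H x y = Re (H x y)"

definition form_E :: "('v \<Rightarrow> 'v \<Rightarrow> complex) \<Rightarrow> 'v \<Rightarrow> 'v \<Rightarrow> real" where
  "form_E H x y = Im (H x y)"

definition gram :: "('v \<Rightarrow> 'v \<Rightarrow> 'a) \<Rightarrow> ('m \<Rightarrow> 'v) \<Rightarrow> 'a ^ 'm ^ 'm" where
  "gram B e = (\<chi> j k. B (e j) (e k))"

definition underlying_int_basis :: "('n \<Rightarrow> complex ^ 'n) \<Rightarrow> 'n + 'n \<Rightarrow> complex ^ 'n" where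
  "underlying_int_basis b = case_sum b (\<lambda>k. \<i> *s b k)"

text \<open>The three determinants do not depend on the choice of the basis.\<close>

definition unimodular ::
  "(complex ^ 'n) set \<Rightarrow> (complex ^ 'n \<Rightarrow> complex ^ 'n \<Rightarrow> complex) \<Rightarrow> bool" where
  "unimodular \<Gamma> H \<longleftrightarrow>
     (\<exists>b. gaussian_basis b \<Gamma> \<and>
          det (gram (form_S H) (underlying_int_basis b)) = 1 \<and>
          det (gram (form_E H) (underlying_int_basis b)) = 1 \<and>
          (det (gram H b))\<^sup>2 = 1)"

definition even_lattice :: "'v set \<Rightarrow> ('v \<Rightarrow> 'v \<Rightarrow> complex) \<Rightarrow> bool" where
  "even_lattice \<Gamma> H \<longleftrightarrow> (\<forall>x\<in>\<Gamma>. \<exists>k::int. form_S H x x = 2 * of_int k)"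

definition entire :: "(complex ^ 'n \<Rightarrow> complex) \<Rightarrow> bool" where
  "entire f \<longleftrightarrow>
     (\<forall>z. \<exists>f'. (f has_derivative f') (at z) \<and> (\<forall>c v. f' (c *s v) = c * f' v))"

text \<open>
  The (Cartier) divisor of a nonzero entire function is its class modulo entire
  functions without zeros. Every effective divisor on \<open>\<Gamma>\<^sub>\<real>\<close> is of this form
  (second Cousin problem), and the effective divisors on \<open>A\<^sub>\<Gamma> = \<Gamma>\<^sub>\<real> / \<Gamma>\<close> are, by
  pullback to \<open>\<Gamma>\<^sub>\<real>\<close>, the effective divisors on \<open>\<Gamma>\<^sub>\<real>\<close> invariant under translations
  by \<open>\<Gamma>\<close>.
\<close>

definition divisor_of :: "(complex ^ 'n \<Rightarrow> complex) \<Rightarrow> (complex ^ 'n \<Rightarrow> complex) set" where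
  "divisor_of f = {\<lambda>z. u z * f z | u. entire u \<and> (\<forall>z. u z \<noteq> 0)}"

definition pullback_divisor :: "('v \<Rightarrow> 'v) \<Rightarrow> ('v \<Rightarrow> complex) set \<Rightarrow> ('v \<Rightarrow> complex) set" where
  "pullback_divisor \<phi> D = (\<lambda>f. f \<circ> \<phi>) ` D"

definition effective_divisor ::
  "(complex ^ 'n) set \<Rightarrow> (complex ^ 'n \<Rightarrow> complex) set \<Rightarrow> bool" where
  "effective_divisor \<Gamma> D \<longleftrightarrow>
     (\<exists>f. entire f \<and> (\<exists>z. f z \<noteq> 0) \<and> D = divisor_of f) \<and>
     (\<forall>\<gamma>\<in>\<Gamma>. pullback_divisor (\<lambda>z. z + \<gamma>) D = D)"

text \<open>
  The line bundles on \<open>A\<^sub>\<Gamma>\<close> whose first Chern class is the polarization \<open>H\<close> are the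
  bundles \<open>L(H, \<psi>)\<close> given by the factors of automorphy
  \<open>\<psi>(\<gamma>) exp (\<pi> H(\<gamma>, z + \<gamma>/2))\<close>, where \<open>\<psi>\<close> is a semicharacter for \<open>E\<close>
  (Appell-Humbert). A divisor defines the polarization \<open>H\<close> if it is the divisor of a
  section of one of these.
\<close>

definition semicharacter :: "'v::ab_group_add set \<Rightarrow> ('v \<Rightarrow> 'v \<Rightarrow> complex) \<Rightarrow> ('v \<Rightarrow> complex) \<Rightarrow> bool" where
  "semicharacter \<Gamma> H \<psi> \<longleftrightarrow>
     (\<forall>\<gamma>\<in>\<Gamma>. norm (\<psi> \<gamma>) = 1) \<and>
     (\<forall>\<gamma>\<in>\<Gamma>. \<forall>\<delta>\<in>\<Gamma>. \<psi> (\<gamma> + \<delta>) = \<psi> \<gamma> * \<psi> \<delta> * (-1) powi \<lfloor>form_E H \<gamma> \<delta>\<rfloor>)"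

definition automorphy_factor ::
  "(complex ^ 'n \<Rightarrow> complex ^ 'n \<Rightarrow> complex) \<Rightarrow> (complex ^ 'n \<Rightarrow> complex) \<Rightarrow>
   complex ^ 'n \<Rightarrow> complex ^ 'n \<Rightarrow> complex" where
  "automorphy_factor H \<psi> \<gamma> z = \<psi> \<gamma> * exp (of_real pi * H \<gamma> (z + (1/2) *s \<gamma>))"

definition theta_function ::
  "(complex ^ 'n) set \<Rightarrow> (complex ^ 'n \<Rightarrow> complex ^ 'n \<Rightarrow> complex) \<Rightarrow>
   (complex ^ 'n \<Rightarrow> complex) \<Rightarrow> (complex ^ 'n \<Rightarrow> complex) \<Rightarrow> bool" where
  "theta_function \<Gamma> H \<psi> \<theta> \<longleftrightarrow>
     entire \<theta> \<and> (\<exists>z. \<theta> z \<noteq> 0) \<and>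
     (\<forall>\<gamma>\<in>\<Gamma>. \<forall>z. \<theta> (z + \<gamma>) = automorphy_factor H \<psi> \<gamma> z * \<theta> z)"

definition theta_divisor ::
  "(complex ^ 'n) set \<Rightarrow> (complex ^ 'n \<Rightarrow> complex ^ 'n \<Rightarrow> complex) \<Rightarrow>
   (complex ^ 'n \<Rightarrow> complex) set \<Rightarrow> bool" where
  "theta_divisor \<Gamma> H \<Theta> \<longleftrightarrow>
     effective_divisor \<Gamma> \<Theta> \<and>
     (\<exists>\<psi> \<theta>. semicharacter \<Gamma> H \<psi> \<and> theta_function \<Gamma> H \<psi> \<theta> \<and> \<Theta> = divisor_of \<theta>)"

definition i_invariant :: "(complex ^ 'n \<Rightarrow> complex) set \<Rightarrow> bool" where
  "i_invariant D \<longleftrightarrow> pullback_divisor (\<lambda>z. \<i> *s z) D = D"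

fun iterated_dir_deriv ::
  "(complex ^ 'n) list \<Rightarrow> (complex ^ 'n \<Rightarrow> complex) \<Rightarrow> complex ^ 'n \<Rightarrow> complex" where
  "iterated_dir_deriv [] f = f"
| "iterated_dir_deriv (v # vs) f = (\<lambda>z. deriv (\<lambda>t. iterated_dir_deriv vs f (z + t *s v)) 0)"

definition vanishing_order :: "(complex ^ 'n \<Rightarrow> complex) \<Rightarrow> complex ^ 'n \<Rightarrow> nat" where
  "vanishing_order f z = (LEAST m. \<exists>vs. length vs = m \<and> iterated_dir_deriv vs f z \<noteq> 0)"

text \<open>
  The multiplicity at the origin of \<open>A\<^sub>\<Gamma>\<close>; all equations of \<open>D\<close> have the same order
  of vanishing, as they differ by units.
\<close>

definition mult_at_origin :: "(complex ^ 'n \<Rightarrow> complex) set \<Rightarrow> nat" where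
  "mult_at_origin D = vanishing_order (SOME f. f \<in> D) 0"

text \<open>
  A function \<open>q : A\<^sub>2 = \<Gamma>/2\<Gamma> \<rightarrow> \<int>/4\<close> is represented by integer representatives of its
  values, as a function on \<open>\<Gamma>\<close> that is constant modulo 4 on the classes of \<open>\<Gamma>/2\<Gamma>\<close>.
\<close>

definition quadratic_form_A2 ::
  "'v::ab_group_add set \<Rightarrow> ('v \<Rightarrow> 'v \<Rightarrow> complex) \<Rightarrow> ('v \<Rightarrow> int) \<Rightarrow> bool" where
  "quadratic_form_A2 \<Gamma> H q \<longleftrightarrow>
     (\<forall>x\<in>\<Gamma>. \<forall>y\<in>\<Gamma>. [q (x + (y + y)) = q x] (mod 4)) \<and>
     (\<forall>x\<in>\<Gamma>. \<forall>y\<in>\<Gamma>. [q (x + y) = q x + q y + 2 * \<lfloor>form_E H x y\<rfloor>] (mod 4))"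

definition vanishing_thetanull ::
  "(complex ^ 'n) set \<Rightarrow> (complex ^ 'n \<Rightarrow> complex ^ 'n \<Rightarrow> complex) \<Rightarrow>
   (complex ^ 'n \<Rightarrow> complex) set \<Rightarrow> bool" where
  "vanishing_thetanull \<Gamma> H \<Theta> \<longleftrightarrow>
     (\<exists>q \<theta>. quadratic_form_A2 \<Gamma> H q \<and>
            theta_function \<Gamma> H (\<lambda>\<gamma>. \<i> powi q \<gamma>) \<theta> \<and>
            \<Theta> = divisor_of \<theta> \<and>
            (\<forall>z. \<theta> (- z) = \<theta> z) \<and> \<theta> 0 = 0)"

end

theory Submission
  imports Defs "HOL-Complex_Analysis.Complex_Analysis"
begin

text \<open>
  An \<open>\<i>\<close>-invariant theta divisor is the divisor of a theta function \<open>\<theta>\<close> for a semicharacter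
  \<open>\<psi>\<close> with \<open>\<psi>(\<i>\<gamma>) = \<psi>(\<gamma>)\<close> (Liouville), and such \<open>\<psi>\<close> take the values \<open>1\<close> and \<open>-1\<close>. As the theta functions
  for \<open>\<psi>\<close> form a line, \<open>\<theta>(\<i>z) = c \<theta>(z)\<close> for a fourth root of unity \<open>c\<close>, and comparing lowest order
  terms at 0 gives \<open>c = \<i>\<^sup>m\<close> with \<open>m\<close> the multiplicity at the origin. So the divisors with \<open>c = -1\<close>
  have to be counted.

  The line is spanned by the Poincare series \<open>K(z,w) = (\<Sum>\<gamma>\<in>\<Gamma>. exp(\<pi>H(w,z+\<gamma>)) / e\<^sub>\<gamma>(z))\<close>, whose restriction
  to the diagonal, times \<open>exp(-\<pi>H(z,z))\<close>, has mean value 1 over \<open>A\<^sub>\<Gamma>\<close>. Computing the mean value of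
  \<open>K(\<i>z,z) exp(-\<pi>H(z,z))\<close> by completing squares gives
  \<open>c = (1-\<i>)\<^sup>-\<^sup>g (\<Sum>\<delta>\<in>\<Gamma>/(1-\<i>)\<Gamma>. \<i>\<^bsup>r(\<delta>)\<^esup>)\<close> with \<open>r = q - H\<close>, where \<open>\<psi> = \<i>\<^sup>q\<close>; this is the holomorphic Lefschetz formula
  for \<open>\<i>\<close>. The forms \<open>r\<close> are a torsor under the characters of \<open>\<Gamma>/(1-\<i>)\<Gamma>\<close>, and orthogonality of
  characters evaluates the sums of \<open>c\<close> and \<open>c\<^sup>2\<close> over all \<open>r\<close>, which determine the count.
\<close>

text \<open>Uniqueness of the theta function: for theta functions f and g of one semicharacter, the
  mean over z of f(z+v) cnj(g(z)) exp(-pi H(z,z+v)) is both holomorphic and antiholomorphic in v,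
  hence constant. Lattice vectors v produce characters, so all Fourier coefficients of the periodic
  function f cnj(g) exp(-pi H) are nonzero multiples of its mean. Orthogonality of f and g thus
  forces f cnj(g) = 0, which bounds the dimension by 1. The Gaussian constant: the trace leaves the
  mean of a periodised Gaussian with complex parameter l = 1 - i. No integral over the whole space
  is evaluated. Rescaling the lattice shows that the mean is r l^(-g) with r nonnegative, and
  comparing the sum of |c|^2 over all forms with the orthogonality relations gives r = 1. In the
  even case c^2 = i^g for every form, so 4 divides g as soon as some c equals 1; a positive theta
  series at the origin provides such a c.\<close>

no_notation fps_nth (infixl \<open>$\<close> 75)

section \<open>Holomorphic dependence on a parameter\<close>

lemma continuous_on_deriv_param:
  fixes f :: "complex \<Rightarrow> 'a::metric_space \<Rightarrow> complex"
  assumes U: "open U" and cont: "continuous_on (U \<times> K) (\<lambda>(s,t). f s t)"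
    and holo: "\<And>t. t \<in> K \<Longrightarrow> (\<lambda>s. f s t) holomorphic_on U"
  shows "continuous_on (U \<times> K) (\<lambda>(s,t). deriv (\<lambda>s. f s t) s)"
proof (rule continuous_onI)
  fix p :: "complex \<times> 'a" and e :: real
  assume "p \<in> U \<times> K" and e: "0 < e"
  then obtain s0 t0 where p: "p = (s0, t0)" "s0 \<in> U" "t0 \<in> K" by auto
  obtain r where r: "0 < r" "cball s0 (2*r) \<subseteq> U"
  proof -
    obtain r' where "0 < r'" "cball s0 r' \<subseteq> U" using U p open_contains_cball by blast
    then show ?thesis using that[of "r'/2"] by simp
  qed
  have c1: "continuous_on (K \<times> cball s0 (2*r)) (\<lambda>(t,s). f s t)"
    using continuous_on_compose2[OF cont continuous_on_swap, of "K \<times> cball s0 (2*r)"] r(2)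
    by (auto simp: case_prod_unfold prod.swap_def subset_iff image_iff)
  \<comment> \<open>Cauchy's inequality on a circle of radius \<open>r\<close> divides by
    \<open>r\<close>, so a bound \<open>e * r / 4\<close> for the change of \<open>f\<close> becomes
    \<open>e / 4\<close> for its derivative; the rest is spent on the variation in \<open>s\<close>.
    The radius \<open>2 * r\<close> keeps circles with centre within \<open>r\<close> of
    \<open>s0\<close> inside the compact set.\<close>
  have er: "0 < e * r / 4" using e r by simp
  obtain X0 where X0: "t0 \<in> X0" "open X0"
    "\<forall>t\<in>X0 \<inter> K. \<forall>s\<in>cball s0 (2*r). dist (f s t) (f s t0) \<le> e * r / 4"
    by (rule continuous_on_prod_compactE[OF c1 compact_cball p(3) er, unfolded case_prod_conv])
  have "(\<lambda>s. f s t0) holomorphic_on U" using holo p by blast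
  then have "deriv (\<lambda>s. f s t0) holomorphic_on U" using U by (rule holomorphic_deriv)
  then have "continuous_on U (deriv (\<lambda>s. f s t0))" by (rule holomorphic_on_imp_continuous_on)
  then obtain d1 where d1: "0 < d1"
    "\<And>s. s \<in> U \<Longrightarrow> dist s s0 < d1 \<Longrightarrow> dist (deriv (\<lambda>s. f s t0) s) (deriv (\<lambda>s. f s t0) s0) < e/2"
    using p e unfolding continuous_on_iff by (meson half_gt_zero)
  obtain d2 where d2: "0 < d2" "ball t0 d2 \<subseteq> X0" using X0 open_contains_ball by blast
  show "\<exists>d>0. \<forall>x'\<in>U \<times> K. dist x' p < d \<longrightarrow>
      dist (case x' of (s, t) \<Rightarrow> deriv (\<lambda>s. f s t) s) (case p of (s, t) \<Rightarrow> deriv (\<lambda>s. f s t) s) \<le> e"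
  proof (intro exI conjI ballI impI)
    show "0 < min (min d1 d2) r" using d1 d2 r by simp
  next
    fix x assume x: "x \<in> U \<times> K" and dx: "dist x p < min (min d1 d2) r"
    obtain s t where st: "x = (s,t)" "s \<in> U" "t \<in> K" using x by auto
    have ds: "dist s s0 < min d1 r" and dt: "dist t t0 < d2"
      using dx st p dist_fst_le[of x p] dist_snd_le[of x p] by auto
    have tX: "t \<in> X0 \<inter> K" using d2 dt st by (auto simp: dist_commute)
    let ?h = "\<lambda>z. f z t - f z t0"
    have sub: "cball s r \<subseteq> cball s0 (2*r)"
    proof
      fix z assume "z \<in> cball s r"
      then show "z \<in> cball s0 (2*r)" using ds dist_triangle[of s0 z s] by (auto simp: dist_commute)
    qed
    have hol: "?h holomorphic_on U"
      by (intro holomorphic_intros holo st p)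
    have "norm ((deriv ^^ 1) ?h s) \<le> fact 1 * (e * r / 4) / r ^ 1"
    proof (rule Cauchy_inequality)
      show "?h holomorphic_on ball s r"
        using hol sub r(2) ball_subset_cball by (blast intro: holomorphic_on_subset)
      show "continuous_on (cball s r) ?h"
        using hol sub r(2) by (blast intro: holomorphic_on_imp_continuous_on holomorphic_on_subset)
      show "norm (f x t - f x t0) \<le> e * r / 4" if "norm (s - x) = r" for x
      proof -
        have "x \<in> cball s0 (2*r)" using sub that by (auto simp: dist_norm subset_iff)
        then show ?thesis using X0(3) tX by (auto simp: dist_norm)
      qed
    qed (use r in auto)
    then have b1: "norm (deriv ?h s) \<le> e / 4" using r by simp
    have "deriv ?h s = deriv (\<lambda>s. f s t) s - deriv (\<lambda>s. f s t0) s"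
      using holomorphic_on_imp_differentiable_at[OF holo U] st p by (intro deriv_diff) auto
    then have "dist (deriv (\<lambda>s. f s t) s) (deriv (\<lambda>s. f s t0) s) \<le> e/4"
      using b1 by (simp add: dist_norm)
    moreover have "dist (deriv (\<lambda>s. f s t0) s) (deriv (\<lambda>s. f s t0) s0) < e/2"
      using d1(2) st ds by auto
    ultimately show "dist (case x of (s, t) \<Rightarrow> deriv (\<lambda>s. f s t) s) (case p of (s, t) \<Rightarrow> deriv (\<lambda>s. f s t) s) \<le> e"
      using st p e dist_triangle[of "deriv (\<lambda>s. f s t) s" "deriv (\<lambda>s. f s t0) s0" "deriv (\<lambda>s. f s t0) s"] by simp
  qed
qed

text \<open>Differentiation under the integral on a small ball, with joint continuity of the
  derivative supplied by \<open>continuous_on_deriv_param\<close>.\<close>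

lemma holomorphic_on_integral_cbox:
  fixes f :: "complex \<Rightarrow> 'a::euclidean_space \<Rightarrow> complex"
  assumes U: "open U" and cont: "continuous_on (U \<times> cbox a b) (\<lambda>(s,t). f s t)"
    and holo: "\<And>t. t \<in> cbox a b \<Longrightarrow> (\<lambda>s. f s t) holomorphic_on U"
  shows "(\<lambda>s. integral (cbox a b) (f s)) holomorphic_on U"
  unfolding holomorphic_on_def
proof
  fix s0 assume s0: "s0 \<in> U"
  then obtain r where r: "0 < r" "ball s0 r \<subseteq> U" using U open_contains_ball by blast
  have "(\<lambda>s. integral (cbox a b) (f s)) field_differentiable at s0 within ball s0 r"
  proof (rule leibniz_rule_field_differentiable)
    show "((\<lambda>x. f x t) has_field_derivative deriv (\<lambda>s. f s t) x) (at x within ball s0 r)"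
      if "x \<in> ball s0 r" "t \<in> cbox a b" for x t
      using holo[OF that(2)] that(1) r(2) U
      by (meson holomorphic_derivI has_field_derivative_at_within subsetD)
    show "f x integrable_on cbox a b" if "x \<in> ball s0 r" for x
    proof (rule integrable_continuous)
      show "continuous_on (cbox a b) (f x)"
        using continuous_on_compose2[OF cont, of "cbox a b" "\<lambda>t. (x,t)"] that r
        by (simp add: continuous_on_Pair image_subset_iff) (metis subsetD mem_ball)
    qed
    show "continuous_on (ball s0 r \<times> cbox a b) (\<lambda>(x, t). deriv (\<lambda>s. f s t) x)"
    proof (rule continuous_on_subset)
      show "continuous_on (U \<times> cbox a b) (\<lambda>(x, t). deriv (\<lambda>s. f s t) x)"
        using U cont holo by (rule continuous_on_deriv_param)
    qed (use r(2) in blast)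
    show "s0 \<in> ball s0 r" "convex (ball s0 r)" using r(1) by simp_all
  qed
  then have "(\<lambda>s. integral (cbox a b) (f s)) field_differentiable at s0"
    using r(1) by (simp add: at_within_open[of s0 "ball s0 r"])
  then show "(\<lambda>s. integral (cbox a b) (f s)) field_differentiable at s0 within U"
    by (rule field_differentiable_at_within)
qed

text \<open>Cauchy's formula over the unit circle writes the derivative at 0 as an integral of
  values of \<open>F s\<close>, which makes it a parameter integral.\<close>

lemma holomorphic_on_deriv_param:
  fixes F :: "complex \<Rightarrow> complex \<Rightarrow> complex"
  assumes cont: "continuous_on UNIV (\<lambda>(s,t). F s t)"
    and h1: "\<And>t. (\<lambda>s. F s t) holomorphic_on UNIV"
    and h2: "\<And>s. F s holomorphic_on UNIV"
  shows "(\<lambda>s. deriv (F s) 0) holomorphic_on UNIV"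
proof -
  have ci: "((\<lambda>u. F s u / (u - 0) ^ Suc 1) has_contour_integral
        (2 * pi * \<i>) / fact 1 * (deriv ^^ 1) (F s) 0) (circlepath 0 1)" for s
  proof (rule Cauchy_has_contour_integral_higher_derivative_circlepath)
    show "continuous_on (cball 0 1) (F s)" "F s holomorphic_on ball 0 1"
      using h2[of s] by (auto intro: holomorphic_on_imp_continuous_on holomorphic_on_subset)
  qed auto
  have eq: "deriv (F s) 0 = integral (cbox 0 1) (\<lambda>x. F s (circlepath 0 1 x) / (circlepath 0 1 x)^2 *
      (2 * pi * \<i> * exp (2 * of_real pi * \<i> * x))) / (2 * pi * \<i>)" for s
  proof -
    have "contour_integral (circlepath 0 1) (\<lambda>u. F s u / (u - 0) ^ Suc 1) = 2 * pi * \<i> * deriv (F s) 0"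
      using contour_integral_unique[OF ci[of s]] by simp
    then show ?thesis
      unfolding contour_integral_integral vector_derivative_circlepath01
      by (simp add: contour_integral_integral vector_derivative_circlepath power2_eq_square)
  qed
  have cc: "continuous_on A (circlepath 0 1)" for A
    unfolding circlepath_def part_circlepath_def by (intro continuous_intros)
  have nz: "circlepath 0 1 x \<noteq> 0" for x by (simp add: circlepath)
  have "(\<lambda>s. integral (cbox 0 1) (\<lambda>x. F s (circlepath 0 1 x) / (circlepath 0 1 x)^2 *
      (2 * pi * \<i> * exp (2 * of_real pi * \<i> * x)))) holomorphic_on UNIV"
  proof (rule holomorphic_on_integral_cbox)
    have "continuous_on (UNIV \<times> cbox 0 1) (\<lambda>p. F (fst p) (circlepath 0 1 (snd p)))"
      by (rule continuous_on_compose2[OF cont, of "UNIV \<times> cbox 0 1" "\<lambda>p. (fst p, circlepath 0 1 (snd p))",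
            unfolded case_prod_unfold fst_conv snd_conv])
         (auto intro!: continuous_intros continuous_on_compose2[OF cc[of UNIV]])
    then show "continuous_on (UNIV \<times> cbox 0 1) (\<lambda>(s, x). F s (circlepath 0 1 x) / (circlepath 0 1 x)^2 *
      (2 * pi * \<i> * exp (2 * of_real pi * \<i> * x)))"
      unfolding case_prod_unfold
      by (intro continuous_intros continuous_on_compose2[OF cc[of UNIV]]) (auto simp: nz)
  qed (intro holomorphic_intros h1 | simp add: nz)+
  then show ?thesis unfolding eq by (intro holomorphic_intros) auto
qed

section \<open>Entire functions of several variables and their order of vanishing\<close>

lemma scaleR_vec_smult: "r *\<^sub>R (x::complex^'n) = of_real r *s x"
  by (simp add: vec_eq_iff) (simp add: scaleR_conv_of_real)

lemma continuous_on_smult [continuous_intros]: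
  fixes g :: "'a::topological_space \<Rightarrow> complex^'n"
  assumes "continuous_on S f" "continuous_on S g"
  shows "continuous_on S (\<lambda>x. f x *s g x)"
  unfolding continuous_on_componentwise vector_scalar_mult_def
  using assms by (auto intro!: continuous_intros)

text \<open>Equivalent to \<open>entire\<close> by \<open>entire_iff_gentire\<close>. Holomorphy
  along complex lines reduces products, derivatives and identity theorems to one variable; joint
  continuity is what makes directional derivatives again functions of this kind.\<close>

definition gentire :: "(complex ^ 'n \<Rightarrow> complex) \<Rightarrow> bool" where
  "gentire f \<longleftrightarrow> continuous_on UNIV f \<and> (\<forall>z v. (\<lambda>t. f (z + t *s v)) holomorphic_on UNIV)"

definition dir_deriv :: "complex ^ 'n \<Rightarrow> (complex ^ 'n \<Rightarrow> complex) \<Rightarrow> complex ^ 'n \<Rightarrow> complex" where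
  "dir_deriv v f = (\<lambda>z. deriv (\<lambda>t. f (z + t *s v)) 0)"

lemma iterated_dir_deriv_Cons: "iterated_dir_deriv (v # vs) f = dir_deriv v (iterated_dir_deriv vs f)"
  by (simp add: dir_deriv_def)

lemma gentire_cont: "gentire f \<Longrightarrow> continuous_on A f"
  unfolding gentire_def using continuous_on_subset by blast

lemma gentire_holo: "gentire f \<Longrightarrow> (\<lambda>t. f (z + t *s v)) holomorphic_on A"
  unfolding gentire_def using holomorphic_on_subset by blast

lemma gentire_holo_comp: "gentire f \<Longrightarrow> g holomorphic_on A \<Longrightarrow> (\<lambda>t. f (z + g t *s v)) holomorphic_on A"
  using holomorphic_on_compose_gen[of g A "\<lambda>t. f (z + t *s v)" UNIV] gentire_holo
  by (auto simp: o_def)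

lemma gentire_has_deriv:
  assumes "gentire f"
  shows "((\<lambda>t. f (z + t *s v)) has_field_derivative dir_deriv v f (z + t *s v)) (at t)"
proof -
  have 1: "((\<lambda>s. f ((z + t *s v) + s *s v)) has_field_derivative dir_deriv v f (z + t *s v)) (at (t - t))"
    unfolding dir_deriv_def using gentire_holo[OF assms, of "z + t *s v" v UNIV]
    by (auto intro: holomorphic_derivI)
  have 2: "((\<lambda>s. s - t) has_field_derivative 1) (at t)"
    by (auto intro!: derivative_eq_intros)
  have "((\<lambda>s. f ((z + t *s v) + (s - t) *s v)) has_field_derivative dir_deriv v f (z + t *s v) * 1) (at t)"
    using DERIV_chain2[OF 1 2] by simp
  moreover have "(z + t *s v) + (s - t) *s v = z + s *s v" for s
    by (simp add: vec_eq_iff algebra_simps)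
  ultimately show ?thesis by simp
qed

lemma gentire_deriv_eq:
  assumes "gentire f"
  shows "deriv (\<lambda>t. f (z + t *s v)) t = dir_deriv v f (z + t *s v)"
  using gentire_has_deriv[OF assms] by (rule DERIV_imp_deriv)

text \<open>For continuity the base point is the parameter of the line derivative. For holomorphy
  along a second direction the position on that second line is the parameter, and
  \<open>holomorphic_on_deriv_param\<close> applies.\<close>

lemma gentire_dir_deriv:
  fixes f :: "complex^'n \<Rightarrow> complex"
  assumes f: "gentire f"
  shows "gentire (dir_deriv v f)"
  unfolding gentire_def
proof (intro conjI allI)
  have c: "continuous_on UNIV (\<lambda>p::complex \<times> (complex^'n). f (snd p + fst p *s v))"
    by (intro continuous_on_compose2[OF gentire_cont[OF f, of UNIV]] continuous_intros) auto
  have "continuous_on (UNIV \<times> UNIV) (\<lambda>(s,z). deriv (\<lambda>s. f (z + s *s v)) s)"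
    by (rule continuous_on_deriv_param) (use c gentire_holo[OF f] in \<open>auto simp: case_prod_unfold\<close>)
  then have "continuous_on UNIV (\<lambda>z. (\<lambda>(s,z). deriv (\<lambda>s. f (z + s *s v)) s) (0, z))"
    by (rule continuous_on_compose2) (auto intro!: continuous_intros)
  then show "continuous_on UNIV (dir_deriv v f)" by (simp add: dir_deriv_def)
next
  fix z w :: "complex^'n"
  have "(\<lambda>s. deriv (\<lambda>t. f (z + s *s w + t *s v)) 0) holomorphic_on UNIV"
  proof (rule holomorphic_on_deriv_param)
    show "continuous_on UNIV (\<lambda>(s, t). f (z + s *s w + t *s v))"
      unfolding case_prod_unfold
      by (intro continuous_on_compose2[OF gentire_cont[OF f, of UNIV]] continuous_intros) auto
    show "(\<lambda>s. f (z + s *s w + t *s v)) holomorphic_on UNIV" for t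
      using gentire_holo[OF f, of "z + t *s v" w UNIV] by (simp add: algebra_simps)
  qed (rule gentire_holo[OF f])
  then show "(\<lambda>t. dir_deriv v f (z + t *s w)) holomorphic_on UNIV" by (simp add: dir_deriv_def)
qed

lemma gentire_iterated: "gentire f \<Longrightarrow> gentire (iterated_dir_deriv vs f)"
  by (induction vs) (auto simp: gentire_dir_deriv simp flip: dir_deriv_def)

lemma gentire_const: "gentire (\<lambda>z. c)"
  by (simp add: gentire_def)

lemma gentire_add: "gentire f \<Longrightarrow> gentire g \<Longrightarrow> gentire (\<lambda>z. f z + g z)"
  by (simp add: gentire_def continuous_on_add holomorphic_on_add)

lemma gentire_mult: "gentire f \<Longrightarrow> gentire g \<Longrightarrow> gentire (\<lambda>z. f z * g z)"
  by (simp add: gentire_def continuous_on_mult holomorphic_on_mult)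

lemma gentire_divide: "gentire f \<Longrightarrow> gentire g \<Longrightarrow> (\<And>z. g z \<noteq> 0) \<Longrightarrow> gentire (\<lambda>z. f z / g z)"
  by (simp add: gentire_def continuous_on_divide holomorphic_on_divide)

lemma gentire_smult_arg: "gentire f \<Longrightarrow> gentire (\<lambda>z. f (c *s z))"
  unfolding gentire_def
proof (intro conjI allI; elim conjE)
  assume "continuous_on UNIV f"
  then show "continuous_on UNIV (\<lambda>z. f (c *s z))"
    by (rule continuous_on_compose2) (auto intro!: continuous_intros)
next
  fix z v assume "\<forall>z v. (\<lambda>t. f (z + t *s v)) holomorphic_on UNIV"
  then have "(\<lambda>t. f (c *s z + t *s (c *s v))) holomorphic_on UNIV" by blast
  moreover have "c *s z + t *s (c *s v) = c *s (z + t *s v)" for t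
    by (simp add: vec_eq_iff algebra_simps)
  ultimately show "(\<lambda>t. f (c *s (z + t *s v))) holomorphic_on UNIV" by (simp only:)
qed

lemma dir_deriv_smult_arg:
  assumes "gentire f"
  shows "dir_deriv v (\<lambda>z. f (c *s z)) z = c * dir_deriv v f (c *s z)"
proof -
  have "((\<lambda>t. f (c *s z + t *s v)) has_field_derivative dir_deriv v f (c *s z + (c * 0) *s v)) (at (c * 0))"
    by (rule gentire_has_deriv[OF assms])
  moreover have "((\<lambda>t. c * t) has_field_derivative c) (at 0)"
    by (auto intro!: derivative_eq_intros)
  ultimately have "((\<lambda>t. f (c *s z + (c * t) *s v)) has_field_derivative dir_deriv v f (c *s z + (c * 0) *s v) * c) (at 0)"
    by (rule DERIV_chain2)
  moreover have "c *s z + (c * t) *s v = c *s (z + t *s v)" for t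
    by (simp add: vec_eq_iff algebra_simps)
  ultimately have "((\<lambda>t. f (c *s (z + t *s v))) has_field_derivative dir_deriv v f (c *s z + (c * 0) *s v) * c) (at 0)"
    by (simp only:)
  then have "((\<lambda>t. f (c *s (z + t *s v))) has_field_derivative dir_deriv v f (c *s z) * c) (at 0)"
    by (simp only: mult_zero_right vector_smult_lzero add_0_right)
  then show ?thesis unfolding dir_deriv_def[of v "\<lambda>z. f (c *s z)"] by (simp add: DERIV_imp_deriv mult.commute)
qed

lemma dir_deriv_at:
  assumes "gentire f"
  shows "((\<lambda>t. f (z + t *s v)) has_field_derivative dir_deriv v f z) (at 0)"
  using gentire_has_deriv[OF assms, of z v 0] by simp

lemma dir_deriv_add:
  assumes "gentire f" "gentire g"
  shows "dir_deriv v (\<lambda>z. f z + g z) z = dir_deriv v f z + dir_deriv v g z"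
  unfolding dir_deriv_def[of v "\<lambda>z. f z + g z"]
  by (rule DERIV_imp_deriv) (intro DERIV_add dir_deriv_at assms)

lemma dir_deriv_mult:
  assumes "gentire f" "gentire g"
  shows "dir_deriv v (\<lambda>z. f z * g z) z = dir_deriv v f z * g z + f z * dir_deriv v g z"
  unfolding dir_deriv_def[of v "\<lambda>z. f z * g z"]
  using DERIV_mult[OF dir_deriv_at[OF assms(1), of z v] dir_deriv_at[OF assms(2), of z v]]
  by (intro DERIV_imp_deriv) (simp add: mult.commute add.commute)

lemma dir_deriv_cmult:
  assumes "gentire f"
  shows "dir_deriv v (\<lambda>z. c * f z) z = c * dir_deriv v f z"
  unfolding dir_deriv_def[of v "\<lambda>z. c * f z"]
  by (rule DERIV_imp_deriv) (intro DERIV_cmult dir_deriv_at assms)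

lemma iterated_smult_arg:
  assumes "gentire f"
  shows "iterated_dir_deriv vs (\<lambda>z. f (c *s z)) z = c ^ length vs * iterated_dir_deriv vs f (c *s z)"
proof (induction vs arbitrary: z)
  case (Cons v vs)
  have "iterated_dir_deriv (v # vs) (\<lambda>z. f (c *s z)) z
      = dir_deriv v (\<lambda>z. c ^ length vs * iterated_dir_deriv vs f (c *s z)) z"
    unfolding iterated_dir_deriv_Cons using Cons.IH by presburger
  also have "\<dots> = c ^ length vs * (c * dir_deriv v (iterated_dir_deriv vs f) (c *s z))"
    using assms by (simp add: dir_deriv_cmult gentire_smult_arg gentire_iterated dir_deriv_smult_arg)
  finally show ?case by (simp add: iterated_dir_deriv_Cons del: iterated_dir_deriv.simps)
qed simp

text \<open>The lower-order terms of the Leibniz rule.\<close>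

inductive lower_comb :: "(complex ^ 'n \<Rightarrow> complex) \<Rightarrow> nat \<Rightarrow> (complex ^ 'n \<Rightarrow> complex) \<Rightarrow> bool" for f k where
  zero: "lower_comb f k (\<lambda>z. 0)"
| add: "gentire e \<Longrightarrow> length us < k \<Longrightarrow> lower_comb f k h \<Longrightarrow>
    lower_comb f k (\<lambda>z. e z * iterated_dir_deriv us f z + h z)"

lemma lower_comb_gentire: "lower_comb f k h \<Longrightarrow> gentire f \<Longrightarrow> gentire h"
  by (induction rule: lower_comb.induct) (auto intro!: gentire_const gentire_add gentire_mult gentire_iterated)

lemma lower_comb_dir_deriv:
  fixes f :: "complex^'n \<Rightarrow> complex"
  assumes "lower_comb f k h" and f: "gentire f"
  shows "lower_comb f (Suc k) (dir_deriv v h)"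
  using assms(1)
proof (induction rule: lower_comb.induct)
  case zero
  have "dir_deriv v (\<lambda>z. 0) = (\<lambda>z. 0)" by (simp add: dir_deriv_def fun_eq_iff)
  then show ?case by (simp add: lower_comb.zero)
next
  case (add e us h)
  have eq: "dir_deriv v (\<lambda>z. e z * iterated_dir_deriv us f z + h z) =
      (\<lambda>z. e z * iterated_dir_deriv (v # us) f z + (dir_deriv v e z * iterated_dir_deriv us f z + dir_deriv v h z))"
    unfolding iterated_dir_deriv_Cons using add.hyps f
    by (simp add: fun_eq_iff dir_deriv_add dir_deriv_mult gentire_mult gentire_iterated lower_comb_gentire)
  show ?case unfolding eq
    using add by (intro lower_comb.add) (auto intro: gentire_dir_deriv)
qed

lemma iterated_dir_deriv_mult:
  assumes "gentire f" "gentire w"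
  shows "\<exists>h. lower_comb f (length vs) h \<and>
    iterated_dir_deriv vs (\<lambda>z. w z * f z) = (\<lambda>z. w z * iterated_dir_deriv vs f z + h z)"
proof (induction vs)
  case Nil
  show ?case by (intro exI[of _ "\<lambda>z. 0"]) (auto intro: lower_comb.zero)
next
  case (Cons v vs)
  then obtain h where h: "lower_comb f (length vs) h"
    "iterated_dir_deriv vs (\<lambda>z. w z * f z) = (\<lambda>z. w z * iterated_dir_deriv vs f z + h z)" by blast
  have "iterated_dir_deriv (v # vs) (\<lambda>z. w z * f z) =
     (\<lambda>z. w z * iterated_dir_deriv (v # vs) f z + (dir_deriv v w z * iterated_dir_deriv vs f z + dir_deriv v h z))"
    unfolding iterated_dir_deriv_Cons h(2) using assms h(1)
    by (simp add: fun_eq_iff dir_deriv_add dir_deriv_mult gentire_mult gentire_iterated lower_comb_gentire)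
  moreover have "lower_comb f (length (v # vs)) (\<lambda>z. dir_deriv v w z * iterated_dir_deriv vs f z + dir_deriv v h z)"
    using assms h(1) lower_comb_dir_deriv[OF h(1) assms(1)] by (auto intro!: lower_comb.add gentire_dir_deriv)
  ultimately show ?case by blast
qed

lemma lower_comb_eq_0:
  assumes "lower_comb f k h" "\<And>us. length us < k \<Longrightarrow> iterated_dir_deriv us f z = 0"
  shows "h z = 0"
  using assms by (induction rule: lower_comb.induct) auto

lemma iterated_dir_deriv_replicate:
  assumes "gentire f"
  shows "(deriv ^^ k) (\<lambda>t. f (z + t *s v)) = (\<lambda>t. iterated_dir_deriv (replicate k v) f (z + t *s v))"
proof (induction k)
  case (Suc k)
  have "deriv (\<lambda>t. iterated_dir_deriv (replicate k v) f (z + t *s v)) =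
     (\<lambda>t. iterated_dir_deriv (replicate (Suc k) v) f (z + t *s v))"
    unfolding replicate_Suc iterated_dir_deriv_Cons
    using gentire_deriv_eq[OF gentire_iterated[OF assms]] by blast
  then show ?case using Suc by simp
qed simp

text \<open>By the identity theorem on the line through 0 and \<open>v\<close>, the repeated
  derivatives in the single direction \<open>v\<close> cannot all vanish at 0. Hence the least order
  in \<open>vanishing_order\<close> is attained.\<close>

lemma exists_iterated_dir_deriv_nonzero:
  assumes f: "gentire f" and nz: "f v \<noteq> 0"
  shows "\<exists>vs. iterated_dir_deriv vs f 0 \<noteq> 0"
proof (rule ccontr)
  assume a: "\<not> ?thesis"
  let ?h = "\<lambda>t. f (0 + t *s v)"
  have "?h 1 = 0"
  proof (rule holomorphic_fun_eq_0_on_connected[of ?h UNIV 0])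
    show "?h holomorphic_on UNIV" by (rule gentire_holo[OF f])
    show "(deriv ^^ n) ?h 0 = 0" for n
      unfolding iterated_dir_deriv_replicate[OF f] using a by simp
  qed auto
  then show False using nz by simp
qed

text \<open>A derivative of minimal order with nonzero value at 0 is applied to both sides. The
  chain rule yields \<open>a\<close> to that order on the left; on the right only the top term of
  the Leibniz rule survives. The factor \<open>w\<close> allows the equation of a divisor to change
  by a unit.\<close>

lemma vanishing_order_semi_invariant:
  assumes f: "gentire f" "f v \<noteq> 0" and w: "gentire w" "w 0 = 1"
    and eq: "\<And>z. f (a *s z) = c * (w z * f z)"
  shows "c = a ^ vanishing_order f 0"
proof -
  define m where "m = vanishing_order f 0"
  obtain us where "iterated_dir_deriv us f 0 \<noteq> 0" using exists_iterated_dir_deriv_nonzero[OF f] by blast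
  then have "\<exists>m vs. length vs = m \<and> iterated_dir_deriv vs f 0 \<noteq> 0" by blast
  then have "\<exists>vs. length vs = m \<and> iterated_dir_deriv vs f 0 \<noteq> 0"
    unfolding m_def vanishing_order_def by (rule LeastI_ex)
  then obtain vs where vs: "length vs = m" "iterated_dir_deriv vs f 0 \<noteq> 0" by blast
  have low: "iterated_dir_deriv us f 0 = 0" if "length us < m" for us
    using that not_less_Least[of "length us"] unfolding m_def vanishing_order_def by blast
  obtain h where h: "lower_comb f (length vs) h"
    "iterated_dir_deriv vs (\<lambda>z. (c * w z) * f z) = (\<lambda>z. (c * w z) * iterated_dir_deriv vs f z + h z)"
    using iterated_dir_deriv_mult[OF f(1) gentire_mult[OF gentire_const w(1)]] by blast
  have "h 0 = 0" using lower_comb_eq_0[OF h(1)] low vs by blast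
  have "a ^ m * iterated_dir_deriv vs f 0 = iterated_dir_deriv vs (\<lambda>z. f (a *s z)) 0"
    using iterated_smult_arg[OF f(1), of vs a 0] vs by simp
  also have "\<dots> = c * iterated_dir_deriv vs f 0"
    using h(2) \<open>h 0 = 0\<close> w(2) by (simp add: eq mult.assoc)
  finally show ?thesis using vs m_def by simp
qed

lemma entire_imp_gentire:
  fixes f :: "complex^'n \<Rightarrow> complex"
  assumes "entire f"
  shows "gentire f"
  unfolding gentire_def
proof (intro conjI allI)
  show "continuous_on UNIV f"
    using assms unfolding entire_def continuous_on_eq_continuous_at[OF open_UNIV]
    by (meson has_derivative_continuous)
next
  fix z v :: "complex^'n"
  have bl: "bounded_linear (\<lambda>h::complex. h *s v)"
    by (intro linear_conv_bounded_linear[THEN iffD1] linearI)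
       (simp_all add: vec_eq_iff algebra_simps)
  show "(\<lambda>t. f (z + t *s v)) holomorphic_on UNIV"
    unfolding holomorphic_on_open[OF open_UNIV]
  proof
    fix t :: complex
    obtain f' where f': "(f has_derivative f') (at (z + t *s v))" "\<And>c v. f' (c *s v) = c * f' v"
      using assms unfolding entire_def by blast
    have "((\<lambda>t. z + t *s v) has_derivative (\<lambda>h. h *s v)) (at t)"
      using has_derivative_add[OF has_derivative_const bounded_linear_imp_has_derivative[OF bl]] by simp
    then have "((\<lambda>t. f (z + t *s v)) has_derivative (\<lambda>h. f' (h *s v))) (at t)"
      using f'(1) by (rule has_derivative_compose)
    then have "((\<lambda>t. f (z + t *s v)) has_derivative (*) (f' v)) (at t)"
      by (rule has_derivative_eq_rhs) (simp add: f'(2) fun_eq_iff)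
    then show "\<exists>f'. ((\<lambda>t. f (z + t *s v)) has_field_derivative f') (at t)"
      unfolding has_field_derivative_def by blast
  qed
qed

lemma gentire_increment_bound:
  fixes f :: "complex^'n \<Rightarrow> complex"
  assumes f: "gentire f"
    and B: "\<And>s. norm s \<le> norm t \<Longrightarrow> norm (dir_deriv v f (y + s *s v) - a) \<le> B"
  shows "norm (f (y + t *s v) - f y - t * a) \<le> B * norm t"
proof -
  let ?g = "\<lambda>s. f (y + s *s v) - s * a"
  have "norm (?g t - ?g 0) \<le> B * norm (t - 0)"
  proof (rule field_differentiable_bound[of "cball 0 (norm t)" ?g "\<lambda>s. dir_deriv v f (y + s *s v) - a"])
    show "(?g has_field_derivative dir_deriv v f (y + s *s v) - a) (at s within cball 0 (norm t))" for s
      by (rule has_field_derivative_at_within)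
         (auto intro!: derivative_eq_intros gentire_has_deriv[OF f])
  qed (use B in auto)
  then show ?thesis by (simp add: algebra_simps)
qed

text \<open>Continuous partial derivatives give total differentiability: the path from
  \<open>z\<close> to \<open>z + h\<close> changes one coordinate at a time, and each step is
  estimated by \<open>gentire_increment_bound\<close>.\<close>

lemma gentire_imp_entire:
  fixes f :: "complex^'n \<Rightarrow> complex"
  assumes f: "gentire f"
  shows "entire f"
  unfolding entire_def
proof
  fix z :: "complex^'n"
  define D where "D k = dir_deriv (axis k 1) f z" for k
  define L where "L A h = (\<Sum>k\<in>A. (h$k) * D k)" for A and h :: "complex^'n"
  define p where "p A h = (\<Sum>k\<in>A. h$k *s axis k (1::complex))" for A and h :: "complex^'n"
  have pcomp: "p A h $ j = (if j \<in> A then h $ j else 0)" for A h j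
    unfolding p_def by (simp add: axis_def if_distrib[of "(*) _"] cong: if_cong)
  have pn: "norm (p A h) \<le> norm h" for A h
    by (rule norm_le_componentwise_cart) (simp add: pcomp)
  have claim: "\<exists>d>0. \<forall>h. norm h < d \<longrightarrow> norm (f (z + p A h) - f z - L A h) \<le> e * norm h"
    if "0 < e" for e A
    using finite[of A] that
  proof (induction A arbitrary: e rule: finite_induct)
    case empty
    then show ?case by (intro exI[of _ 1]) (auto simp: L_def p_def)
  next
    case (insert j A)
    have e2: "0 < e/2" using insert by simp
    obtain d1 where d1: "0 < d1"
      "\<And>h. norm h < d1 \<Longrightarrow> norm (f (z + p A h) - f z - L A h) \<le> e/2 * norm h"
      using insert.IH[OF e2] by blast
    have "continuous (at z) (dir_deriv (axis j 1) f)"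
      using gentire_cont[OF gentire_dir_deriv[OF f], of UNIV]
      by (simp add: continuous_on_eq_continuous_at)
    then obtain d2 where d2: "0 < d2"
      "\<And>y. dist y z < d2 \<Longrightarrow> dist (dir_deriv (axis j 1) f y) (D j) < e/2"
      using e2 unfolding continuous_at_eps_delta D_def by blast
    show ?case
    proof (intro exI conjI allI impI)
      \<comment> \<open>Half of \<open>d2\<close>, because the coordinates already moved and the one
        in motion each contribute at most the norm of \<open>h\<close>.\<close>
      show "0 < min d1 (d2/2)" using d1 d2 by simp
      fix h :: "complex^'n" assume h: "norm h < min d1 (d2/2)"
      let ?y = "z + p A h"
      have "norm (f (?y + h$j *s axis j 1) - f ?y - h$j * D j) \<le> e/2 * norm (h$j)"
      proof (rule gentire_increment_bound[OF f])
        fix s :: complex assume s: "norm s \<le> norm (h$j)"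
        have "norm (s *s axis j (1::complex)) \<le> norm h"
          by (rule norm_le_componentwise_cart) (use s in \<open>auto simp: axis_def\<close>)
        then have "dist (?y + s *s axis j 1) z < d2"
          using pn[of A h] h norm_triangle_ineq[of "p A h" "s *s axis j 1"] by (simp add: dist_norm add.assoc)
        then show "norm (dir_deriv (axis j 1) f (?y + s *s axis j 1) - D j) \<le> e/2"
          using d2(2) by (simp add: dist_norm less_imp_le)
      qed
      also have "\<dots> \<le> e/2 * norm h" using e2 by (intro mult_left_mono Finite_Cartesian_Product.norm_nth_le) auto
      finally have 1: "norm (f (?y + h$j *s axis j 1) - f ?y - h$j * D j) \<le> e/2 * norm h" .
      have 2: "norm (f ?y - f z - L A h) \<le> e/2 * norm h" using d1 h by simp
      have "f (z + p (insert j A) h) - f z - L (insert j A) h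
          = (f (?y + h$j *s axis j 1) - f ?y - h$j * D j) + (f ?y - f z - L A h)"
        using insert.hyps by (simp add: L_def p_def algebra_simps)
      then show "norm (f (z + p (insert j A) h) - f z - L (insert j A) h) \<le> e * norm h"
        using norm_triangle_mono[OF 1 2] by (simp only: field_sum_of_halves distrib_right[symmetric])
    qed
  qed
  have pU: "p UNIV h = h" for h by (simp add: vec_eq_iff pcomp)
  have Lc: "L UNIV (c *s v) = c * L UNIV v" for c v
    by (simp add: L_def sum_distrib_left algebra_simps)
  have "linear (L UNIV)"
    by (intro linearI) (simp_all add: L_def sum.distrib distrib_right scaleR_sum_right)
  then have bl: "bounded_linear (L UNIV)" by (simp add: linear_conv_bounded_linear)
  have "(f has_derivative L UNIV) (at z)"
    unfolding has_derivative_at_alt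
  proof (intro conjI bl allI impI)
    fix e :: real assume "0 < e"
    then obtain d where d: "0 < d" "\<And>h. norm h < d \<Longrightarrow> norm (f (z + h) - f z - L UNIV h) \<le> e * norm h"
      using claim[of e UNIV] unfolding pU by blast
    show "\<exists>d>0. \<forall>y. norm (y - z) < d \<longrightarrow> norm (f y - f z - L UNIV (y - z)) \<le> e * norm (y - z)"
      using d(1) d(2)[of "_ - z"] by (intro exI[of _ d]) auto
  qed
  then show "\<exists>f'. (f has_derivative f') (at z) \<and> (\<forall>c v. f' (c *s v) = c * f' v)"
    using Lc by blast
qed

lemma entire_iff_gentire: "entire f \<longleftrightarrow> gentire f"
  using entire_imp_gentire gentire_imp_entire by blast

section \<open>Gaussian lattices\<close>

lemma gaussian_ints_iff: "z \<in> gaussian_ints \<longleftrightarrow> (\<exists>a b::int. z = of_int a + \<i> * of_int b)"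
proof
  assume "z \<in> gaussian_ints"
  then obtain a b :: int where "Re z = of_int a" "Im z = of_int b"
    by (auto simp: gaussian_ints_def Ints_def)
  then have "z = of_int a + \<i> * of_int b" by (simp add: complex_eq_iff)
  then show "\<exists>a b::int. z = of_int a + \<i> * of_int b" by blast
qed (auto simp: gaussian_ints_def)

lemma gaussian_ints_closed [simp]:
  "0 \<in> gaussian_ints" "1 \<in> gaussian_ints" "\<i> \<in> gaussian_ints" "of_int m \<in> gaussian_ints" "of_nat n \<in> gaussian_ints"
  "z \<in> gaussian_ints \<Longrightarrow> - z \<in> gaussian_ints" "z \<in> gaussian_ints \<Longrightarrow> cnj z \<in> gaussian_ints"
  "z \<in> gaussian_ints \<Longrightarrow> w \<in> gaussian_ints \<Longrightarrow> z + w \<in> gaussian_ints"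
  "z \<in> gaussian_ints \<Longrightarrow> w \<in> gaussian_ints \<Longrightarrow> z - w \<in> gaussian_ints"
  "z \<in> gaussian_ints \<Longrightarrow> w \<in> gaussian_ints \<Longrightarrow> z * w \<in> gaussian_ints"
  by (auto simp: gaussian_ints_def)

lemma det_Ints:
  fixes A :: "real ^ 'm ^ 'm"
  assumes "\<And>i j. A $ i $ j \<in> \<int>"
  shows "det A \<in> \<int>"
  unfolding det_def by (intro Ints_sum Ints_mult Ints_prod) (auto simp: assms)

text \<open>The fixed basis supplies integral coordinates, and \<open>det_E\<close> makes
  \<open>E\<close> a perfect pairing on the lattice. Positivity is assumed on lattice vectors and
  extended to the whole space in \<open>H_pos\<close>.\<close>

locale unimodular_lattice =
  fixes \<Gamma> :: "(complex ^ 'n) set" and H :: "complex ^ 'n \<Rightarrow> complex ^ 'n \<Rightarrow> complex"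
    and b :: "'n \<Rightarrow> complex ^ 'n"
  assumes basis: "gaussian_basis b \<Gamma>"
    and H_add_right: "\<And>x y z. H x (y + z) = H x y + H x z"
    and H_smult_right: "\<And>c x y. H x (c *s y) = c * H x y"
    and H_cnj: "\<And>x y. H y x = cnj (H x y)"
    and H_int: "\<And>x y. x \<in> \<Gamma> \<Longrightarrow> y \<in> \<Gamma> \<Longrightarrow> H x y \<in> gaussian_ints"
    and H_pos_lattice: "\<And>x. x \<in> \<Gamma> \<Longrightarrow> x \<noteq> 0 \<Longrightarrow> 0 < Re (H x x)"
    and det_E: "det (gram (form_E H) (underlying_int_basis b)) = 1"
begin

definition bas :: "'n + 'n \<Rightarrow> complex ^ 'n" where "bas = underlying_int_basis b"

text \<open>Real coordinates in the underlying integral basis: integral vectors go to the lattice,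
  so the unit cube becomes a fundamental domain.\<close>

definition lin :: "real ^ ('n + 'n) \<Rightarrow> complex ^ 'n" where
  "lin x = (\<Sum>k\<in>UNIV. x $ k *\<^sub>R bas k)"

lemma H_add_left: "H (x + y) z = H x z + H y z"
  by (metis H_add_right H_cnj complex_cnj_add)

lemma H_smult_left: "H (c *s x) y = cnj c * H x y"
  by (metis H_smult_right H_cnj complex_cnj_mult)

lemma H_zero [simp]: "H x 0 = 0" "H 0 x = 0"
  using H_smult_right[of x 0 0] H_smult_left[of 0 0 x] by simp_all

lemma H_minus [simp]: "H x (- y) = - H x y" "H (- x) y = - H x y"
  using H_smult_right[of x "-1" y] H_smult_left[of "-1" x y] by (simp_all add: vector_sneg_minus1[symmetric])

lemma H_diff: "H x (y - z) = H x y - H x z" "H (x - y) z = H x z - H y z"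
  using H_add_right[of x y "- z"] H_add_left[of x "- y" z] by simp_all

lemmas H_simps = H_add_left H_add_right H_smult_left H_smult_right H_diff

lemma H_scaleR: "H x (r *\<^sub>R y) = r *\<^sub>R H x y" "H (r *\<^sub>R x) y = r *\<^sub>R H x y"
  by (simp_all add: scaleR_vec_smult H_simps) (simp_all add: scaleR_conv_of_real)

lemma H_self_real: "Im (H x x) = 0" "H x x = of_real (Re (H x x))"
proof -
  show "Im (H x x) = 0" using H_cnj[of x x] by (metis complex_cnj_cancel_iff Reals_cnj_iff complex_is_Real_iff)
  then show "H x x = of_real (Re (H x x))" by (simp add: complex_eq_iff)
qed

lemma bounded_bilinear_H: "bounded_bilinear H"
proof -
  have "bilinear H" unfolding bilinear_def
    by (auto intro!: linearI simp: H_simps H_scaleR)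
  then show ?thesis by (simp add: bilinear_conv_bounded_bilinear)
qed

lemmas continuous_on_H [continuous_intros] = bounded_bilinear.continuous_on[OF bounded_bilinear_H]

lemma bas_simps: "bas (Inl k) = b k" "bas (Inr k) = \<i> *s b k"
  by (simp_all add: bas_def underlying_int_basis_def)

lemma linear_lin: "linear lin"
  unfolding lin_def by (intro linearI) (simp_all add: sum.distrib scaleR_left_distrib scaleR_sum_right)

lemma lin_add: "lin (x + y) = lin x + lin y" and lin_diff: "lin (x - y) = lin x - lin y"
  and lin_scale: "lin (r *\<^sub>R x) = r *\<^sub>R lin x" and lin_0 [simp]: "lin 0 = 0" and lin_minus: "lin (- x) = - lin x"
  using linear_lin by (simp_all add: linear_add linear_diff linear_scale linear_0 linear_neg)

lemma continuous_on_lin [continuous_intros]: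
  "continuous_on A f \<Longrightarrow> continuous_on A (\<lambda>x. lin (f x))"
  by (rule continuous_on_compose2[OF linear_continuous_on[of lin UNIV]])
     (simp_all add: linear_lin linear_conv_bounded_linear[symmetric])

lemma lin_complex: "lin x = (\<Sum>k\<in>UNIV. (of_real (x $ Inl k) + \<i> * of_real (x $ Inr k)) *s b k)"
proof -
  have "lin x = (\<Sum>k\<in>UNIV. x $ Inl k *\<^sub>R b k) + (\<Sum>k\<in>UNIV. x $ Inr k *\<^sub>R (\<i> *s b k))"
    unfolding lin_def UNIV_Plus_UNIV[symmetric] by (subst sum.Plus) (simp_all add: bas_simps)
  also have "\<dots> = (\<Sum>k\<in>UNIV. (of_real (x $ Inl k) + \<i> * of_real (x $ Inr k)) *s b k)"
    unfolding sum.distrib[symmetric]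
    by (intro sum.cong refl) (simp add: scaleR_vec_smult vec_eq_iff algebra_simps)
  finally show ?thesis .
qed

lemma inj_b: "inj b" and indep_b: "vec.independent (range b)"
  and Gamma_eq: "\<Gamma> = {\<Sum>k\<in>UNIV. c k *s b k | c. \<forall>k. c k \<in> gaussian_ints}"
  using basis by (auto simp: gaussian_basis_def)

lemma basis_unique:
  assumes "(\<Sum>k\<in>UNIV. c k *s b k) = 0"
  shows "c k = 0"
proof (rule ccontr)
  assume nz: "c k \<noteq> 0"
  have "(\<Sum>v\<in>range b. c (inv b v) *s v) = (\<Sum>k\<in>UNIV. c k *s b k)"
    by (subst sum.reindex[OF inj_b]) (simp add: inj_b)
  then have "vec.dependent (range b)"
    unfolding vec.dependent_finite[OF finite_imageI[OF finite]] using assms nz inj_b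
    by (intro exI[of _ "\<lambda>v. c (inv b v)"]) auto
  then show False using indep_b by simp
qed

lemma inj_lin: "inj lin"
  unfolding linear_injective_0[OF linear_lin]
proof (intro allI impI)
  fix x assume "lin x = 0"
  then have "of_real (x $ Inl k) + \<i> * of_real (x $ Inr k) = 0" for k
    unfolding lin_complex by (rule basis_unique)
  then have "x $ Inl k = 0 \<and> x $ Inr k = 0" for k by (simp add: complex_eq_iff)
  then have "x $ j = 0" for j by (cases j) auto
  then show "x = 0" by (simp add: vec_eq_iff)
qed

lemma surj_lin: "surj lin"
proof -
  have "vec.span (range b) = UNIV"
    using vec.card_ge_dim_independent[of "range b" UNIV] indep_b
    by (simp add: card_image[OF inj_b] vec_dim_card card_cart_basis top.extremum_unique)
  show ?thesis unfolding surj_def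
  proof
    fix z
    have "z \<in> vec.span (range b)" using \<open>vec.span (range b) = UNIV\<close> by simp
    then obtain u where "z = (\<Sum>v\<in>range b. u v *s v)"
      unfolding vec.span_finite[OF finite_imageI[OF finite]] by auto
    then have z: "z = (\<Sum>k\<in>UNIV. u (b k) *s b k)" by (simp add: sum.reindex[OF inj_b])
    have "z = lin (\<chi> j. case j of Inl k \<Rightarrow> Re (u (b k)) | Inr k \<Rightarrow> Im (u (b k)))"
      unfolding lin_complex z by (simp add: complex_eq[symmetric])
    then show "\<exists>x. z = lin x" by blast
  qed
qed

definition coo :: "complex ^ 'n \<Rightarrow> real ^ ('n + 'n)" where "coo = inv lin"

lemma lin_coo [simp]: "lin (coo z) = z" and coo_lin [simp]: "coo (lin x) = x"
  by (simp_all add: coo_def surj_lin surj_f_inv_f inj_lin)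

lemma coo_add: "coo (x + y) = coo x + coo y" and coo_0 [simp]: "coo 0 = 0" and coo_minus: "coo (- x) = - coo x"
  using coo_lin[of "coo x + coo y"] coo_lin[of 0] coo_lin[of "- coo x"]
  by (simp_all add: lin_add lin_minus del: coo_lin)

lemma linear_coo: "linear coo"
proof (intro linearI coo_add)
  show "coo (r *\<^sub>R x) = r *\<^sub>R coo x" for r x
    using coo_lin[of "r *\<^sub>R coo x"] by (simp add: lin_scale del: coo_lin)
qed

lemma Gamma_lin: "\<Gamma> = lin ` {x. \<forall>k. x $ k \<in> \<int>}"
proof (intro equalityI subsetI)
  fix z assume "z \<in> \<Gamma>"
  then obtain c where c: "z = (\<Sum>k\<in>UNIV. c k *s b k)" "\<And>k. c k \<in> gaussian_ints"
    unfolding Gamma_eq by blast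
  let ?x = "\<chi> j. case j of Inl k \<Rightarrow> Re (c k) | Inr k \<Rightarrow> Im (c k)"
  have "z = lin ?x" unfolding lin_complex c(1) by (simp add: complex_eq[symmetric])
  moreover have "?x $ j \<in> \<int>" for j using c(2) by (cases j) (auto simp: gaussian_ints_def)
  ultimately show "z \<in> lin ` {x. \<forall>k. x $ k \<in> \<int>}" by blast
next
  fix z assume "z \<in> lin ` {x. \<forall>k. x $ k \<in> \<int>}"
  then obtain x where x: "z = lin x" "\<And>k. x $ k \<in> \<int>" by blast
  have "of_real (x $ Inl k) + \<i> * of_real (x $ Inr k) \<in> gaussian_ints" for k
    using x(2) by (simp add: gaussian_ints_def)
  then show "z \<in> \<Gamma>" unfolding Gamma_eq x(1) lin_complex
    by (intro CollectI exI[of _ "\<lambda>k. of_real (x $ Inl k) + \<i> * of_real (x $ Inr k)"]) simp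
qed

lemma Gamma_iff: "z \<in> \<Gamma> \<longleftrightarrow> (\<forall>k. coo z $ k \<in> \<int>)"
proof
  assume "\<forall>k. coo z $ k \<in> \<int>"
  then show "z \<in> \<Gamma>" unfolding Gamma_lin by (intro image_eqI[of _ _ "coo z"]) auto
qed (auto simp: Gamma_lin)

lemma Gamma_0 [simp]: "0 \<in> \<Gamma>" and Gamma_add: "x \<in> \<Gamma> \<Longrightarrow> y \<in> \<Gamma> \<Longrightarrow> x + y \<in> \<Gamma>"
  and Gamma_minus: "x \<in> \<Gamma> \<Longrightarrow> - x \<in> \<Gamma>"
  by (simp_all add: Gamma_iff coo_add coo_minus)

lemma Gamma_diff: "x \<in> \<Gamma> \<Longrightarrow> y \<in> \<Gamma> \<Longrightarrow> x - y \<in> \<Gamma>"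
  using Gamma_add[of x "- y"] Gamma_minus[of y] by simp

lemma Gamma_smult: "c \<in> gaussian_ints \<Longrightarrow> x \<in> \<Gamma> \<Longrightarrow> c *s x \<in> \<Gamma>"
proof -
  assume c: "c \<in> gaussian_ints" "x \<in> \<Gamma>"
  obtain d where "x = (\<Sum>k\<in>UNIV. d k *s b k)" "\<And>k. d k \<in> gaussian_ints"
    using c(2) unfolding Gamma_eq by blast
  then have "c *s x = (\<Sum>k\<in>UNIV. (c * d k) *s b k)" "\<And>k. c * d k \<in> gaussian_ints"
    using c(1) by (auto simp: vec_eq_iff sum_distrib_left algebra_simps)
  then show ?thesis unfolding Gamma_eq by (intro CollectI exI[of _ "\<lambda>k. c * d k"]) auto
qed

lemma lin_axis: "lin (axis k 1) = bas k"
  unfolding lin_def by (simp add: axis_def if_distrib[of "\<lambda>r. r *\<^sub>R _"] cong: if_cong)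

lemma bas_in_Gamma: "bas k \<in> \<Gamma>"
  unfolding Gamma_iff lin_axis[symmetric] coo_lin by (simp add: axis_def)

lemma b_in_Gamma: "b k \<in> \<Gamma>"
  using bas_in_Gamma[of "Inl k"] by (simp add: bas_simps)

lemma Gamma_sum: "(\<And>k. k \<in> A \<Longrightarrow> f k \<in> \<Gamma>) \<Longrightarrow> sum f A \<in> \<Gamma>"
  by (induction A rule: infinite_finite_induct) (auto intro: Gamma_add)

section \<open>Duality under E and positivity of H\<close>

abbreviation E :: "complex ^ 'n \<Rightarrow> complex ^ 'n \<Rightarrow> real" where "E x y \<equiv> Im (H x y)"

lemma E_int: "x \<in> \<Gamma> \<Longrightarrow> y \<in> \<Gamma> \<Longrightarrow> E x y \<in> \<int>"
  using H_int[of x y] by (simp add: gaussian_ints_def)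

lemma E_lin: "E z (lin x) = (\<Sum>k\<in>UNIV. x $ k * E z (bas k))" "E (lin x) z = (\<Sum>k\<in>UNIV. x $ k * E (bas k) z)"
proof -
  have 1: "H z (sum f A) = (\<Sum>k\<in>A. H z (f k))" "H (sum f A) z = (\<Sum>k\<in>A. H (f k) z)" for f and A :: "('n + 'n) set"
    by (induction A rule: infinite_finite_induct) (auto simp: H_simps)
  show "E z (lin x) = (\<Sum>k\<in>UNIV. x $ k * E z (bas k))" "E (lin x) z = (\<Sum>k\<in>UNIV. x $ k * E (bas k) z)"
    unfolding lin_def 1 by (simp_all add: H_scaleR)
qed

definition gramT :: "real ^ ('n + 'n) ^ ('n + 'n)" where "gramT = (\<chi> j k. E (bas k) (bas j))"

lemma det_gramT: "det gramT = 1"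
proof -
  have "gramT = transpose (gram (form_E H) (underlying_int_basis b))"
    by (simp add: gramT_def gram_def form_E_def bas_def transpose_def vec_eq_iff)
  then show ?thesis using det_E by simp
qed

lemma gramT_mult: "(gramT *v x) $ j = E (lin x) (bas j)"
  by (simp add: gramT_def matrix_vector_mult_def E_lin mult.commute)

text \<open>Cramer's rule: the denominator is the determinant 1 and the numerators are determinants
  of integral matrices, so the solution is integral.\<close>

lemma exists_dual:
  assumes "\<And>j. k j \<in> \<int>"
  shows "\<exists>\<gamma>\<in>\<Gamma>. \<forall>j. E \<gamma> (bas j) = k j"
proof -
  have d: "det gramT \<noteq> 0" by (simp add: det_gramT)
  define x where "x = (\<chi> l. det (\<chi> i j. if j = l then (\<chi> j. k j) $ i else gramT $ i $ j) / det gramT)"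
  have "gramT *v x = (\<chi> j. k j)" unfolding x_def using cramer[OF d] by blast
  then have "E (lin x) (bas j) = k j" for j using gramT_mult[of x j] by simp
  moreover have "x $ l \<in> \<int>" for l
  proof -
    have "det (\<chi> i j. if j = l then (\<chi> j. k j) $ i else gramT $ i $ j) \<in> \<int>"
      using assms E_int[OF bas_in_Gamma bas_in_Gamma] by (intro det_Ints) (simp add: gramT_def)
    then show ?thesis by (simp add: x_def det_gramT)
  qed
  ultimately show ?thesis by (intro bexI[of _ "lin x"]) (auto simp: Gamma_iff)
qed

lemma E_nondegenerate:
  assumes "\<And>y. E z y = 0"
  shows "z = 0"
proof -
  have d: "det gramT \<noteq> 0" by (simp add: det_gramT)
  have "gramT *v coo z = 0" by (simp add: vec_eq_iff gramT_mult assms)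
  moreover have "gramT *v 0 = 0" by simp
  ultimately have "coo z = 0" unfolding cramer[OF d] by (rule trans[OF _ sym])
  then show ?thesis by (metis lin_0 lin_coo)
qed

text \<open>Rounding down \<open>N + 1\<close> times the coordinates gives lattice vectors, where
  the form is nonnegative; dividing by \<open>N + 1\<close> keeps this, and the quotients converge
  to the given vector.\<close>

lemma H_semidef: "0 \<le> Re (H z z)"
proof -
  define w where "w N = (\<chi> k. real_of_int \<lfloor>real (Suc N) * coo z $ k\<rfloor>)" for N
  define y where "y N = inverse (real (Suc N)) *\<^sub>R w N" for N
  have "(\<lambda>N. inverse (real (Suc N)) * of_int \<lfloor>real (Suc N) * t\<rfloor>) \<longlonglongrightarrow> t" for t :: real
  proof (rule tendsto_sandwich[OF always_eventually always_eventually])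
    show "(\<lambda>N. t - inverse (real (Suc N))) \<longlonglongrightarrow> t"
      using tendsto_diff[OF tendsto_const LIMSEQ_inverse_real_of_nat, of t] by simp
    show "\<forall>N. t - inverse (real (Suc N)) \<le> inverse (real (Suc N)) * of_int \<lfloor>real (Suc N) * t\<rfloor>"
    proof
      fix N
      have "real (Suc N) * t - 1 \<le> of_int \<lfloor>real (Suc N) * t\<rfloor>" by linarith
      then have "inverse (real (Suc N)) * (real (Suc N) * t - 1) \<le> inverse (real (Suc N)) * of_int \<lfloor>real (Suc N) * t\<rfloor>"
        by (rule mult_left_mono) simp
      moreover have "inverse (real (Suc N)) * (real (Suc N) * t - 1) = t - inverse (real (Suc N))"
        by (simp add: field_simps del: of_nat_Suc)
      ultimately show "t - inverse (real (Suc N)) \<le> inverse (real (Suc N)) * of_int \<lfloor>real (Suc N) * t\<rfloor>"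
        by (simp only:)
    qed
    show "\<forall>N. inverse (real (Suc N)) * of_int \<lfloor>real (Suc N) * t\<rfloor> \<le> t"
    proof
      fix N
      have "inverse (real (Suc N)) * of_int \<lfloor>real (Suc N) * t\<rfloor> \<le> inverse (real (Suc N)) * (real (Suc N) * t)"
        by (rule mult_left_mono) auto
      also have "\<dots> = t" by (simp del: of_nat_Suc)
      finally show "inverse (real (Suc N)) * of_int \<lfloor>real (Suc N) * t\<rfloor> \<le> t" .
    qed
  qed simp
  then have y: "y \<longlonglongrightarrow> coo z" by (intro vec_tendstoI) (simp add: y_def w_def)
  have "continuous_on UNIV (\<lambda>x. Re (H (lin x) (lin x)))" by (intro continuous_intros)
  then have "(\<lambda>N. Re (H (lin (y N)) (lin (y N)))) \<longlonglongrightarrow> Re (H (lin (coo z)) (lin (coo z)))"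
    using y by (rule continuous_on_tendsto_compose) auto
  moreover have "0 \<le> Re (H (lin (y N)) (lin (y N)))" for N
  proof -
    have "lin (w N) \<in> \<Gamma>" by (simp add: Gamma_iff w_def)
    then have "0 \<le> Re (H (lin (w N)) (lin (w N)))"
      using H_pos_lattice[of "lin (w N)"] by (cases "lin (w N) = 0") auto
    then show ?thesis by (simp add: y_def lin_scale H_scaleR)
  qed
  ultimately have "0 \<le> Re (H (lin (coo z)) (lin (coo z)))"
    by (intro tendsto_lowerbound[of _ _ sequentially 0]) auto
  then show ?thesis by simp
qed

text \<open>Passing to the limit could lose strictness. But a null vector of a semidefinite form is
  orthogonal to every vector, contradicting the nondegeneracy of \<open>E\<close>.\<close>

lemma H_pos: assumes "z \<noteq> 0" shows "0 < Re (H z z)"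
proof (rule ccontr)
  assume "\<not> 0 < Re (H z z)"
  then have z0: "Re (H z z) = 0" using H_semidef[of z] by linarith
  have "H z y = 0" for y
  proof (rule ccontr)
    assume nz: "H z y \<noteq> 0"
    define h where "h = (norm (H z y))^2"
    define q where "q = Re (H y y)"
    have h: "0 < h" using nz by (simp add: h_def)
    have q: "0 \<le> q" using H_semidef by (simp add: q_def)
    \<comment> \<open>With \<open>c\<close> opposite to the conjugate of \<open>H z y\<close>, the
      linear term of the form at \<open>z + c *s y\<close> is \<open>- 2 e h\<close> and the
      quadratic one \<open>e^2 h q\<close>. The choice of \<open>e\<close> gives
      \<open>e q < 2\<close>, so the negative term wins.\<close>
    define e where "e = 1 / (q + 1)"
    define c where "c = - (of_real e * cnj (H z y))"
    have "Re (H (z + c *s y) (z + c *s y)) = 2 * Re (c * H z y) + (norm c)^2 * q"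
    proof -
      have "H (z + c *s y) (z + c *s y) = H z z + (c * H z y + cnj (c * H z y)) + (c * cnj c) * H y y"
        by (simp add: H_simps algebra_simps H_cnj[of z y])
      also have "c * H z y + cnj (c * H z y) = of_real (2 * Re (c * H z y))" by (rule complex_add_cnj)
      also have "c * cnj c = of_real ((norm c)^2)" by (rule complex_norm_square[symmetric])
      finally show ?thesis using z0 by (simp add: q_def)
    qed
    also have "c * H z y = of_real (- e * h)"
      unfolding c_def h_def of_real_mult complex_norm_square by (simp add: mult.commute)
    also have "(norm c)^2 = e^2 * h" by (simp add: c_def h_def norm_mult power_mult_distrib)
    finally have "0 \<le> - (2 * e * h) + e^2 * h * q" using H_semidef[of "z + c *s y"] by simp
    then have "0 \<le> e * h * (e * q - 2)" by (simp add: power2_eq_square algebra_simps)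
    moreover have "e * q - 2 < 0" "0 < e" using q by (auto simp: e_def field_simps)
    ultimately show False using h mult_pos_neg[of "e * h" "e * q - 2"] by simp
  qed
  then show False using E_nondegenerate[of z] assms by simp
qed

lemma H_coercive: "\<exists>e>0. \<forall>z. e * (norm (coo z))\<^sup>2 \<le> Re (H z z)"
proof -
  let ?f = "\<lambda>x. Re (H (lin x) (lin x))"
  have "continuous_on (sphere 0 1) ?f" by (intro continuous_intros)
  moreover have "sphere (0::real ^ ('n+'n)) 1 \<noteq> {}" by simp
  ultimately obtain x0 where x0: "x0 \<in> sphere 0 1" "\<And>x. x \<in> sphere 0 1 \<Longrightarrow> ?f x0 \<le> ?f x"
    using continuous_attains_inf[OF compact_sphere, of 0 1 ?f] by blast
  have "lin x0 \<noteq> 0" using x0(1) inj_lin linear_injective_0[OF linear_lin] by auto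
  then have pos: "0 < ?f x0" by (rule H_pos)
  show ?thesis
  proof (intro exI conjI allI)
    show "0 < ?f x0" by (rule pos)
    fix z
    show "?f x0 * (norm (coo z))\<^sup>2 \<le> Re (H z z)"
    proof (cases "z = 0")
      case False
      then have n: "coo z \<noteq> 0" by (metis lin_0 lin_coo)
      let ?n = "norm (coo z)"
      have "?f x0 \<le> ?f (inverse ?n *\<^sub>R coo z)" by (rule x0(2)) (use n in simp)
      also have "\<dots> = (inverse ?n)\<^sup>2 * Re (H z z)"
        by (simp add: lin_scale H_scaleR power2_eq_square)
      finally show ?thesis using n by (simp add: field_simps)
    qed simp
  qed
qed

text \<open>By coercivity the quadratic term dominates every linear one. Up to a constant the
  exponent is at most minus the sum of the absolute values of the coordinates, and that series is a
  product of geometric ones.\<close>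

lemma summable_exp_coo:
  assumes a: "0 < a"
  shows "(\<lambda>\<gamma>. exp (- a * Re (H \<gamma> \<gamma>) + B * norm (coo \<gamma>))) summable_on \<Gamma>"
proof -
  obtain e where e: "0 < e" "\<And>z. e * (norm (coo z))\<^sup>2 \<le> Re (H z z)" using H_coercive by blast
  define m where "m = real CARD('n + 'n)"
  \<comment> \<open>The maximum over \<open>t\<close> of \<open>(B + m) t - a e t^2\<close>. The
    additional \<open>m\<close> pays for the sum of the \<open>m\<close> coordinates, each of which
    is at most the norm.\<close>
  define C where "C = (B + m)\<^sup>2 / (4 * (a * e))"
  define p where "p x = (\<Prod>k\<in>UNIV. exp (- \<bar>x $ k\<bar>))" for x :: "real ^ ('n + 'n)"
  have bound: "exp (- a * Re (H \<gamma> \<gamma>) + B * norm (coo \<gamma>)) \<le> exp C * p (coo \<gamma>)" for \<gamma>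
  proof -
    let ?t = "norm (coo \<gamma>)"
    have ae: "0 < a * e" using a e by simp
    have "0 \<le> (2 * (a * e) * ?t - (B + m))\<^sup>2" by simp
    then have "(B + m) * ?t * (4 * (a * e)) \<le> (B + m)\<^sup>2 + (a * e * ?t\<^sup>2) * (4 * (a * e))"
      by (simp add: power2_eq_square algebra_simps)
    also have "(B + m)\<^sup>2 = C * (4 * (a * e))" using ae a e(1) by (simp add: C_def)
    finally have "(B + m) * ?t * (4 * (a * e)) \<le> (C + a * e * ?t\<^sup>2) * (4 * (a * e))"
      by (simp only: distrib_right)
    then have "(B + m) * ?t \<le> C + a * e * ?t\<^sup>2" using ae by (simp only: mult_le_cancel_right)
    moreover have "a * (e * ?t\<^sup>2) \<le> a * Re (H \<gamma> \<gamma>)" using e a by (intro mult_left_mono) auto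
    moreover have "(\<Sum>k\<in>UNIV. \<bar>coo \<gamma> $ k\<bar>) \<le> (\<Sum>k\<in>(UNIV::('n+'n) set). ?t)"
      by (intro sum_mono) (rule component_le_norm_cart)
    ultimately have "- a * Re (H \<gamma> \<gamma>) + B * ?t \<le> C - (\<Sum>k\<in>UNIV. \<bar>coo \<gamma> $ k\<bar>)"
      by (simp add: m_def algebra_simps)
    then have "exp (- a * Re (H \<gamma> \<gamma>) + B * ?t) \<le> exp (C - (\<Sum>k\<in>UNIV. \<bar>coo \<gamma> $ k\<bar>))" by simp
    also have "\<dots> = exp C * p (coo \<gamma>)" by (simp add: p_def exp_sum[symmetric] exp_add[symmetric] sum_negf)
    finally show ?thesis .
  qed
  have geo: "(\<Sum>i\<in>{- int N..int N}. exp (- \<bar>real_of_int i\<bar>)) \<le> 4" for N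
  proof -
    \<comment> \<open>The subtracted term carries the induction: the two new summands together are
      at most \<open>(1/2) ^ N\<close>.\<close>
    have "(\<Sum>i\<in>{- int N..int N}. exp (- \<bar>real_of_int i\<bar>)) \<le> 4 - 2 * (1/2) ^ N"
    proof (induction N)
      case (Suc N)
      have "{- int (Suc N)..int (Suc N)} = insert (int (Suc N)) (insert (- int (Suc N)) {- int N..int N})"
        by auto
      then have "(\<Sum>i\<in>{- int (Suc N)..int (Suc N)}. exp (- \<bar>real_of_int i\<bar>))
          = 2 * exp (- real (Suc N)) + (\<Sum>i\<in>{- int N..int N}. exp (- \<bar>real_of_int i\<bar>))"
        by simp
      moreover have "exp (- real (Suc N)) \<le> (1/2) ^ Suc N"
      proof -
        have "2 \<le> exp (1::real)" using exp_ge_add_one_self[of 1] by simp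
        then have "exp (- 1 :: real) \<le> 1/2" by (simp add: exp_minus field_simps)
        then have "exp (- 1 :: real) ^ Suc N \<le> (1/2) ^ Suc N" by (intro power_mono) auto
        then show ?thesis by (simp add: exp_of_nat_mult[symmetric] del: power_Suc)
      qed
      ultimately show ?case using Suc by simp
    qed simp
    moreover have "0 \<le> (1/2 :: real) ^ N" by simp
    ultimately show ?thesis by linarith
  qed
  \<comment> \<open>A finite set of lattice vectors lies in a box of integral coordinates, and over
    the box the sum of products is a product of sums.\<close>
  have fin: "sum (\<lambda>\<gamma>. p (coo \<gamma>)) F \<le> 4 ^ CARD('n + 'n)" if F: "finite F" "F \<subseteq> \<Gamma>" for F
  proof -
    define f where "f \<gamma> = (\<lambda>k. \<lfloor>coo \<gamma> $ k\<rfloor>)" for \<gamma>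
    have fG: "coo \<gamma> $ k = of_int (f \<gamma> k)" if "\<gamma> \<in> \<Gamma>" for \<gamma> k
    proof -
      have "coo \<gamma> $ k \<in> \<int>" using that Gamma_iff by blast
      then show ?thesis unfolding f_def by (auto elim!: Ints_cases)
    qed
    have inj: "inj_on f \<Gamma>"
    proof (rule inj_onI)
      fix x y assume xy: "x \<in> \<Gamma>" "y \<in> \<Gamma>" "f x = f y"
      have "coo x $ k = coo y $ k" for k using fG[OF xy(1)] fG[OF xy(2)] xy(3) by simp
      then have "coo x = coo y" by (simp add: vec_eq_iff)
      then show "x = y" by (metis lin_coo)
    qed
    define N where "N = nat (Max (insert 0 (\<Union>\<gamma>\<in>F. range (\<lambda>k. \<bar>f \<gamma> k\<bar>))))"
    have fin: "finite (insert 0 (\<Union>\<gamma>\<in>F. range (\<lambda>k. \<bar>f \<gamma> k\<bar>)))" using F by simp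
    have N: "\<bar>f \<gamma> k\<bar> \<le> int N" if "\<gamma> \<in> F" for \<gamma> k
    proof -
      have "\<bar>f \<gamma> k\<bar> \<le> Max (insert 0 (\<Union>\<gamma>\<in>F. range (\<lambda>k. \<bar>f \<gamma> k\<bar>)))"
        by (rule Max_ge[OF fin]) (use that in blast)
      moreover from this have "0 \<le> Max (insert 0 (\<Union>\<gamma>\<in>F. range (\<lambda>k. \<bar>f \<gamma> k\<bar>)))" by linarith
      ultimately show ?thesis by (simp add: N_def)
    qed
    have "sum (\<lambda>\<gamma>. p (coo \<gamma>)) F = sum (\<lambda>\<gamma>. \<Prod>k\<in>UNIV. exp (- \<bar>real_of_int (f \<gamma> k)\<bar>)) F"
    proof (intro sum.cong refl)
      fix \<gamma> assume "\<gamma> \<in> F"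
      then have "\<gamma> \<in> \<Gamma>" using F by blast
      then have "real_of_int (f \<gamma> k) = coo \<gamma> $ k" for k by (rule fG[symmetric])
      then show "p (coo \<gamma>) = (\<Prod>k\<in>UNIV. exp (- \<bar>real_of_int (f \<gamma> k)\<bar>))" by (simp add: p_def)
    qed
    also have "\<dots> = sum (\<lambda>g. \<Prod>k\<in>UNIV. exp (- \<bar>real_of_int (g k)\<bar>)) (f ` F)"
      using inj F by (subst sum.reindex) (auto intro: inj_on_subset)
    also have "\<dots> \<le> sum (\<lambda>g. \<Prod>k\<in>UNIV. exp (- \<bar>real_of_int (g k)\<bar>)) (PiE (UNIV :: ('n + 'n) set) (\<lambda>k. {- int N..int N}))"
    proof (rule sum_mono2)
      show "finite (UNIV \<rightarrow>\<^sub>E {- int N..int N} :: ('n + 'n \<Rightarrow> int) set)" by (intro finite_PiE) auto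
      have "f \<gamma> k \<in> {- int N..int N}" if "\<gamma> \<in> F" for \<gamma> k using N[OF that, of k] by (simp add: abs_le_iff)
      then show "f ` F \<subseteq> UNIV \<rightarrow>\<^sub>E {- int N..int N}" by auto
    qed (simp add: prod_nonneg)
    also have "\<dots> = (\<Prod>k\<in>(UNIV::('n+'n) set). \<Sum>i\<in>{- int N..int N}. exp (- \<bar>real_of_int i\<bar>))"
      by (rule prod_sum_PiE[symmetric]) auto
    also have "\<dots> \<le> (\<Prod>k\<in>(UNIV::('n+'n) set). 4)" using geo by (intro prod_mono conjI sum_nonneg) auto
    finally show ?thesis by simp
  qed
  have "(\<lambda>\<gamma>. p (coo \<gamma>)) summable_on \<Gamma>"
    by (rule nonneg_bdd_above_summable_on)
       (use fin in \<open>auto simp: bdd_above_def p_def intro!: prod_nonneg\<close>)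
  then have "(\<lambda>\<gamma>. exp C * p (coo \<gamma>)) summable_on \<Gamma>" by (rule summable_on_cmult_right)
  then show ?thesis by (rule summable_on_comparison_test) (use bound in auto)
qed

end

section \<open>The mean value of a periodic function\<close>

lemma axis_nth_if: "axis k c $ j = (if j = k then c else 0)"
  by (simp add: axis_def)

lemma integral_translate_cbox:
  fixes f :: "'a::euclidean_space \<Rightarrow> 'b::banach"
  assumes "continuous_on UNIV f"
  shows "integral (cbox a b) (\<lambda>x. f (x + c)) = integral (cbox (a + c) (b + c)) f"
proof -
  have "(f has_integral integral (cbox (a + c) (b + c)) f) (cbox (a + c) (b + c))"
    by (intro integrable_integral integrable_continuous continuous_on_subset[OF assms]) auto
  from has_integral_affinity[OF this, of 1 c]
  have "((\<lambda>x. f (x + c)) has_integral integral (cbox (a + c) (b + c)) f) ((\<lambda>x. x - c) ` cbox (a + c) (b + c))"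
    by simp
  moreover have "(\<lambda>x. x - c) ` cbox (a + c) (b + c) = cbox a b"
    using cbox_translation[of c a b] by (simp add: add.commute image_image)
  ultimately show ?thesis by (metis integral_unique)
qed

text \<open>The cube is cut along the axis at \<open>1 - t\<close>. The translation moves the lower
  piece to the upper end, and periodicity brings the upper piece back to the lower end.\<close>

lemma integral_unit_cube_shift_axis:
  fixes g :: "real ^ 'm \<Rightarrow> complex"
  assumes c: "continuous_on UNIV g" and per: "\<And>x. g (x + axis k 1) = g x" and t: "0 \<le> t" "t \<le> 1"
  shows "integral (cbox 0 1) (\<lambda>x. g (x + t *\<^sub>R axis k 1)) = integral (cbox 0 1) g"
proof -
  let ?e = "axis k (1::real)"
  have ia: "f integrable_on cbox a b" if "continuous_on UNIV f" for f :: "real ^ 'm \<Rightarrow> complex" and a b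
    using that by (intro integrable_continuous) (auto intro: continuous_on_subset)
  have kB: "?e \<in> Basis" by (auto simp: Basis_vec_def)
  have ct: "continuous_on UNIV (\<lambda>x. g (x + u))" for u
    by (intro continuous_on_compose2[OF c] continuous_intros) auto
  have split: "integral (cbox 0 1) f = integral (cbox 0 (1 - (1 - s) *\<^sub>R ?e)) f + integral (cbox (s *\<^sub>R ?e) 1) f"
    if "continuous_on UNIV f" "0 \<le> s" "s \<le> 1" for f :: "real ^ 'm \<Rightarrow> complex" and s
  proof -
    have mem1: "x \<in> cbox 0 (1 - (1 - s) *\<^sub>R ?e) \<longleftrightarrow> x \<in> cbox 0 1 \<inter> {x. x \<bullet> ?e \<le> s}" for x
    proof -
      have "(1 - (1 - s) *\<^sub>R ?e) $ j = (if j = k then s else 1)" for j by (simp add: axis_nth_if)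
      then show ?thesis using that by (auto simp: mem_box_cart inner_axis intro: order_trans split: if_splits)
    qed
    have mem2: "x \<in> cbox (s *\<^sub>R ?e) 1 \<longleftrightarrow> x \<in> cbox 0 1 \<inter> {x. x \<bullet> ?e \<ge> s}" for x
    proof -
      have "(s *\<^sub>R ?e) $ j = (if j = k then s else 0)" for j by (simp add: axis_nth_if)
      then show ?thesis using that by (auto simp: mem_box_cart inner_axis intro: order_trans split: if_splits)
    qed
    have "cbox 0 1 \<inter> {x. x \<bullet> ?e \<le> s} = cbox 0 (1 - (1 - s) *\<^sub>R ?e)"
      "cbox 0 1 \<inter> {x. x \<bullet> ?e \<ge> s} = cbox (s *\<^sub>R ?e) 1"
      using mem1 mem2 by blast+
    then show ?thesis using integral_split[OF ia[OF that(1)] kB, of 0 1 s] by simp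
  qed
  have "integral (cbox 0 1) (\<lambda>x. g (x + t *\<^sub>R ?e)) =
     integral (cbox 0 (1 - t *\<^sub>R ?e)) (\<lambda>x. g (x + t *\<^sub>R ?e)) + integral (cbox ((1 - t) *\<^sub>R ?e) 1) (\<lambda>x. g (x + t *\<^sub>R ?e))"
    using split[OF ct, of "1 - t" "t *\<^sub>R ?e"] t by simp
  also have "integral (cbox 0 (1 - t *\<^sub>R ?e)) (\<lambda>x. g (x + t *\<^sub>R ?e)) = integral (cbox (t *\<^sub>R ?e) 1) g"
    using integral_translate_cbox[OF c, of 0 "1 - t *\<^sub>R ?e" "t *\<^sub>R ?e"] by simp
  also have "integral (cbox ((1 - t) *\<^sub>R ?e) 1) (\<lambda>x. g (x + t *\<^sub>R ?e)) =
     integral (cbox ((1 - t) *\<^sub>R ?e) 1) (\<lambda>x. g (x + (t - 1) *\<^sub>R ?e))"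
  proof (rule integral_cong)
    fix x show "g (x + t *\<^sub>R ?e) = g (x + (t - 1) *\<^sub>R ?e)"
      using per[of "x + (t - 1) *\<^sub>R ?e"] by (simp add: algebra_simps)
  qed
  also have "integral (cbox ((1 - t) *\<^sub>R ?e) 1) (\<lambda>x. g (x + (t - 1) *\<^sub>R ?e)) = integral (cbox 0 (1 - (1 - t) *\<^sub>R ?e)) g"
    using integral_translate_cbox[OF c, of "(1 - t) *\<^sub>R ?e" 1 "(t - 1) *\<^sub>R ?e"] by (simp add: algebra_simps)
  also have "integral (cbox (t *\<^sub>R ?e) 1) g + integral (cbox 0 (1 - (1 - t) *\<^sub>R ?e)) g = integral (cbox 0 1) g"
    using split[OF c t] by simp
  finally show ?thesis .
qed

text \<open>The translation is made one axis at a time by fractional parts; the integral part of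
  \<open>u\<close> is absorbed by periodicity.\<close>

lemma integral_unit_cube_shift:
  fixes g :: "real ^ 'm \<Rightarrow> complex"
  assumes c: "continuous_on UNIV g" and per: "\<And>x m. (\<And>k. m $ k \<in> \<int>) \<Longrightarrow> g (x + m) = g x"
  shows "integral (cbox 0 1) (\<lambda>x. g (x + u)) = integral (cbox 0 1) g"
proof -
  define p where "p A = (\<Sum>k\<in>A. frac (u $ k) *\<^sub>R axis k (1::real))" for A
  have "integral (cbox 0 1) (\<lambda>x. g (x + p A)) = integral (cbox 0 1) g" for A
    using finite[of A]
  proof (induction A rule: finite_induct)
    case empty
    show ?case by (simp add: p_def)
  next
    case (insert k A)
    let ?g = "\<lambda>x. g (x + p A)"
    have "integral (cbox 0 1) (\<lambda>x. ?g (x + frac (u $ k) *\<^sub>R axis k 1)) = integral (cbox 0 1) ?g"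
    proof (rule integral_unit_cube_shift_axis)
      show "continuous_on UNIV ?g" by (intro continuous_on_compose2[OF c] continuous_intros) auto
      show "g (x + axis k 1 + p A) = g (x + p A)" for x
        using per[of "axis k 1" "x + p A"] by (simp add: axis_def algebra_simps)
      show "0 \<le> frac (u $ k)" "frac (u $ k) \<le> 1" by (auto simp: frac_lt_1 less_imp_le)
    qed
    then show ?case using insert by (simp add: p_def algebra_simps)
  qed
  moreover have "g (x + u) = g (x + p UNIV)" for x
  proof -
    have "p UNIV $ k = frac (u $ k)" for k
      unfolding p_def by (simp add: axis_def if_distrib[of "\<lambda>t. _ * t"] cong: if_cong)
    then have "(u - p UNIV) $ k \<in> \<int>" for k by (simp add: frac_def)
    then show ?thesis using per[of "u - p UNIV" "x + p UNIV"] by simp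
  qed
  ultimately show ?thesis by simp
qed

text \<open>The powers of \<open>k\<close> concentrate at \<open>c\<close>.\<close>

lemma integral_cbox_zero_concentrate:
  fixes f :: "real ^ 'm \<Rightarrow> complex" and k :: "real ^ 'm \<Rightarrow> real"
  assumes f: "continuous_on UNIV f" and k: "continuous_on UNIV k"
    and c: "\<And>j. 0 < c $ j \<and> c $ j < 1" and kc: "k c = 1" and k0: "\<And>x. 0 \<le> k x"
    and k1: "\<And>x. x \<in> cbox 0 1 \<Longrightarrow> x \<noteq> c \<Longrightarrow> k x < 1"
    and zero: "\<And>N. integral (cbox 0 1) (\<lambda>x. f x * of_real (k x ^ N)) = 0"
  shows "f c = 0"
proof (rule ccontr)
  assume nz: "f c \<noteq> 0"
  \<comment> \<open>Normalised to have the value 1 at \<open>c\<close>, so that it exceeds 1/2 on a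
    ball around \<open>c\<close>.\<close>
  define h where "h x = Re (f x / f c)" for x
  have hc: "continuous_on A h" for A
    unfolding h_def using nz by (intro continuous_intros continuous_on_subset[OF f]) auto
  have kc': "continuous_on A k" for A using k by (rule continuous_on_subset) auto
  have h1: "h c = 1" using nz by (simp add: h_def)
  have hint: "integral (cbox 0 1) (\<lambda>x. h x * k x ^ N) = 0" for N
  proof -
    have "continuous_on (cbox 0 1) (\<lambda>x. f x * of_real (k x ^ N))"
      by (intro continuous_intros continuous_on_subset[OF f] kc') auto
    then have "((\<lambda>x. f x * of_real (k x ^ N)) has_integral 0) (cbox 0 1)"
      using zero[of N] by (metis integrable_continuous integrable_integral)
    then have "((\<lambda>x. f x * of_real (k x ^ N) * inverse (f c)) has_integral 0 * inverse (f c)) (cbox 0 1)"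
      by (rule has_integral_mult_left)
    from has_integral_linear[OF this bounded_linear_Re] have "((\<lambda>x. Re (f x * of_real (k x ^ N) * inverse (f c))) has_integral Re (0 * inverse (f c))) (cbox 0 1)"
      by (simp only: o_def)
    moreover have "Re (f x * of_real (k x ^ N) * inverse (f c)) = h x * k x ^ N" for x
    proof -
      have eq: "f x * of_real (k x ^ N) * inverse (f c) = of_real (k x ^ N) * (f x / f c)"
        by (simp add: divide_inverse mult_ac)
      have re: "Re (of_real t * w) = t * Re w" for t w by simp
      show ?thesis unfolding h_def eq re by (rule mult.commute)
    qed
    ultimately show ?thesis by (simp add: integral_unique)
  qed
  have "open {x. h x > 1/2}" by (intro open_Collect_less continuous_on_const hc)
  moreover have "c \<in> {x. h x > 1/2}" using h1 by simp
  ultimately obtain d where d: "0 < d" "ball c d \<subseteq> {x. h x > 1/2}"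
    by (rule openE)
  let ?K = "cbox 0 1 - ball c d"
  obtain r where r: "0 \<le> r" "r < 1" "\<And>x. x \<in> ?K \<Longrightarrow> k x \<le> r"
  proof (cases "?K = {}")
    case True
    then show ?thesis using that[of 0] by (simp only: empty_iff)
  next
    case False
    have "compact ?K" by (intro compact_diff compact_cbox open_ball)
    then obtain x0 where "x0 \<in> ?K" "\<And>x. x \<in> ?K \<Longrightarrow> k x \<le> k x0"
      using continuous_attains_sup[OF _ False kc'] by blast
    moreover from this have "x0 \<noteq> c" "x0 \<in> cbox 0 1" using d(1) by auto
    ultimately show ?thesis using that[OF k0 k1] by blast
  qed
  \<comment> \<open>Strictly between \<open>r\<close> and 1: \<open>k\<close> exceeds
    \<open>s\<close> on a whole box around \<open>c\<close> and is at most \<open>r\<close> outside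
    the ball. As \<open>r / s\<close> is less than 1, the outside becomes negligible for high
    powers.\<close>
  define s where "s = (1 + r) / 2"
  have s: "r < s" "s < 1" "0 < s" using r by (auto simp: s_def)
  have "open ({x. k x > s} \<inter> ball c d \<inter> box 0 1)"
    by (intro open_Int open_ball open_box open_Collect_less continuous_on_const kc')
  moreover have "c \<in> {x. k x > s} \<inter> ball c d \<inter> box 0 1"
    using kc s d c by (simp add: mem_box_cart)
  ultimately obtain a b where ab: "c \<in> box a b" "cbox a b \<subseteq> {x. k x > s} \<inter> ball c d \<inter> box 0 1"
    by (rule open_contains_cbox) blast
  define v where "v = measure lborel (cbox a b)"
  have v: "0 < v" unfolding v_def using ab(1) by (auto simp: content_pos_lt_eq mem_box)
  have sub: "cbox a b \<subseteq> cbox 0 1" using ab(2) box_subset_cbox[of 0 1] by blast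
  obtain B where B: "0 < B" "\<And>x. x \<in> cbox 0 1 \<Longrightarrow> \<bar>h x\<bar> \<le> B"
    using compact_imp_bounded[OF compact_continuous_image[OF hc compact_cbox]]
    unfolding bounded_pos by (metis imageI real_norm_def)
  have lower: "s ^ N / 2 * v \<le> B * r ^ N" for N
  proof -
    let ?g = "\<lambda>x. (if x \<in> cbox a b then s ^ N / 2 else 0) - B * r ^ N"
    have g1: "((\<lambda>x. if x \<in> cbox a b then s ^ N / 2 else 0) has_integral v *\<^sub>R (s ^ N / 2)) (cbox 0 1)"
      unfolding has_integral_restrict[OF sub] v_def by (rule has_integral_const)
    have "(?g has_integral v *\<^sub>R (s ^ N / 2) - measure lborel (cbox (0::real^'m) 1) *\<^sub>R (B * r ^ N)) (cbox 0 1)"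
      by (intro has_integral_diff g1 has_integral_const)
    moreover have "((\<lambda>x. h x * k x ^ N) has_integral 0) (cbox 0 1)"
      using hint[of N] by (metis integrable_integral integrable_continuous hc kc' continuous_on_mult continuous_on_power)
    ultimately have "v *\<^sub>R (s ^ N / 2) - measure lborel (cbox (0::real^'m) 1) *\<^sub>R (B * r ^ N) \<le> 0"
    proof (rule has_integral_le)
      fix x :: "real ^ 'm" assume x: "x \<in> cbox 0 1"
      have rN: "0 \<le> B * r ^ N" using B r by simp
      show "?g x \<le> h x * k x ^ N"
      proof (cases "x \<in> ball c d")
        case True
        then have hx: "1/2 \<le> h x" using d by auto
        have "s ^ N \<le> k x ^ N" if "x \<in> cbox a b"
          using that ab(2) s by (intro power_mono) auto
        moreover have "1/2 * k x ^ N \<le> h x * k x ^ N" using hx k0 by (intro mult_right_mono) auto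
        moreover have "0 \<le> k x ^ N" using k0 by simp
        ultimately show ?thesis using rN by auto
      next
        case False
        then have "k x ^ N \<le> r ^ N" using x r k0 by (intro power_mono) auto
        then have "\<bar>h x * k x ^ N\<bar> \<le> B * r ^ N"
          unfolding abs_mult using B(2)[OF x] k0 by (intro mult_mono) auto
        moreover have "x \<notin> cbox a b" using False ab by auto
        ultimately show ?thesis by auto
      qed
    qed
    moreover have "measure lborel (cbox (0::real^'m) 1) = 1"
      by (subst content_cbox_cart) (auto simp: interval_ne_empty_cart)
    ultimately show ?thesis by (simp add: mult.commute)
  qed
  have "(\<lambda>N. (r / s) ^ N) \<longlonglongrightarrow> 0" using r s by (intro LIMSEQ_power_zero) auto
  then have "(\<lambda>N. B * (r / s) ^ N) \<longlonglongrightarrow> B * 0" by (intro tendsto_mult tendsto_const)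
  moreover have "v / 2 \<le> B * (r / s) ^ N" for N
    using lower[of N] s by (simp add: power_divide field_simps)
  ultimately have "v / 2 \<le> B * 0" by (intro LIMSEQ_le_const) auto
  then show False using v by simp
qed

context unimodular_lattice
begin

text \<open>The integral over the torus in lattice coordinates, which give it total mass 1.\<close>

definition mean :: "(complex ^ 'n \<Rightarrow> complex) \<Rightarrow> complex" where
  "mean f = integral (cbox 0 1) (\<lambda>x. f (lin x))"

definition periodic :: "(complex ^ 'n \<Rightarrow> complex) \<Rightarrow> bool" where
  "periodic f \<longleftrightarrow> (\<forall>\<gamma>\<in>\<Gamma>. \<forall>z. f (z + \<gamma>) = f z)"

lemma periodicD: "periodic f \<Longrightarrow> \<gamma> \<in> \<Gamma> \<Longrightarrow> f (z + \<gamma>) = f z"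
  by (simp add: periodic_def)

lemma mean_integrable:
  fixes f :: "complex ^ 'n \<Rightarrow> complex"
  assumes "continuous_on UNIV f"
  shows "(\<lambda>x. f (lin x)) integrable_on (cbox u v)"
  by (intro integrable_continuous continuous_on_compose2[OF assms] continuous_intros) auto

lemma mean_translate:
  assumes c: "continuous_on UNIV f" and p: "periodic f"
  shows "mean (\<lambda>z. f (z + w)) = mean f"
proof -
  have "integral (cbox 0 1) (\<lambda>x. (\<lambda>x. f (lin x)) (x + coo w)) = integral (cbox 0 1) (\<lambda>x. f (lin x))"
  proof (rule integral_unit_cube_shift)
    show "continuous_on UNIV (\<lambda>x. f (lin x))"
      by (intro continuous_on_compose2[OF c] continuous_intros) auto
    show "f (lin (x + m)) = f (lin x)" if "\<And>k. m $ k \<in> \<int>" for x m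
      using periodicD[OF p, of "lin m" "lin x"] that by (simp add: lin_add Gamma_iff)
  qed
  then show ?thesis by (simp add: mean_def lin_add)
qed

lemma mean_const [simp]: "mean (\<lambda>z. c) = c"
proof -
  have "measure lborel (cbox (0::real^('n+'n)) 1) = 1"
    by (subst content_cbox_cart) (auto simp: interval_ne_empty_cart)
  then show ?thesis by (simp add: mean_def)
qed

lemma mean_add:
  assumes "continuous_on UNIV f" "continuous_on UNIV g"
  shows "mean (\<lambda>z. f z + g z) = mean f + mean g"
  unfolding mean_def by (intro integral_add mean_integrable assms)

lemma mean_cmult: "mean (\<lambda>z. c * f z) = c * mean f"
  by (simp add: mean_def)

lemma mean_sum:
  assumes "finite I" "\<And>i. i \<in> I \<Longrightarrow> continuous_on UNIV (f i)"
  shows "mean (\<lambda>z. \<Sum>i\<in>I. f i z) = (\<Sum>i\<in>I. mean (f i))"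
  unfolding mean_def using assms by (intro integral_sum mean_integrable) auto

text \<open>Adding \<open>u\<close> to the argument does not change the mean over \<open>z\<close>,
  as it amounts to translating \<open>z\<close> by \<open>u / N\<close>. Averaging over
  \<open>u\<close> and exchanging the two integrals makes the factor \<open>N\<close>
  disappear.\<close>

lemma mean_cmult_arg:
  assumes c: "continuous_on UNIV f" and p: "periodic f" and N: "0 < N"
  shows "mean (\<lambda>z. f (of_nat N *s z)) = mean f"
proof -
  have c': "continuous_on UNIV (\<lambda>z. f (of_nat N *s z))"
    by (intro continuous_on_compose2[OF c] continuous_intros) auto
  have p': "periodic (\<lambda>z. f (of_nat N *s z))"
    unfolding periodic_def vector_add_ldistrib by (auto intro!: periodicD[OF p] Gamma_smult)
  have 1: "mean (\<lambda>z. f (of_nat N *s z + u)) = mean (\<lambda>z. f (of_nat N *s z))" for u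
    using mean_translate[OF c' p', of "inverse (of_nat N) *s u"] N by (simp add: vector_add_ldistrib vector_smult_assoc)
  have 2: "mean (\<lambda>u. f (w + u)) = mean f" for w
    using mean_translate[OF c p, of w] by (simp add: add.commute)
  have "mean (\<lambda>u. mean (\<lambda>z. f (of_nat N *s z + u))) = mean (\<lambda>z. mean (\<lambda>u. f (of_nat N *s z + u)))"
    unfolding mean_def
    by (rule integral_swap_continuous)
       (auto simp: case_prod_unfold intro!: continuous_on_compose2[OF c] continuous_intros)
  then show ?thesis by (simp add: 1 2)
qed

section \<open>Characters of the torus and completeness of Fourier series\<close>

definition chr :: "complex ^ 'n \<Rightarrow> complex ^ 'n \<Rightarrow> complex" where
  "chr \<gamma> z = exp (2 * of_real pi * \<i> * of_real (E \<gamma> z))"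

lemma chr_add_left: "chr (\<gamma> + \<delta>) z = chr \<gamma> z * chr \<delta> z"
  and chr_add_right: "chr \<gamma> (z + w) = chr \<gamma> z * chr \<gamma> w"
  by (simp_all add: chr_def H_simps exp_add[symmetric] algebra_simps)

lemma chr_0 [simp]: "chr 0 z = 1" "chr \<gamma> 0 = 1" by (simp_all add: chr_def)

lemma chr_nonzero [simp]: "chr \<gamma> z \<noteq> 0" by (simp add: chr_def)

lemma continuous_chr [continuous_intros]: "continuous_on A f \<Longrightarrow> continuous_on A (\<lambda>z. chr \<gamma> (f z))"
  unfolding chr_def by (intro continuous_intros)

lemma chr_lattice: "\<gamma> \<in> \<Gamma> \<Longrightarrow> \<delta> \<in> \<Gamma> \<Longrightarrow> chr \<gamma> \<delta> = 1"
  using E_int[of \<gamma> \<delta>] exp_integer_2pi[of "of_real (E \<gamma> \<delta>)"]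
  by (auto simp: chr_def mult_ac elim!: Ints_cases)

lemma periodic_chr: "\<gamma> \<in> \<Gamma> \<Longrightarrow> periodic (chr \<gamma>)"
  by (simp add: periodic_def chr_add_right chr_lattice)

lemma periodic_mult: "periodic f \<Longrightarrow> periodic g \<Longrightarrow> periodic (\<lambda>z. f z * g z)"
  by (simp add: periodic_def)

text \<open>Translation by a vector at which \<open>E \<gamma>\<close> takes the value 1/2 changes
  the sign of the character but not its mean.\<close>

lemma mean_chr:
  assumes "\<gamma> \<in> \<Gamma>" "\<gamma> \<noteq> 0"
  shows "mean (chr \<gamma>) = 0"
proof -
  have p: "0 < Re (H \<gamma> \<gamma>)" using assms(2) by (rule H_pos)
  let ?w = "(\<i> / (2 * of_real (Re (H \<gamma> \<gamma>)))) *s \<gamma>"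
  have "H \<gamma> \<gamma> \<noteq> 0" using p by auto
  then have "H \<gamma> ?w = \<i> / 2" using p H_self_real(2)[of \<gamma>] by (simp add: H_simps field_simps)
  then have "E \<gamma> ?w = 1 / 2" by (simp only:) simp
  then have "chr \<gamma> ?w = -1" unfolding chr_def by (simp only:) simp
  then have "mean (\<lambda>z. chr \<gamma> (z + ?w)) = - mean (chr \<gamma>)"
    using mean_cmult[of "-1" "chr \<gamma>"] by (simp add: chr_add_right mult.commute)
  moreover have "mean (\<lambda>z. chr \<gamma> (z + ?w)) = mean (chr \<gamma>)"
    by (intro mean_translate periodic_chr assms continuous_intros)
  ultimately show ?thesis by simp
qed

text \<open>
  This property holds for the characters and is inherited by sums and products, hence it
  holds for all trigonometric polynomials.
\<close>

definition trig_mult :: "(complex ^ 'n \<Rightarrow> complex) \<Rightarrow> bool" where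
  "trig_mult g \<longleftrightarrow> continuous_on UNIV g \<and>
     (\<forall>h. continuous_on UNIV h \<longrightarrow> (\<forall>\<gamma>\<in>\<Gamma>. mean (\<lambda>z. h z * chr \<gamma> z) = 0) \<longrightarrow>
       (\<forall>\<gamma>\<in>\<Gamma>. mean (\<lambda>z. (h z * g z) * chr \<gamma> z) = 0))"

lemma trig_mult_chr: "\<delta> \<in> \<Gamma> \<Longrightarrow> trig_mult (chr \<delta>)"
  by (auto simp: trig_mult_def mult.assoc chr_add_left[symmetric] intro!: continuous_intros Gamma_add)

lemma trig_mult_cont: "trig_mult f \<Longrightarrow> continuous_on UNIV f"
  by (simp add: trig_mult_def)

lemma trig_multD:
  "trig_mult f \<Longrightarrow> continuous_on UNIV h \<Longrightarrow> (\<And>\<gamma>. \<gamma> \<in> \<Gamma> \<Longrightarrow> mean (\<lambda>z. h z * chr \<gamma> z) = 0) \<Longrightarrow>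
    \<gamma> \<in> \<Gamma> \<Longrightarrow> mean (\<lambda>z. (h z * f z) * chr \<gamma> z) = 0"
  by (simp add: trig_mult_def)

lemma trig_multI:
  assumes "continuous_on UNIV f"
    "\<And>h \<gamma>. continuous_on UNIV h \<Longrightarrow> (\<And>\<gamma>. \<gamma> \<in> \<Gamma> \<Longrightarrow> mean (\<lambda>z. h z * chr \<gamma> z) = 0) \<Longrightarrow> \<gamma> \<in> \<Gamma> \<Longrightarrow>
      mean (\<lambda>z. (h z * f z) * chr \<gamma> z) = 0"
  shows "trig_mult f"
  using assms by (simp add: trig_mult_def)

lemma trig_mult_add:
  assumes f: "trig_mult f" and g: "trig_mult g" shows "trig_mult (\<lambda>z. f z + g z)"
proof (rule trig_multI)
  show "continuous_on UNIV (\<lambda>z. f z + g z)" by (intro continuous_intros trig_mult_cont f g)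
  fix h \<gamma> assume h: "continuous_on UNIV h" "\<And>\<gamma>. \<gamma> \<in> \<Gamma> \<Longrightarrow> mean (\<lambda>z. h z * chr \<gamma> z) = 0" and \<gamma>: "\<gamma> \<in> \<Gamma>"
  have "mean (\<lambda>z. (h z * f z) * chr \<gamma> z + (h z * g z) * chr \<gamma> z) = 0"
    using trig_multD[OF f h \<gamma>] trig_multD[OF g h \<gamma>] trig_mult_cont[OF f] trig_mult_cont[OF g] h(1)
    by (subst mean_add) (auto intro!: continuous_intros)
  then show "mean (\<lambda>z. (h z * (f z + g z)) * chr \<gamma> z) = 0" by (simp add: algebra_simps)
qed

lemma trig_mult_cmult:
  assumes "trig_mult f" shows "trig_mult (\<lambda>z. c * f z)"
proof -
  have "mean (\<lambda>z. h z * (c * f z) * chr \<gamma> z) = c * mean (\<lambda>z. h z * f z * chr \<gamma> z)" for h \<gamma>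
    unfolding mean_cmult[symmetric] by (simp add: mult_ac)
  then show ?thesis using assms unfolding trig_mult_def by (auto intro!: continuous_intros)
qed

lemma trig_mult_mult:
  assumes f: "trig_mult f" and g: "trig_mult g" shows "trig_mult (\<lambda>z. f z * g z)"
proof (rule trig_multI)
  show "continuous_on UNIV (\<lambda>z. f z * g z)" by (intro continuous_intros trig_mult_cont f g)
  fix h \<gamma> assume h: "continuous_on UNIV h" "\<And>\<gamma>. \<gamma> \<in> \<Gamma> \<Longrightarrow> mean (\<lambda>z. h z * chr \<gamma> z) = 0" and \<gamma>: "\<gamma> \<in> \<Gamma>"
  have "mean (\<lambda>z. ((h z * f z) * g z) * chr \<gamma> z) = 0"
    by (intro trig_multD[OF g] trig_multD[OF f] continuous_intros h \<gamma> trig_mult_cont f)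
  then show "mean (\<lambda>z. (h z * (f z * g z)) * chr \<gamma> z) = 0" by (simp add: mult.assoc)
qed

lemma trig_mult_const: "trig_mult (\<lambda>z. c)"
  using trig_mult_cmult[OF trig_mult_chr[OF Gamma_0], of c] by simp

lemma trig_mult_prod: "finite A \<Longrightarrow> (\<And>k. k \<in> A \<Longrightarrow> trig_mult (f k)) \<Longrightarrow> trig_mult (\<lambda>z. \<Prod>k\<in>A. f k z)"
  by (induction A rule: finite_induct) (auto intro: trig_mult_mult trig_mult_const)

lemma trig_mult_power: "trig_mult f \<Longrightarrow> trig_mult (\<lambda>z. f z ^ N)"
  by (induction N) (auto intro: trig_mult_mult trig_mult_const)

text \<open>Unimodularity enters here: some lattice vector represents the coordinate
  \<open>k\<close> through \<open>E\<close>, so that the squared sine is a combination of 1 and two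
  opposite characters.\<close>

lemma trig_mult_sin2: "trig_mult (\<lambda>z. of_real ((sin (pi * coo z $ k))\<^sup>2))"
proof -
  have "\<exists>\<gamma>\<in>\<Gamma>. \<forall>j. E \<gamma> (bas j) = (if j = k then 1 else 0)" by (rule exists_dual) auto
  then obtain \<gamma> where \<gamma>: "\<gamma> \<in> \<Gamma>" "\<And>j. E \<gamma> (bas j) = (if j = k then 1 else 0)" by blast
  have E: "E \<gamma> z = coo z $ k" for z
  proof -
    have "E \<gamma> (lin (coo z)) = coo z $ k" unfolding E_lin \<gamma>(2) by (simp add: if_distrib cong: if_cong)
    then show ?thesis by simp
  qed
  have "of_real ((sin (pi * coo z $ k))\<^sup>2) = 1/2 + (-1/4) * (chr \<gamma> z + chr (- \<gamma>) z)" for z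
  proof -
    have "chr \<gamma> z + chr (- \<gamma>) z = of_real (2 * cos (2 * (pi * coo z $ k)))"
      by (simp add: chr_def E exp_Euler[symmetric] cos_of_real[symmetric] cos_exp_eq mult_ac)
    moreover have "(sin a)\<^sup>2 = 1/2 + (-1/4) * (2 * cos (2 * a))" for a :: real
      unfolding cos_double_sin by (simp add: field_simps)
    ultimately show ?thesis
      by (simp only: of_real_add of_real_mult of_real_divide of_real_minus of_real_1 of_real_numeral)
  qed
  moreover have "trig_mult (\<lambda>z. 1/2 + (-1/4) * (chr \<gamma> z + chr (- \<gamma>) z))"
    using \<gamma>(1) by (intro trig_mult_add trig_mult_cmult trig_mult_const trig_mult_chr Gamma_minus)
  ultimately show ?thesis by simp
qed

text \<open>On the unit cube the product of the squared sines attains its maximum 1 only at the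
  centre. Its powers are trigonometric polynomials, so the integrals in
  \<open>integral_cbox_zero_concentrate\<close> all vanish.\<close>

lemma fourier_complete_centre:
  assumes c: "continuous_on UNIV f" and z: "\<And>\<gamma>. \<gamma> \<in> \<Gamma> \<Longrightarrow> mean (\<lambda>z. f z * chr \<gamma> z) = 0"
  shows "f (lin (\<chi> j. 1/2)) = 0"
proof -
  define k where "k x = (\<Prod>j\<in>UNIV. (sin (pi * x $ j))\<^sup>2)" for x :: "real ^ ('n + 'n)"
  have sin1: "(sin t)\<^sup>2 \<le> 1" for t :: real by (simp add: abs_square_le_1)
  show ?thesis
  proof (rule integral_cbox_zero_concentrate[of "\<lambda>x. f (lin x)" k])
    show "continuous_on UNIV (\<lambda>x. f (lin x))"
      by (intro continuous_on_compose2[OF c] continuous_intros) auto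
    show "continuous_on UNIV k" unfolding k_def by (intro continuous_intros)
    show "k (\<chi> j. 1/2) = 1" by (simp add: k_def)
    show "0 \<le> k x" for x by (auto simp: k_def intro: prod_nonneg)
    show "k x < 1" if x: "x \<in> cbox 0 1" "x \<noteq> (\<chi> j. 1/2)" for x
    proof -
      obtain j where j: "x $ j \<noteq> 1/2" using x(2) by (auto simp: vec_eq_iff)
      have xj: "0 \<le> x $ j" "x $ j \<le> 1" using x(1) by (auto simp: mem_box_cart)
      have "(sin (pi * x $ j))\<^sup>2 \<noteq> 1"
      proof
        assume "(sin (pi * x $ j))\<^sup>2 = 1"
        then have "cos (pi * x $ j) = 0" using sin_cos_squared_add[of "pi * x $ j"] by simp
        moreover have "cos (pi * x $ j) = cos (pi / 2) \<longrightarrow> pi * x $ j = pi / 2"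
          using xj cos_inj_pi[of "pi * x $ j" "pi / 2"] by (simp add: mult_left_le)
        ultimately show False using j by simp
      qed
      then have 1: "(sin (pi * x $ j))\<^sup>2 < 1" using sin1 less_le by blast
      have "k x = (sin (pi * x $ j))\<^sup>2 * (\<Prod>j\<in>UNIV - {j}. (sin (pi * x $ j))\<^sup>2)"
        unfolding k_def by (simp add: prod.remove)
      also have "\<dots> \<le> (sin (pi * x $ j))\<^sup>2 * 1"
        by (intro mult_left_mono prod_le_1) (auto simp: sin1)
      finally show ?thesis using 1 by simp
    qed
    show "integral (cbox 0 1) (\<lambda>x. f (lin x) * of_real (k x ^ N)) = 0" for N
    proof -
      have "trig_mult (\<lambda>z. (\<Prod>j\<in>UNIV. of_real ((sin (pi * coo z $ j))\<^sup>2)) ^ N)"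
        by (intro trig_mult_power trig_mult_prod trig_mult_sin2) simp
      then have "mean (\<lambda>z. (f z * (\<Prod>j\<in>UNIV. of_real ((sin (pi * coo z $ j))\<^sup>2)) ^ N) * chr 0 z) = 0"
        by (rule trig_multD[OF _ c z Gamma_0])
      then show ?thesis by (simp add: mean_def k_def)
    qed
  qed simp
qed

text \<open>Any point can be translated to the centre of the cube; this multiplies each Fourier
  coefficient by a nonzero number.\<close>

lemma fourier_complete:
  assumes c: "continuous_on UNIV f" and p: "periodic f"
    and z: "\<And>\<gamma>. \<gamma> \<in> \<Gamma> \<Longrightarrow> mean (\<lambda>z. f z * chr \<gamma> z) = 0"
  shows "f w = 0"
proof -
  define u where "u = w - lin (\<chi> j. 1/2)"
  have "f (lin (\<chi> j. 1/2) + u) = 0"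
  proof (rule fourier_complete_centre)
    show "continuous_on UNIV (\<lambda>z. f (z + u))" by (intro continuous_on_compose2[OF c] continuous_intros) auto
    fix \<gamma> assume \<gamma>: "\<gamma> \<in> \<Gamma>"
    have "mean (\<lambda>z. f (z + u) * chr \<gamma> (z + u)) = 0"
      using mean_translate[of "\<lambda>z. f z * chr \<gamma> z" u] z[OF \<gamma>] c p \<gamma>
      by (simp add: continuous_intros periodic_mult periodic_chr)
    moreover have "mean (\<lambda>z. f (z + u) * chr \<gamma> (z + u)) = chr \<gamma> u * mean (\<lambda>z. f (z + u) * chr \<gamma> z)"
      unfolding mean_cmult[symmetric] by (simp add: chr_add_right mult_ac)
    ultimately show "mean (\<lambda>z. f (z + u) * chr \<gamma> z) = 0" by simp
  qed
  then show ?thesis by (simp add: u_def)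
qed

end

section \<open>Uniqueness of theta functions\<close>

text \<open>Near \<open>v\<close> the first factor has no zeros, so the second one vanishes there,
  and the identity theorem carries this along the line from \<open>v\<close> to
  \<open>z\<close>.\<close>

lemma gentire_mult_eq_0:
  fixes f g :: "complex ^ 'n \<Rightarrow> complex"
  assumes f: "gentire f" and g: "gentire g" and fg: "\<And>z. f z * g z = 0" and v: "f v \<noteq> 0"
  shows "g z = 0"
proof -
  let ?f = "\<lambda>t. f (v + t *s (z - v))" and ?g = "\<lambda>t. g (v + t *s (z - v))"
  have "continuous_on UNIV ?f" using gentire_holo[OF f] by (rule holomorphic_on_imp_continuous_on)
  then have "open {t. ?f t \<noteq> 0}" by (intro open_Collect_neq continuous_on_const)
  moreover have "0 \<in> {t. ?f t \<noteq> 0}" using v by simp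
  ultimately obtain e where e: "0 < e" "ball 0 e \<subseteq> {t. ?f t \<noteq> 0}"
    using open_contains_ball by blast
  have "?g 1 = 0"
  proof (rule analytic_continuation[of ?g UNIV "ball 0 e" 0])
    show "?g holomorphic_on UNIV" by (rule gentire_holo[OF g])
    show "(0::complex) islimpt ball 0 e" using e(1) by (simp add: islimpt_ball)
    show "?g t = 0" if "t \<in> ball 0 e" for t
    proof -
      have "?f t \<noteq> 0" using that e(2) by blast
      then show ?thesis using fg by (metis mult_eq_0_iff)
    qed
  qed auto
  then show ?thesis by simp
qed

text \<open>The derivative of the conjugate is both complex linear and antilinear; comparing its
  values at 1 and \<open>\<i>\<close> shows that it is zero.\<close>

lemma holomorphic_cnj_imp_const:
  assumes h: "h holomorphic_on UNIV" and k: "(\<lambda>s. cnj (h s)) holomorphic_on UNIV"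
  shows "h s = h t"
proof -
  have "(h has_field_derivative 0) (at s)" for s
  proof -
    obtain a where a: "(h has_field_derivative a) (at s)"
      using h unfolding holomorphic_on_open[OF open_UNIV] by blast
    obtain d where d: "((\<lambda>s. cnj (h s)) has_field_derivative d) (at s)"
      using k unfolding holomorphic_on_open[OF open_UNIV] by blast
    have "((\<lambda>s. cnj (h s)) has_derivative (\<lambda>x. cnj (a * x))) (at s)"
      using a unfolding has_field_derivative_def
      by (rule bounded_linear.has_derivative[OF bounded_linear_cnj])
    then have eq: "(\<lambda>x. cnj (a * x)) = (*) d"
      using d unfolding has_field_derivative_def by (rule has_derivative_unique)
    have "cnj a = d" "cnj a * (- \<i>) = d * \<i>"
      using fun_cong[OF eq, of 1] fun_cong[OF eq, of \<i>] by simp_all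
    then have "a = 0" by (auto simp: complex_eq_iff)
    then show ?thesis using a by simp
  qed
  then have "\<exists>c. \<forall>x\<in>UNIV. h x = c" by (intro has_field_derivative_zero_constant) auto
  then show ?thesis by auto
qed

context unimodular_lattice
begin

lemma cnj_H: "cnj (H x y) = H y x"
  by (rule H_cnj[symmetric])

lemma chr_eq: "chr \<gamma> z = exp (of_real pi * (H \<gamma> z - H z \<gamma>))"
  using complex_diff_cnj[of "H \<gamma> z"] by (simp add: chr_def cnj_H mult_ac)

definition theta_space :: "(complex ^ 'n \<Rightarrow> complex) \<Rightarrow> (complex ^ 'n \<Rightarrow> complex) set" where
  "theta_space \<psi> = {\<theta>. gentire \<theta> \<and> (\<forall>\<gamma>\<in>\<Gamma>. \<forall>z. \<theta> (z + \<gamma>) = automorphy_factor H \<psi> \<gamma> z * \<theta> z)}"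

lemma theta_function_iff: "theta_function \<Gamma> H \<psi> \<theta> \<longleftrightarrow> \<theta> \<in> theta_space \<psi> \<and> (\<exists>z. \<theta> z \<noteq> 0)"
  by (auto simp: theta_function_def theta_space_def entire_iff_gentire)

lemma automorphy_factor_eq:
  "automorphy_factor H \<psi> \<gamma> z = \<psi> \<gamma> * exp (of_real pi * H \<gamma> z + of_real pi / 2 * H \<gamma> \<gamma>)"
  by (simp add: automorphy_factor_def H_simps algebra_simps)

lemma theta_gentire: "\<theta> \<in> theta_space \<psi> \<Longrightarrow> gentire \<theta>"
  by (simp add: theta_space_def)

lemma theta_shift: "\<theta> \<in> theta_space \<psi> \<Longrightarrow> \<gamma> \<in> \<Gamma> \<Longrightarrow>
    \<theta> (z + \<gamma>) = \<psi> \<gamma> * exp (of_real pi * H \<gamma> z + of_real pi / 2 * H \<gamma> \<gamma>) * \<theta> z"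
  by (simp add: theta_space_def automorphy_factor_eq)

lemma theta_space_add: "f \<in> theta_space \<psi> \<Longrightarrow> g \<in> theta_space \<psi> \<Longrightarrow> (\<lambda>z. f z + g z) \<in> theta_space \<psi>"
  by (simp add: theta_space_def gentire_add distrib_left)

lemma theta_space_cmult: "f \<in> theta_space \<psi> \<Longrightarrow> (\<lambda>z. c * f z) \<in> theta_space \<psi>"
  using gentire_mult[OF gentire_const, of f c] by (simp add: theta_space_def)

text \<open>
  The sesquiholomorphic extension of \<open>z \<mapsto> \<theta>\<^sub>1(z) cnj (\<theta>\<^sub>2(z)) exp (- \<pi> H(z,z))\<close>: it is
  holomorphic in the first variable and antiholomorphic in the second one.
\<close>

definition pairing :: "(complex ^ 'n \<Rightarrow> complex) \<Rightarrow> (complex ^ 'n \<Rightarrow> complex) \<Rightarrow> complex ^ 'n \<Rightarrow> complex ^ 'n \<Rightarrow> complex" where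
  "pairing f g x y = f x * cnj (g y) * exp (- (of_real pi * H y x))"

lemma pairing_shift:
  assumes f: "f \<in> theta_space \<psi>" and g: "g \<in> theta_space \<psi>" and n: "norm (\<psi> \<gamma>) = 1" and \<gamma>: "\<gamma> \<in> \<Gamma>"
  shows "pairing f g (x + \<gamma>) (y + \<gamma>) = pairing f g x y"
proof -
  have n': "\<psi> \<gamma> * cnj (\<psi> \<gamma>) = 1" using n complex_norm_square[of "\<psi> \<gamma>"] by simp
  let ?p = "of_real pi :: complex"
  have fx: "f (x + \<gamma>) = \<psi> \<gamma> * exp (?p * H \<gamma> x + ?p / 2 * H \<gamma> \<gamma>) * f x"
    by (rule theta_shift[OF f \<gamma>])
  have gy: "cnj (g (y + \<gamma>)) = cnj (\<psi> \<gamma>) * exp (?p * H y \<gamma> + ?p / 2 * H \<gamma> \<gamma>) * cnj (g y)"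
    unfolding theta_shift[OF g \<gamma>] by (simp add: exp_cnj cnj_H)
  have e: "H (y + \<gamma>) (x + \<gamma>) = H y x + H y \<gamma> + H \<gamma> x + H \<gamma> \<gamma>" by (simp add: H_simps)
  have "pairing f g (x + \<gamma>) (y + \<gamma>) = (\<psi> \<gamma> * cnj (\<psi> \<gamma>)) * (f x * cnj (g y)) *
     (exp (?p * H \<gamma> x + ?p / 2 * H \<gamma> \<gamma>) * exp (?p * H y \<gamma> + ?p / 2 * H \<gamma> \<gamma>) *
      exp (- (?p * (H y x + H y \<gamma> + H \<gamma> x + H \<gamma> \<gamma>))))"
    unfolding pairing_def fx gy e by (simp only: mult_ac)
  also have "exp (?p * H \<gamma> x + ?p / 2 * H \<gamma> \<gamma>) * exp (?p * H y \<gamma> + ?p / 2 * H \<gamma> \<gamma>) *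
      exp (- (?p * (H y x + H y \<gamma> + H \<gamma> x + H \<gamma> \<gamma>))) = exp (- (?p * H y x))"
    unfolding exp_add[symmetric] by (simp add: algebra_simps)
  finally show ?thesis by (simp add: n' pairing_def)
qed

lemma continuous_on_pairing:
  assumes "gentire f" "gentire g" "continuous_on A u" "continuous_on A v"
  shows "continuous_on A (\<lambda>p. pairing f g (u p) (v p))"
  unfolding pairing_def
  by (intro continuous_intros assms continuous_on_compose2[OF gentire_cont[OF assms(1), of UNIV]]
      continuous_on_compose2[OF gentire_cont[OF assms(2), of UNIV]]) auto

text \<open>
  By translation invariance the mean is also that of \<open>pairing f g z (z - v)\<close>, so that it
  depends both holomorphically and antiholomorphically on \<open>v\<close>.
\<close>

lemma mean_pairing_shift:
  assumes f: "f \<in> theta_space \<psi>" and g: "g \<in> theta_space \<psi>" and n: "\<And>\<gamma>. \<gamma> \<in> \<Gamma> \<Longrightarrow> norm (\<psi> \<gamma>) = 1"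
  shows "mean (\<lambda>z. pairing f g (z + v) z) = mean (\<lambda>z. pairing f g z z)"
proof -
  define h where "h s = mean (\<lambda>z. pairing f g (z + s *s v) z)" for s
  note gf = theta_gentire[OF f] and gg = theta_gentire[OF g]
  have "h holomorphic_on UNIV" unfolding h_def mean_def
  proof (rule holomorphic_on_integral_cbox)
    show "continuous_on (UNIV \<times> cbox 0 1) (\<lambda>(s, x). pairing f g (lin x + s *s v) (lin x))"
      unfolding case_prod_unfold by (intro continuous_on_pairing gf gg continuous_intros)
    show "(\<lambda>s. pairing f g (lin t + s *s v) (lin t)) holomorphic_on UNIV" for t
      unfolding pairing_def H_simps by (intro holomorphic_intros gentire_holo gf)
  qed simp
  moreover have "(\<lambda>s. cnj (h s)) holomorphic_on UNIV"
  proof -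
    have "h s = mean (\<lambda>z. pairing f g z (z - s *s v))" for s
    proof -
      have "mean (\<lambda>z. pairing f g (z + - (s *s v) + s *s v) (z + - (s *s v))) = h s"
        unfolding h_def
      proof (rule mean_translate[of "\<lambda>z. pairing f g (z + s *s v) z"])
        show "continuous_on UNIV (\<lambda>z. pairing f g (z + s *s v) z)"
          by (intro continuous_on_pairing gf gg continuous_intros)
        show "periodic (\<lambda>z. pairing f g (z + s *s v) z)"
          unfolding periodic_def
        proof (intro ballI allI)
          fix \<gamma> z assume "\<gamma> \<in> \<Gamma>"
          then show "pairing f g (z + \<gamma> + s *s v) (z + \<gamma>) = pairing f g (z + s *s v) z"
            using pairing_shift[OF f g n, of \<gamma> "z + s *s v" z] by (simp add: algebra_simps)
        qed
      qed
      then show ?thesis by simp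
    qed
    then have "cnj (h s) = mean (\<lambda>z. cnj (pairing f g z (z - s *s v)))" for s
      by (simp add: mean_def integral_cnj)
    moreover have "(\<lambda>s. mean (\<lambda>z. cnj (pairing f g z (z - s *s v)))) holomorphic_on UNIV"
      unfolding mean_def
    proof (rule holomorphic_on_integral_cbox)
      show "continuous_on (UNIV \<times> cbox 0 1) (\<lambda>(s, x). cnj (pairing f g (lin x) (lin x - s *s v)))"
        unfolding case_prod_unfold by (intro continuous_on_pairing gf gg continuous_intros)
      have "cnj (pairing f g z (z - s *s v)) = cnj (f z) * g (z + (- s) *s v) * exp (- (of_real pi * (H z z - s * H z v)))" for s z
      proof -
        have "z - s *s v = z + (- s) *s v" by (simp add: vec_eq_iff)
        moreover have "cnj (H (z - s *s v) z) = H z z - s * H z v" by (simp add: cnj_H H_simps)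
        ultimately show ?thesis by (simp add: pairing_def exp_cnj)
      qed
      moreover have "(\<lambda>s. cnj (f z) * g (z + (- s) *s v) * exp (- (of_real pi * (H z z - s * H z v)))) holomorphic_on UNIV" for z
        by (intro holomorphic_intros gentire_holo_comp gg)
      ultimately show "(\<lambda>s. cnj (pairing f g (lin t) (lin t - s *s v))) holomorphic_on UNIV" for t by simp
    qed simp
    ultimately show ?thesis by simp
  qed
  ultimately have "h 1 = h 0" by (rule holomorphic_cnj_imp_const)
  then show ?thesis by (simp add: h_def)
qed

text \<open>This links translated means to Fourier coefficients: a lattice translation of the first
  variable multiplies the diagonal values by a constant and a character.\<close>

lemma pairing_lattice_shift:
  assumes f: "f \<in> theta_space \<psi>" and \<gamma>: "\<gamma> \<in> \<Gamma>"
  shows "pairing f g (z + \<gamma>) z = \<psi> \<gamma> * exp (of_real pi / 2 * H \<gamma> \<gamma>) * (pairing f g z z * chr \<gamma> z)"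
proof -
  let ?p = "of_real pi :: complex"
  have fz: "f (z + \<gamma>) = \<psi> \<gamma> * exp (?p * H \<gamma> z + ?p / 2 * H \<gamma> \<gamma>) * f z"
    by (rule theta_shift[OF f \<gamma>])
  have e: "H z (z + \<gamma>) = H z z + H z \<gamma>" by (simp add: H_simps)
  have "exp (?p * H \<gamma> z + ?p / 2 * H \<gamma> \<gamma>) * exp (- (?p * (H z z + H z \<gamma>)))
      = exp (?p / 2 * H \<gamma> \<gamma>) * (exp (- (?p * H z z)) * exp (?p * (H \<gamma> z - H z \<gamma>)))"
    unfolding exp_add[symmetric] by (simp add: algebra_simps)
  then show ?thesis unfolding pairing_def fz e chr_eq by (simp add: mult_ac)
qed

text \<open>Each Fourier coefficient of the pairing is, up to a nonzero constant, the mean of a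
  lattice translate, and \<open>mean_pairing_shift\<close> identifies all of these with the mean on
  the diagonal.\<close>

lemma orthogonal_imp_zero:
  assumes f: "f \<in> theta_space \<psi>" and g: "g \<in> theta_space \<psi>" and n: "\<And>\<gamma>. \<gamma> \<in> \<Gamma> \<Longrightarrow> norm (\<psi> \<gamma>) = 1"
    and orth: "mean (\<lambda>z. pairing f g z z) = 0"
  shows "f z * cnj (g z) = 0"
proof -
  have "pairing f g z z = 0"
  proof (rule fourier_complete)
    show "continuous_on UNIV (\<lambda>z. pairing f g z z)"
      by (intro continuous_on_pairing theta_gentire[OF f] theta_gentire[OF g] continuous_intros)
    show "periodic (\<lambda>z. pairing f g z z)"
      using pairing_shift[OF f g n] by (simp add: periodic_def)
    fix \<gamma> assume \<gamma>: "\<gamma> \<in> \<Gamma>"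
    have "\<psi> \<gamma> * exp (of_real pi / 2 * H \<gamma> \<gamma>) * mean (\<lambda>z. pairing f g z z * chr \<gamma> z) = 0"
      unfolding mean_cmult[symmetric] pairing_lattice_shift[OF f \<gamma>, symmetric]
      using mean_pairing_shift[OF f g n] orth by simp
    moreover have "\<psi> \<gamma> \<noteq> 0" using n[OF \<gamma>] by auto
    ultimately show "mean (\<lambda>z. pairing f g z z * chr \<gamma> z) = 0" by simp
  qed
  then show ?thesis by (simp add: pairing_def)
qed

theorem theta_space_one_dimensional:
  assumes f: "f \<in> theta_space \<psi>" "f v \<noteq> 0" and g: "g \<in> theta_space \<psi>" and n: "\<And>\<gamma>. \<gamma> \<in> \<Gamma> \<Longrightarrow> norm (\<psi> \<gamma>) = 1"
  obtains c where "\<And>z. g z = c * f z"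
proof -
  define N where "N = mean (\<lambda>z. pairing f f z z)"
  have "N \<noteq> 0" using orthogonal_imp_zero[OF f(1) f(1) n, of v] f(2) unfolding N_def by auto
  \<comment> \<open>The coefficient of the orthogonal projection of \<open>g\<close> to the line of
    \<open>f\<close>, conjugated because \<open>pairing\<close> is antilinear in its second
    function.\<close>
  define c where "c = cnj (mean (\<lambda>z. pairing f g z z) / N)"
  define k where "k z = g z + (- c) * f z" for z
  have k: "k \<in> theta_space \<psi>" unfolding k_def by (intro theta_space_add theta_space_cmult g f)
  have "pairing f k z z = pairing f g z z + (- cnj c) * pairing f f z z" for z
    by (simp add: pairing_def k_def algebra_simps)
  then have "mean (\<lambda>z. pairing f k z z) = mean (\<lambda>z. pairing f g z z) + (- cnj c) * N"
    unfolding N_def mean_cmult[symmetric]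
    by (simp only:) (intro mean_add continuous_intros continuous_on_pairing theta_gentire[OF f(1)] theta_gentire[OF g])
  also have "\<dots> = 0" using \<open>N \<noteq> 0\<close> by (simp add: c_def)
  finally have orth: "mean (\<lambda>z. pairing f k z z) = 0" .
  have "f z * cnj (k z) = 0" for z by (rule orthogonal_imp_zero[OF f(1) k n orth])
  then have "f z * k z = 0" for z by (metis complex_cnj_zero_iff mult_eq_0_iff)
  then have "k z = 0" for z
    using gentire_mult_eq_0[OF theta_gentire[OF f(1)] theta_gentire[OF k] _ f(2)] by blast
  then have "g z = c * f z" for z by (simp add: k_def)
  then show ?thesis by (rule that)
qed

end

section \<open>The reproducing kernel\<close>

lemma continuous_on_infsum:
  fixes f :: "'i \<Rightarrow> 'a::topological_space \<Rightarrow> complex"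
  assumes "\<And>i. i \<in> X \<Longrightarrow> continuous_on A (f i)"
    and "\<And>i z. i \<in> X \<Longrightarrow> z \<in> A \<Longrightarrow> norm (f i z) \<le> M i" and "M summable_on X"
  shows "continuous_on A (\<lambda>z. \<Sum>\<^sub>\<infinity>i\<in>X. f i z)"
proof (rule uniform_limit_theorem)
  show "uniform_limit A (\<lambda>F z. \<Sum>i\<in>F. f i z) (\<lambda>z. \<Sum>\<^sub>\<infinity>i\<in>X. f i z) (finite_subsets_at_top X)"
    using assms(2,3) by (rule Weierstrass_m_test_general)
  show "\<forall>\<^sub>F F in finite_subsets_at_top X. continuous_on A (\<lambda>z. \<Sum>i\<in>F. f i z)"
    by (rule eventually_finite_subsets_at_top_weakI) (auto intro!: continuous_on_sum assms(1))
qed simp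

lemma holomorphic_on_infsum:
  fixes f :: "'i \<Rightarrow> complex \<Rightarrow> complex"
  assumes A: "open A" and holo: "\<And>i. i \<in> X \<Longrightarrow> f i holomorphic_on A"
    and "\<And>i z. i \<in> X \<Longrightarrow> z \<in> A \<Longrightarrow> norm (f i z) \<le> M i" and "M summable_on X"
  shows "(\<lambda>z. \<Sum>\<^sub>\<infinity>i\<in>X. f i z) holomorphic_on A"
proof -
  have ul: "uniform_limit A (\<lambda>F z. \<Sum>i\<in>F. f i z) (\<lambda>z. \<Sum>\<^sub>\<infinity>i\<in>X. f i z) (finite_subsets_at_top X)"
    using assms(3,4) by (rule Weierstrass_m_test_general)
  have "\<exists>e>0. (\<lambda>z. \<Sum>\<^sub>\<infinity>i\<in>X. f i z) holomorphic_on ball z0 e" if z0: "z0 \<in> A" for z0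
  proof -
    obtain e where e: "0 < e" "cball z0 e \<subseteq> A" using A z0 open_contains_cball by blast
    have holo': "(\<lambda>z. \<Sum>i\<in>F. f i z) holomorphic_on A" if "F \<subseteq> X" for F
      using that by (intro holomorphic_on_sum holo) auto
    have ev: "\<forall>\<^sub>F F in finite_subsets_at_top X. continuous_on (cball z0 e) (\<lambda>z. \<Sum>i\<in>F. f i z) \<and>
        (\<lambda>z. \<Sum>i\<in>F. f i z) holomorphic_on ball z0 e"
    proof (rule eventually_finite_subsets_at_top_weakI)
      fix F assume "finite F" "F \<subseteq> X"
      then show "continuous_on (cball z0 e) (\<lambda>z. \<Sum>i\<in>F. f i z) \<and> (\<lambda>z. \<Sum>i\<in>F. f i z) holomorphic_on ball z0 e"
        using holo'[of F] e ball_subset_cball[of z0 e]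
        by (meson holomorphic_on_imp_continuous_on holomorphic_on_subset order_trans)
    qed
    have "uniform_limit (cball z0 e) (\<lambda>F z. \<Sum>i\<in>F. f i z) (\<lambda>z. \<Sum>\<^sub>\<infinity>i\<in>X. f i z) (finite_subsets_at_top X)"
      using ul e(2) by (rule uniform_limit_on_subset)
    from holomorphic_uniform_limit[OF ev this] e(1) show ?thesis by auto
  qed
  then show ?thesis
    unfolding holomorphic_on_def by (meson centre_in_ball field_differentiable_at_within
      holomorphic_on_def holomorphic_on_imp_differentiable_at open_ball)
qed

lemma norm_smult: "norm (c *s (v::complex ^ 'n)) = norm c * norm v"
  unfolding norm_vec_def by (simp add: norm_mult L2_set_right_distrib)

context unimodular_lattice
begin

lemma H_boundE:
  obtains C where "0 < C" "\<And>x y. norm (H x y) \<le> C * norm (coo x) * norm y"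
proof -
  obtain C1 where C1: "0 < C1" "\<And>x y. norm (H x y) \<le> norm x * norm y * C1"
    using bounded_bilinear.pos_bounded[OF bounded_bilinear_H] by blast
  obtain C2 where C2: "0 < C2" "\<And>x. norm (lin x) \<le> C2 * norm x"
    using linear_bounded_pos[OF linear_lin] by blast
  have "norm (H x y) \<le> C1 * C2 * norm (coo x) * norm y" for x y
  proof -
    have "norm (H x y) \<le> norm x * (norm y * C1)" using C1(2)[of x y] by (simp add: mult.assoc)
    also have "\<dots> \<le> (C2 * norm (coo x)) * (norm y * C1)"
      using C2(2)[of "coo x"] C1(1) by (intro mult_right_mono) auto
    finally show ?thesis by (simp add: mult_ac)
  qed
  then show ?thesis using that[of "C1 * C2"] C1 C2 by simp
qed

text \<open>A Gaussian majorant uniform over the parameter set; the linear term in the exponent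
  leaves room for translations. It yields summability, continuity, holomorphy and termwise
  integration alike.\<close>

definition gauss_dominated :: "(complex ^ 'n \<Rightarrow> 'p \<Rightarrow> complex) \<Rightarrow> 'p set \<Rightarrow> bool" where
  "gauss_dominated f S \<longleftrightarrow> (\<exists>a>0. \<exists>B D. \<forall>\<gamma>\<in>\<Gamma>. \<forall>p\<in>S. norm (f \<gamma> p) \<le> exp (D + (- a * Re (H \<gamma> \<gamma>) + B * norm (coo \<gamma>))))"

lemma gauss_dominated_summable:
  assumes "gauss_dominated f S"
  obtains M where "M summable_on \<Gamma>" "\<And>\<gamma> p. \<gamma> \<in> \<Gamma> \<Longrightarrow> p \<in> S \<Longrightarrow> norm (f \<gamma> p) \<le> M \<gamma>"
proof -
  obtain a B D where a: "0 < a" and bd: "\<And>\<gamma> p. \<gamma> \<in> \<Gamma> \<Longrightarrow> p \<in> S \<Longrightarrow> norm (f \<gamma> p) \<le> exp (D + (- a * Re (H \<gamma> \<gamma>) + B * norm (coo \<gamma>)))"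
    using assms unfolding gauss_dominated_def by blast
  have "(\<lambda>\<gamma>. exp D * exp (- a * Re (H \<gamma> \<gamma>) + B * norm (coo \<gamma>))) summable_on \<Gamma>"
    by (intro summable_on_cmult_right summable_exp_coo a)
  then show ?thesis using bd by (intro that[of "\<lambda>\<gamma>. exp D * exp (- a * Re (H \<gamma> \<gamma>) + B * norm (coo \<gamma>))"]) (auto simp: exp_add)
qed

lemma gauss_dominated_abs_summable:
  assumes "gauss_dominated f S" "p \<in> S"
  shows "(\<lambda>\<gamma>. f \<gamma> p) summable_on \<Gamma>"
proof -
  obtain M where M: "M summable_on \<Gamma>" "\<And>\<gamma> p. \<gamma> \<in> \<Gamma> \<Longrightarrow> p \<in> S \<Longrightarrow> norm (f \<gamma> p) \<le> M \<gamma>"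
    using gauss_dominated_summable[OF assms(1)] by blast
  have "(\<lambda>\<gamma>. norm (f \<gamma> p)) summable_on \<Gamma>"
    using M(1) by (rule summable_on_comparison_test) (use M(2) assms(2) in auto)
  then show ?thesis by (rule abs_summable_summable)
qed

lemma gauss_dominated_cont:
  fixes f :: "complex ^ 'n \<Rightarrow> 'p::topological_space \<Rightarrow> complex"
  assumes "gauss_dominated f S" "\<And>\<gamma>. \<gamma> \<in> \<Gamma> \<Longrightarrow> continuous_on S (f \<gamma>)"
  shows "continuous_on S (\<lambda>p. \<Sum>\<^sub>\<infinity>\<gamma>\<in>\<Gamma>. f \<gamma> p)"
  by (rule gauss_dominated_summable[OF assms(1)]) (rule continuous_on_infsum[OF assms(2)])

lemma gauss_dominated_holo:
  assumes "gauss_dominated f S" "open S" "\<And>\<gamma>. \<gamma> \<in> \<Gamma> \<Longrightarrow> f \<gamma> holomorphic_on S"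
  shows "(\<lambda>p. \<Sum>\<^sub>\<infinity>\<gamma>\<in>\<Gamma>. f \<gamma> p) holomorphic_on S"
  by (rule gauss_dominated_summable[OF assms(1)]) (rule holomorphic_on_infsum[OF assms(2,3)])

lemma continuous_on_all_balls:
  fixes F :: "complex ^ 'n \<Rightarrow> complex"
  assumes "\<And>R. continuous_on (ball 0 R) F" shows "continuous_on UNIV F"
proof -
  have "continuous_on (\<Union>R. ball 0 R) F" by (rule continuous_on_open_UN) (auto simp: assms)
  moreover have "(\<Union>R::real. ball (0::complex ^ 'n) R) = UNIV"
  proof -
    have "x \<in> ball 0 (norm x + 1)" for x :: "complex ^ 'n" by simp
    then show ?thesis by blast
  qed
  ultimately show ?thesis by simp
qed

lemma gentire_infsum:
  fixes f :: "complex ^ 'n \<Rightarrow> complex ^ 'n \<Rightarrow> complex"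
  assumes dom: "\<And>R. gauss_dominated f (ball 0 R)" and g: "\<And>\<gamma>. \<gamma> \<in> \<Gamma> \<Longrightarrow> gentire (f \<gamma>)"
  shows "gentire (\<lambda>z. \<Sum>\<^sub>\<infinity>\<gamma>\<in>\<Gamma>. f \<gamma> z)"
  unfolding gentire_def
proof (intro conjI allI)
  show "continuous_on UNIV (\<lambda>z. \<Sum>\<^sub>\<infinity>\<gamma>\<in>\<Gamma>. f \<gamma> z)"
    by (rule continuous_on_all_balls) (rule gauss_dominated_cont[OF dom], rule gentire_cont, rule g)
  fix z v :: "complex ^ 'n"
  have "(\<lambda>t. \<Sum>\<^sub>\<infinity>\<gamma>\<in>\<Gamma>. f \<gamma> (z + t *s v)) holomorphic_on ball 0 r" for r
  proof (rule gauss_dominated_holo)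
    obtain a B D where "0 < a" and bd: "\<And>\<gamma> p. \<gamma> \<in> \<Gamma> \<Longrightarrow> p \<in> ball 0 (norm z + r * norm v + 1) \<Longrightarrow>
        norm (f \<gamma> p) \<le> exp (D + (- a * Re (H \<gamma> \<gamma>) + B * norm (coo \<gamma>)))"
      using dom[of "norm z + r * norm v + 1"] unfolding gauss_dominated_def by blast
    moreover have "z + t *s v \<in> ball 0 (norm z + r * norm v + 1)" if "t \<in> ball 0 r" for t
    proof -
      have "norm (z + t *s v) \<le> norm z + norm t * norm v" using norm_triangle_ineq[of z "t *s v"] by (simp add: norm_smult)
      also have "\<dots> \<le> norm z + r * norm v" using that by (intro add_left_mono mult_right_mono) auto
      finally show ?thesis by simp
    qed
    ultimately show "gauss_dominated (\<lambda>\<gamma> t. f \<gamma> (z + t *s v)) (ball 0 r)"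
      unfolding gauss_dominated_def by blast
  qed (auto intro: gentire_holo g)
  then have "(\<lambda>t. \<Sum>\<^sub>\<infinity>\<gamma>\<in>\<Gamma>. f \<gamma> (z + t *s v)) holomorphic_on (\<Union>r. ball 0 r)"
    by (intro holomorphic_on_UN_open) auto
  moreover have "(\<Union>r::real. ball (0::complex) r) = UNIV"
  proof -
    have "x \<in> ball 0 (norm x + 1)" for x :: complex by simp
    then show ?thesis by blast
  qed
  ultimately show "(\<lambda>t. \<Sum>\<^sub>\<infinity>\<gamma>\<in>\<Gamma>. f \<gamma> (z + t *s v)) holomorphic_on UNIV" by simp
qed

lemma bounded_lin_cube: "\<exists>R. \<forall>x\<in>cbox 0 1. lin x \<in> ball 0 R"
proof -
  have "compact (lin ` cbox 0 1)"
    by (intro compact_continuous_image compact_cbox continuous_on_lin continuous_on_id)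
  then obtain R where "\<forall>y\<in>lin ` cbox 0 1. norm y \<le> R" using compact_imp_bounded bounded_iff by metis
  then show ?thesis by (intro exI[of _ "R + 1"]) force
qed

lemma mean_infsum:
  fixes f :: "complex ^ 'n \<Rightarrow> complex ^ 'n \<Rightarrow> complex"
  assumes dom: "\<And>R. gauss_dominated f (ball 0 R)" and c: "\<And>\<gamma>. \<gamma> \<in> \<Gamma> \<Longrightarrow> continuous_on UNIV (f \<gamma>)"
  shows "mean (\<lambda>z. \<Sum>\<^sub>\<infinity>\<gamma>\<in>\<Gamma>. f \<gamma> z) = (\<Sum>\<^sub>\<infinity>\<gamma>\<in>\<Gamma>. mean (f \<gamma>))"
proof -
  obtain R where R: "\<And>x. x \<in> cbox 0 1 \<Longrightarrow> lin x \<in> ball 0 R" using bounded_lin_cube by blast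
  obtain M where M: "M summable_on \<Gamma>" "\<And>\<gamma> p. \<gamma> \<in> \<Gamma> \<Longrightarrow> p \<in> ball 0 R \<Longrightarrow> norm (f \<gamma> p) \<le> M \<gamma>"
    using gauss_dominated_summable[OF dom] by blast
  \<comment> \<open>Set to 0 outside the lattice because the limit theorem for integrals asks for
    continuous partial sums over all finite sets, not only over those in the lattice.\<close>
  define h where "h \<gamma> x = (if \<gamma> \<in> \<Gamma> then f \<gamma> (lin x) else 0)" for \<gamma> x
  have hc: "continuous_on (cbox 0 1) (h \<gamma>)" for \<gamma>
    using continuous_on_compose2[OF c continuous_on_lin[OF continuous_on_id], of \<gamma> "cbox 0 1"]
    by (cases "\<gamma> \<in> \<Gamma>") (auto simp: h_def)
  have "uniform_limit (cbox 0 1) (\<lambda>F x. \<Sum>\<gamma>\<in>F. h \<gamma> x) (\<lambda>x. \<Sum>\<^sub>\<infinity>\<gamma>\<in>\<Gamma>. h \<gamma> x) (finite_subsets_at_top \<Gamma>)"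
    by (rule Weierstrass_m_test_general[OF _ M(1)]) (use M(2) R in \<open>auto simp: h_def\<close>)
  then obtain I J where I: "\<And>F. ((\<lambda>x. \<Sum>\<gamma>\<in>F. h \<gamma> x) has_integral I F) (cbox 0 1)"
      "((\<lambda>x. \<Sum>\<^sub>\<infinity>\<gamma>\<in>\<Gamma>. h \<gamma> x) has_integral J) (cbox 0 1)" "(I \<longlongrightarrow> J) (finite_subsets_at_top \<Gamma>)"
    by (rule uniform_limit_integral_cbox) (auto intro!: continuous_on_sum hc)
  have "(\<lambda>x. \<Sum>\<^sub>\<infinity>\<gamma>\<in>\<Gamma>. h \<gamma> x) = (\<lambda>x. \<Sum>\<^sub>\<infinity>\<gamma>\<in>\<Gamma>. f \<gamma> (lin x))"
    by (intro ext infsum_cong) (simp add: h_def)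
  then have J: "mean (\<lambda>z. \<Sum>\<^sub>\<infinity>\<gamma>\<in>\<Gamma>. f \<gamma> z) = J"
    using I(2) unfolding mean_def by (simp add: integral_unique)
  have "I F = (\<Sum>\<gamma>\<in>F. mean (f \<gamma>))" if "finite F" "F \<subseteq> \<Gamma>" for F
  proof -
    have "I F = integral (cbox 0 1) (\<lambda>x. \<Sum>\<gamma>\<in>F. h \<gamma> x)" using I(1)[of F] by (simp add: integral_unique)
    also have "\<dots> = (\<Sum>\<gamma>\<in>F. integral (cbox 0 1) (h \<gamma>))"
      using that by (intro integral_sum integrable_continuous hc) auto
    also have "\<dots> = (\<Sum>\<gamma>\<in>F. mean (f \<gamma>))"
      using that by (intro sum.cong refl) (auto simp: mean_def h_def[abs_def] subset_iff)
    finally show ?thesis .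
  qed
  then have "\<forall>\<^sub>F F in finite_subsets_at_top \<Gamma>. I F = (\<Sum>\<gamma>\<in>F. mean (f \<gamma>))"
    by (intro eventually_finite_subsets_at_top_weakI) auto
  then have "((\<lambda>F. \<Sum>\<gamma>\<in>F. mean (f \<gamma>)) \<longlongrightarrow> J) (finite_subsets_at_top \<Gamma>)"
    using I(3) by (rule Lim_transform_eventually[rotated])
  then have "((\<lambda>\<gamma>. mean (f \<gamma>)) has_sum J) \<Gamma>" by (simp add: has_sum_def)
  from infsumI[OF this] J show ?thesis by simp
qed

text \<open>The summand of the Poincare series, with the automorphy factor divided out;
  \<open>cnj\<close> inverts the value of \<open>\<psi>\<close>, which has norm 1 for a
  semicharacter.\<close>

definition kernel_term :: "(complex ^ 'n \<Rightarrow> complex) \<Rightarrow> complex ^ 'n \<Rightarrow> complex ^ 'n \<Rightarrow> complex ^ 'n \<Rightarrow> complex" where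
  "kernel_term \<psi> w \<gamma> z = cnj (\<psi> \<gamma>) * exp (of_real pi * (H w z + H w \<gamma> - H \<gamma> z) - of_real pi / 2 * H \<gamma> \<gamma>)"

definition kernel :: "(complex ^ 'n \<Rightarrow> complex) \<Rightarrow> complex ^ 'n \<Rightarrow> complex ^ 'n \<Rightarrow> complex" where
  "kernel \<psi> w z = (\<Sum>\<^sub>\<infinity>\<gamma>\<in>\<Gamma>. kernel_term \<psi> w \<gamma> z)"

lemma gentire_H: "gentire (H w)"
  unfolding gentire_def by (auto simp: H_simps intro!: continuous_intros holomorphic_intros)

lemma gentire_exp: "gentire f \<Longrightarrow> gentire (\<lambda>z. exp (f z))"
  by (simp add: gentire_def continuous_on_exp holomorphic_on_exp')

lemma gentire_kernel_term: "gentire (kernel_term \<psi> w \<gamma>)"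
proof -
  have "kernel_term \<psi> w \<gamma> = (\<lambda>z. cnj (\<psi> \<gamma>) * exp (H (of_real pi *s (w - \<gamma>)) z + (of_real pi * H w \<gamma> - of_real pi / 2 * H \<gamma> \<gamma>)))"
    by (simp add: kernel_term_def H_simps fun_eq_iff algebra_simps)
  then show ?thesis by (auto intro!: gentire_mult gentire_const gentire_exp gentire_add gentire_H)
qed

lemma norm_H_le:
  assumes "\<And>x y. norm (H x y) \<le> C * norm (coo x) * norm y"
  shows "\<bar>Re (H x y)\<bar> \<le> C * norm (coo x) * norm y" "\<bar>Re (H y x)\<bar> \<le> C * norm (coo x) * norm y"
  using assms[of x y] abs_Re_le_cmod[of "H x y"] H_cnj[of x y] by auto

text \<open>For \<open>w\<close> and \<open>z\<close> in a ball, the mixed terms of the exponent are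
  at most linear in the norm of the lattice vector, while the remaining term is negative and
  quadratic.\<close>

lemma kernel_term_dominated:
  assumes n: "\<And>\<gamma>. \<gamma> \<in> \<Gamma> \<Longrightarrow> norm (\<psi> \<gamma>) = 1"
  shows "gauss_dominated (\<lambda>\<gamma> (w, z). kernel_term \<psi> w \<gamma> z) (ball 0 R \<times> ball 0 R)"
proof -
  obtain C where C: "0 < C" "\<And>x y. norm (H x y) \<le> C * norm (coo x) * norm y" using H_boundE by blast
  obtain L where L: "0 < L" "\<And>z. norm (coo z) \<le> L * norm z" using linear_bounded_pos[OF linear_coo] by blast
  have "norm (kernel_term \<psi> w \<gamma> z) \<le> exp (pi * (C * (L * R) * R) + (- (pi / 2) * Re (H \<gamma> \<gamma>) + pi * (2 * C * R) * norm (coo \<gamma>)))"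
    if "\<gamma> \<in> \<Gamma>" "norm w < R" "norm z < R" for \<gamma> w z
  proof -
    have R: "0 \<le> R" using that(2) norm_ge_zero[of w] by linarith
    have 1: "Re (H w z) \<le> C * (L * R) * R"
    proof -
      have "Re (H w z) \<le> C * norm (coo w) * norm z" using norm_H_le(1)[OF C(2), of w z] by linarith
      also have "norm (coo w) \<le> L * R"
        using L(1) that(2) by (intro order_trans[OF L(2)] mult_left_mono) auto
      then have "C * norm (coo w) * norm z \<le> C * (L * R) * R"
        using C(1) L(1) R that by (intro mult_mono mult_left_mono) auto
      finally show ?thesis .
    qed
    have 2: "C * norm (coo \<gamma>) * norm y \<le> C * R * norm (coo \<gamma>)" if "norm y < R" for y
      using that C(1) mult_left_mono[of "norm y" R "C * norm (coo \<gamma>)"] by (simp add: mult_ac)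
    have "Re (H w z + H w \<gamma> - H \<gamma> z) \<le> C * (L * R) * R + 2 * C * R * norm (coo \<gamma>)"
      using 1 2[OF that(2)] 2[OF that(3)] norm_H_le(2)[OF C(2), of w \<gamma>] norm_H_le(1)[OF C(2), of \<gamma> z] by simp
    then have "pi * Re (H w z + H w \<gamma> - H \<gamma> z) \<le> pi * (C * (L * R) * R + 2 * C * R * norm (coo \<gamma>))"
      by (intro mult_left_mono) auto
    then show ?thesis using n[OF that(1)] by (simp add: kernel_term_def norm_mult algebra_simps)
  qed
  then show ?thesis unfolding gauss_dominated_def
    by (intro exI[of _ "pi/2"] conjI exI[of _ "pi * (2 * C * R)"] exI[of _ "pi * (C * (L * R) * R)"]) auto
qed

lemma kernel_term_dominated1:
  assumes n: "\<And>\<gamma>. \<gamma> \<in> \<Gamma> \<Longrightarrow> norm (\<psi> \<gamma>) = 1"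
  shows "gauss_dominated (kernel_term \<psi> w) (ball 0 R)"
proof -
  define R' where "R' = max R (norm w + 1)"
  have "gauss_dominated (\<lambda>\<gamma> (w, z). kernel_term \<psi> w \<gamma> z) (ball 0 R' \<times> ball 0 R')" using n by (rule kernel_term_dominated)
  then obtain a B D where a: "0 < a" and bd: "\<And>\<gamma> w z. \<gamma> \<in> \<Gamma> \<Longrightarrow> w \<in> ball 0 R' \<Longrightarrow> z \<in> ball 0 R' \<Longrightarrow>
     norm (kernel_term \<psi> w \<gamma> z) \<le> exp (D + (- a * Re (H \<gamma> \<gamma>) + B * norm (coo \<gamma>)))"
    unfolding gauss_dominated_def by fastforce
  show ?thesis unfolding gauss_dominated_def
    using a bd[of _ w] by (intro exI[of _ a] conjI exI[of _ B] exI[of _ D]) (auto simp: R'_def)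
qed

lemma kernel_summable: "(\<And>\<gamma>. \<gamma> \<in> \<Gamma> \<Longrightarrow> norm (\<psi> \<gamma>) = 1) \<Longrightarrow> (\<lambda>\<gamma>. kernel_term \<psi> w \<gamma> z) summable_on \<Gamma>"
  by (rule gauss_dominated_abs_summable[OF kernel_term_dominated1[of \<psi> w "norm z + 1"]]) auto

lemma gentire_kernel:
  assumes n: "\<And>\<gamma>. \<gamma> \<in> \<Gamma> \<Longrightarrow> norm (\<psi> \<gamma>) = 1"
  shows "gentire (kernel \<psi> w)"
  unfolding kernel_def[abs_def] by (intro gentire_infsum kernel_term_dominated1 n gentire_kernel_term)

lemma Gamma_shift_bij: "\<delta> \<in> \<Gamma> \<Longrightarrow> bij_betw (\<lambda>\<gamma>. \<gamma> + \<delta>) \<Gamma> \<Gamma>"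
  by (rule bij_betwI[of _ _ _ "\<lambda>\<gamma>. \<gamma> - \<delta>"]) (auto intro: Gamma_add Gamma_diff)

lemma Gamma_minus_bij: "bij_betw uminus \<Gamma> \<Gamma>"
  by (rule bij_betwI[of _ _ _ uminus]) (auto intro: Gamma_minus)

lemma minus_one_powi: "(-1 :: complex) powi k = (if even k then 1 else -1)"
  by (simp add: power_int_minus_left)

lemma minus_one_powi_floor:
  assumes "t \<in> \<int>" shows "(-1 :: complex) powi \<lfloor>t\<rfloor> = exp (- (of_real pi * \<i> * of_real t))"
    "(-1 :: complex) powi \<lfloor>t\<rfloor> = exp (of_real pi * \<i> * of_real t)"
proof -
  obtain k where k: "t = of_int k" using assms by (auto elim: Ints_cases)
  have 1: "exp (of_real pi * \<i> * of_int k) = (-1) powi k" for k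
  proof (cases "even k")
    case True
    then obtain m where "k = 2 * m" by blast
    then show ?thesis using exp_integer_2pi[of "of_int m"] by (simp add: minus_one_powi mult_ac)
  next
    case False
    then obtain m where m: "k = 2 * m + 1" by (rule oddE)
    have "exp (of_real pi * \<i> * of_int k) = exp (2 * of_real pi * \<i> * of_int m) * exp (of_real pi * \<i>)"
      unfolding exp_add[symmetric] m by (simp add: algebra_simps)
    also have "exp (2 * of_real pi * \<i> * of_int m) = 1" using exp_integer_2pi[of "of_int m"] by (simp add: mult_ac)
    finally show ?thesis using False by (simp add: minus_one_powi)
  qed
  show "(-1 :: complex) powi \<lfloor>t\<rfloor> = exp (of_real pi * \<i> * of_real t)" using 1[of k] by (simp add: k)
  show "(-1 :: complex) powi \<lfloor>t\<rfloor> = exp (- (of_real pi * \<i> * of_real t))"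
    using 1[of "- k"] by (simp add: k minus_one_powi)
qed

lemma semicharD:
  assumes "semicharacter \<Gamma> H \<psi>"
  shows "\<gamma> \<in> \<Gamma> \<Longrightarrow> norm (\<psi> \<gamma>) = 1"
    "\<gamma> \<in> \<Gamma> \<Longrightarrow> \<delta> \<in> \<Gamma> \<Longrightarrow> \<psi> (\<gamma> + \<delta>) = \<psi> \<gamma> * \<psi> \<delta> * (-1) powi \<lfloor>E \<gamma> \<delta>\<rfloor>"
    "\<psi> 0 = 1"
proof -
  show "\<gamma> \<in> \<Gamma> \<Longrightarrow> norm (\<psi> \<gamma>) = 1" using assms by (simp add: semicharacter_def)
  have 2: "\<gamma> \<in> \<Gamma> \<Longrightarrow> \<delta> \<in> \<Gamma> \<Longrightarrow> \<psi> (\<gamma> + \<delta>) = \<psi> \<gamma> * \<psi> \<delta> * (-1) powi \<lfloor>E \<gamma> \<delta>\<rfloor>" for \<gamma> \<delta>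
    using assms by (simp add: semicharacter_def form_E_def)
  show "\<gamma> \<in> \<Gamma> \<Longrightarrow> \<delta> \<in> \<Gamma> \<Longrightarrow> \<psi> (\<gamma> + \<delta>) = \<psi> \<gamma> * \<psi> \<delta> * (-1) powi \<lfloor>E \<gamma> \<delta>\<rfloor>"
    by (rule 2)
  have "\<psi> 0 = \<psi> 0 * \<psi> 0" using 2[of 0 0] by simp
  moreover have "norm (\<psi> 0) = 1" using assms by (simp add: semicharacter_def)
  ultimately show "\<psi> 0 = 1" by auto
qed

text \<open>The cocycle relation of the automorphy factors turns a translation of \<open>z\<close>
  by \<open>\<delta>\<close> into a translation of the summation index; the sign in the
  semicharacter law compensates for the asymmetry of \<open>H\<close>.\<close>

lemma kernel_theta_space:
  assumes \<psi>: "semicharacter \<Gamma> H \<psi>"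
  shows "kernel \<psi> w \<in> theta_space \<psi>"
proof -
  note n = semicharD(1)[OF \<psi>]
  have "kernel \<psi> w (z + \<delta>) = automorphy_factor H \<psi> \<delta> z * kernel \<psi> w z" if \<delta>: "\<delta> \<in> \<Gamma>" for z \<delta>
  proof -
    have term_shift: "kernel_term \<psi> w \<gamma> (z + \<delta>) = automorphy_factor H \<psi> \<delta> z * kernel_term \<psi> w (\<gamma> + \<delta>) z" if \<gamma>: "\<gamma> \<in> \<Gamma>" for \<gamma>
    proof -
      let ?p = "of_real pi :: complex"
      have n': "\<psi> \<delta> * cnj (\<psi> \<delta>) = 1" using n[OF \<delta>] complex_norm_square[of "\<psi> \<delta>"] by simp
      have e1: "- (?p * \<i> * of_real (E \<gamma> \<delta>)) = - (?p / 2 * (H \<gamma> \<delta> - H \<delta> \<gamma>))"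
        using complex_diff_cnj[of "H \<gamma> \<delta>"] by (simp add: cnj_H)
      have "cnj (\<psi> (\<gamma> + \<delta>)) = cnj (\<psi> \<gamma>) * cnj (\<psi> \<delta>) * cnj ((-1) powi \<lfloor>E \<gamma> \<delta>\<rfloor>)"
        using semicharD(2)[OF \<psi> \<gamma> \<delta>] by simp
      also have "cnj ((-1) powi \<lfloor>E \<gamma> \<delta>\<rfloor>) = exp (- (?p / 2 * (H \<gamma> \<delta> - H \<delta> \<gamma>)))"
        unfolding e1[symmetric] minus_one_powi_floor(1)[OF E_int[OF \<gamma> \<delta>], symmetric] by (simp add: minus_one_powi)
      finally have c: "cnj (\<psi> (\<gamma> + \<delta>)) = cnj (\<psi> \<gamma>) * cnj (\<psi> \<delta>) * exp (- (?p / 2 * (H \<gamma> \<delta> - H \<delta> \<gamma>)))" .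
      have "automorphy_factor H \<psi> \<delta> z * kernel_term \<psi> w (\<gamma> + \<delta>) z = (\<psi> \<delta> * cnj (\<psi> \<delta>)) * (cnj (\<psi> \<gamma>) *
         (exp (?p * H \<delta> z + ?p / 2 * H \<delta> \<delta>) * exp (- (?p / 2 * (H \<gamma> \<delta> - H \<delta> \<gamma>))) *
          exp (?p * (H w z + H w (\<gamma> + \<delta>) - H (\<gamma> + \<delta>) z) - ?p / 2 * H (\<gamma> + \<delta>) (\<gamma> + \<delta>))))"
        unfolding automorphy_factor_eq kernel_term_def c by (simp only: mult_ac)
      also have "exp (?p * H \<delta> z + ?p / 2 * H \<delta> \<delta>) * exp (- (?p / 2 * (H \<gamma> \<delta> - H \<delta> \<gamma>))) *
          exp (?p * (H w z + H w (\<gamma> + \<delta>) - H (\<gamma> + \<delta>) z) - ?p / 2 * H (\<gamma> + \<delta>) (\<gamma> + \<delta>)) =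
          exp (?p * (H w (z + \<delta>) + H w \<gamma> - H \<gamma> (z + \<delta>)) - ?p / 2 * H \<gamma> \<gamma>)"
        unfolding exp_add[symmetric] H_simps
        by (simp add: algebra_simps add_divide_distrib diff_divide_distrib)
      finally show ?thesis unfolding n' by (simp add: kernel_term_def)
    qed
    have "kernel \<psi> w (z + \<delta>) = (\<Sum>\<^sub>\<infinity>\<gamma>\<in>\<Gamma>. automorphy_factor H \<psi> \<delta> z * kernel_term \<psi> w (\<gamma> + \<delta>) z)"
      unfolding kernel_def by (intro infsum_cong term_shift)
    also have "\<dots> = automorphy_factor H \<psi> \<delta> z * (\<Sum>\<^sub>\<infinity>\<gamma>\<in>\<Gamma>. kernel_term \<psi> w (\<gamma> + \<delta>) z)"
      by (rule infsum_cmult_right')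
    also have "(\<Sum>\<^sub>\<infinity>\<gamma>\<in>\<Gamma>. kernel_term \<psi> w (\<gamma> + \<delta>) z) = kernel \<psi> w z"
      unfolding kernel_def by (rule infsum_reindex_bij_betw[OF Gamma_shift_bij[OF \<delta>]])
    finally show ?thesis .
  qed
  then show ?thesis using gentire_kernel[OF n] by (simp add: theta_space_def)
qed

text \<open>On the diagonal every summand is a constant times a character, so only the summand at 0
  has nonzero mean.\<close>

lemma mean_kernel_diagonal:
  assumes \<psi>: "semicharacter \<Gamma> H \<psi>"
  shows "mean (\<lambda>z. kernel \<psi> z z * exp (- (of_real pi * H z z))) = 1"
proof -
  define f where "f \<gamma> z = cnj (\<psi> \<gamma>) * exp (- (of_real pi / 2 * H \<gamma> \<gamma>)) * chr (- \<gamma>) z" for \<gamma> z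
  note n = semicharD(1)[OF \<psi>]
  have tm: "kernel_term \<psi> z \<gamma> z * exp (- (of_real pi * H z z)) = f \<gamma> z" for \<gamma> z
  proof -
    have "exp (of_real pi * (H z z + H z \<gamma> - H \<gamma> z) - of_real pi / 2 * H \<gamma> \<gamma>) * exp (- (of_real pi * H z z))
        = exp (- (of_real pi / 2 * H \<gamma> \<gamma>)) * exp (of_real pi * (H (- \<gamma>) z - H z (- \<gamma>)))"
      unfolding exp_add[symmetric] by (simp add: algebra_simps)
    then show ?thesis by (simp add: kernel_term_def f_def chr_eq mult.assoc)
  qed
  have nc: "norm (chr \<gamma> z) = 1" for \<gamma> z by (simp add: chr_def)
  have dom: "gauss_dominated f (ball 0 R)" for R
    unfolding gauss_dominated_def
    by (intro exI[of _ "pi/2"] conjI exI[of _ 0]) (auto simp: f_def norm_mult nc n)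
  have "kernel \<psi> z z * exp (- (of_real pi * H z z)) = (\<Sum>\<^sub>\<infinity>\<gamma>\<in>\<Gamma>. f \<gamma> z)" for z
    unfolding kernel_def tm[symmetric] by (rule infsum_cmult_left'[symmetric])
  then have "mean (\<lambda>z. kernel \<psi> z z * exp (- (of_real pi * H z z))) = (\<Sum>\<^sub>\<infinity>\<gamma>\<in>\<Gamma>. mean (f \<gamma>))"
    by (simp only:) (rule mean_infsum[OF dom], auto simp: f_def intro!: continuous_intros)
  also have "\<dots> = (\<Sum>\<^sub>\<infinity>\<gamma>\<in>{0}. mean (f \<gamma>))"
    by (rule infsum_cong_neutral) (auto simp: f_def[abs_def] mean_cmult mean_chr Gamma_minus)
  also have "\<dots> = mean (f 0)" by simp
  also have "f 0 = (\<lambda>z. 1)" using semicharD(3)[OF \<psi>] by (simp add: f_def[abs_def])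
  finally show ?thesis by simp
qed

theorem theta_function_exists:
  assumes "semicharacter \<Gamma> H \<psi>"
  shows "\<exists>\<theta>. theta_function \<Gamma> H \<psi> \<theta>"
proof -
  have "\<exists>z. kernel \<psi> z z \<noteq> 0"
  proof (rule ccontr)
    assume "\<not> ?thesis"
    then have "mean (\<lambda>z. kernel \<psi> z z * exp (- (of_real pi * H z z))) = 0" by simp
    then show False using mean_kernel_diagonal[OF assms] by simp
  qed
  then show ?thesis using kernel_theta_space[OF assms] by (auto simp: theta_function_iff)
qed

end

section \<open>The trace of multiplication by i\<close>

context unimodular_lattice
begin

lemma gauss_dominatedI:
  assumes "0 < a" "\<And>\<gamma> p. \<gamma> \<in> \<Gamma> \<Longrightarrow> p \<in> S \<Longrightarrow> norm (f \<gamma> p) \<le> exp (D + (- a * Re (H \<gamma> \<gamma>) + B * norm (coo \<gamma>)))"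
  shows "gauss_dominated f S"
  using assms unfolding gauss_dominated_def by blast

lemma gauss_dominated_compose:
  assumes "gauss_dominated f S" "\<And>p. p \<in> T \<Longrightarrow> g p \<in> S"
  shows "gauss_dominated (\<lambda>\<gamma> p. f \<gamma> (g p)) T"
  using assms unfolding gauss_dominated_def by blast

definition gauss_fun :: "complex \<Rightarrow> complex ^ 'n \<Rightarrow> complex" where
  "gauss_fun l z = exp (- (of_real pi * l * H z z))"

definition gauss_series :: "complex \<Rightarrow> complex ^ 'n \<Rightarrow> complex" where
  "gauss_series l z = (\<Sum>\<^sub>\<infinity>\<epsilon>\<in>\<Gamma>. gauss_fun l (z + \<epsilon>))"

text \<open>Unfolded, this is the Gaussian integral over the whole space. The parameter is complex
  because completing the square in the trace leads to \<open>l = 1 - \<i>\<close>; positive real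
  parameters serve to determine the value there.\<close>

definition gauss_mean :: "complex \<Rightarrow> complex" where "gauss_mean l = mean (gauss_series l)"

lemma norm_gauss_fun: "norm (gauss_fun l z) = exp (- (pi * Re l * Re (H z z)))"
  by (simp add: gauss_fun_def H_self_real(1))

lemma gauss_fun_dominated:
  assumes a: "0 < a"
  shows "gauss_dominated (\<lambda>\<epsilon> (l, z). gauss_fun l (z + \<epsilon>)) ({l. a < Re l} \<times> ball 0 R)"
proof -
  obtain C where C: "0 < C" "\<And>x y. norm (H x y) \<le> C * norm (coo x) * norm y" using H_boundE by blast
  have "norm (gauss_fun l (z + \<epsilon>)) \<le> exp (0 + (- (pi * a) * Re (H \<epsilon> \<epsilon>) + (pi * a * (2 * C * R)) * norm (coo \<epsilon>)))"
    if "a < Re l" "norm z < R" for l z \<epsilon>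
  proof -
    have n1: "norm (gauss_fun l (z + \<epsilon>)) \<le> exp (- (pi * a * Re (H (z + \<epsilon>) (z + \<epsilon>))))"
    proof -
      have "pi * a * Re (H (z + \<epsilon>) (z + \<epsilon>)) \<le> pi * Re l * Re (H (z + \<epsilon>) (z + \<epsilon>))"
        by (intro mult_right_mono mult_left_mono H_semidef) (use that(1) in simp_all)
      then show ?thesis unfolding norm_gauss_fun by (simp only: exp_le_cancel_iff neg_le_iff_le)
    qed
    have "Re (H (z + \<epsilon>) (z + \<epsilon>)) \<ge> Re (H \<epsilon> \<epsilon>) - 2 * C * R * norm (coo \<epsilon>)"
    proof -
      have "\<bar>Re (H \<epsilon> z)\<bar> \<le> C * norm (coo \<epsilon>) * norm z" by (rule norm_H_le(1)[OF C(2)])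
      also have "\<dots> \<le> C * norm (coo \<epsilon>) * R" using C(1) that(2) by (intro mult_left_mono) auto
      finally have "- Re (H \<epsilon> z) \<le> C * norm (coo \<epsilon>) * R" by linarith
      moreover have "Re (H (z + \<epsilon>) (z + \<epsilon>)) = Re (H z z) + 2 * Re (H \<epsilon> z) + Re (H \<epsilon> \<epsilon>)"
        using H_cnj[of z \<epsilon>] by (simp add: H_simps)
      ultimately show ?thesis using H_semidef[of z] by (simp add: mult_ac)
    qed
    then have "pi * a * (Re (H \<epsilon> \<epsilon>) - 2 * C * R * norm (coo \<epsilon>)) \<le> pi * a * Re (H (z + \<epsilon>) (z + \<epsilon>))"
      by (rule mult_left_mono) (use a in simp)
    then have n2: "exp (- (pi * a * Re (H (z + \<epsilon>) (z + \<epsilon>)))) \<le> exp (- (pi * a * (Re (H \<epsilon> \<epsilon>) - 2 * C * R * norm (coo \<epsilon>))))"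
      by (simp only: exp_le_cancel_iff neg_le_iff_le)
    from order_trans[OF n1 n2] show ?thesis by (simp add: algebra_simps)
  qed
  note bd = this
  show ?thesis
  proof (rule gauss_dominatedI)
    show "0 < pi * a" using a by simp
    fix \<gamma> and p :: "complex \<times> (complex ^ 'n)" assume p: "p \<in> {l. a < Re l} \<times> ball 0 R"
    show "norm (case p of (l, z) \<Rightarrow> gauss_fun l (z + \<gamma>))
        \<le> exp (0 + (- (pi * a) * Re (H \<gamma> \<gamma>) + (pi * a * (2 * C * R)) * norm (coo \<gamma>)))"
      unfolding case_prod_unfold by (rule bd) (use p in auto)
  qed
qed

lemma gauss_fun_dominated1:
  assumes "0 < Re l"
  shows "gauss_dominated (\<lambda>\<epsilon> z. gauss_fun l (z + \<epsilon>)) (ball 0 R)"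
proof -
  have "gauss_dominated (\<lambda>\<epsilon> (l, z). gauss_fun l (z + \<epsilon>)) ({k. Re l / 2 < Re k} \<times> ball 0 R)"
    using assms by (intro gauss_fun_dominated) simp
  from gauss_dominated_compose[OF this, of "ball 0 R" "\<lambda>z. (l, z)"] assms show ?thesis by simp
qed

lemma gauss_fun_summable: "0 < Re l \<Longrightarrow> (\<lambda>\<epsilon>. gauss_fun l (z + \<epsilon>)) summable_on \<Gamma>"
  by (rule gauss_dominated_abs_summable[OF gauss_fun_dominated1[of l "norm z + 1"]]) auto

lemma continuous_gauss_fun [continuous_intros]:
  "continuous_on A f \<Longrightarrow> continuous_on A g \<Longrightarrow> continuous_on A (\<lambda>x. gauss_fun (f x) (g x))"
  unfolding gauss_fun_def by (intro continuous_intros)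

lemma continuous_gauss_series: "0 < Re l \<Longrightarrow> continuous_on UNIV (gauss_series l)"
  unfolding gauss_series_def[abs_def]
  by (rule continuous_on_all_balls) (intro gauss_dominated_cont gauss_fun_dominated1 continuous_intros; simp)

lemma periodic_gauss_series: "periodic (gauss_series l)"
  unfolding periodic_def
proof (intro ballI allI)
  fix \<gamma> z assume \<gamma>: "\<gamma> \<in> \<Gamma>"
  have "gauss_series l (z + \<gamma>) = (\<Sum>\<^sub>\<infinity>\<epsilon>\<in>\<Gamma>. gauss_fun l (z + (\<epsilon> + \<gamma>)))" by (simp add: gauss_series_def algebra_simps)
  also have "\<dots> = gauss_series l z" unfolding gauss_series_def by (rule infsum_reindex_bij_betw[OF Gamma_shift_bij[OF \<gamma>]])
  finally show "gauss_series l (z + \<gamma>) = gauss_series l z" .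
qed

lemma mean_gauss_series_shift: "0 < Re l \<Longrightarrow> mean (\<lambda>z. gauss_series l (z + w)) = gauss_mean l"
  unfolding gauss_mean_def by (intro mean_translate continuous_gauss_series periodic_gauss_series)

text \<open>The majorant is uniform where the real part exceeds a fixed positive number, so the half
  plane is exhausted by smaller ones.\<close>

lemma holomorphic_gauss_mean: "gauss_mean holomorphic_on {l. 0 < Re l}"
proof -
  obtain R where R: "\<And>x. x \<in> cbox 0 1 \<Longrightarrow> lin x \<in> ball 0 R" using bounded_lin_cube by blast
  have op: "open {l. a < Re l}" for a by (intro open_Collect_less continuous_intros)
  have "gauss_mean holomorphic_on {l. a < Re l}" if a: "0 < a" for a
    unfolding gauss_mean_def[abs_def] mean_def
  proof (rule holomorphic_on_integral_cbox)
    show "open {l. a < Re l}" by (rule op)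
    have "continuous_on ({l. a < Re l} \<times> ball 0 R) (\<lambda>p. \<Sum>\<^sub>\<infinity>\<epsilon>\<in>\<Gamma>. (case p of (l, z) \<Rightarrow> gauss_fun l (z + \<epsilon>)))"
      by (intro gauss_dominated_cont gauss_fun_dominated a) (auto simp: case_prod_unfold intro!: continuous_intros)
    then have "continuous_on ({l. a < Re l} \<times> ball 0 R) (\<lambda>p. gauss_series (fst p) (snd p))"
      by (simp add: gauss_series_def case_prod_unfold)
    then have "continuous_on ({l. a < Re l} \<times> cbox 0 1) (\<lambda>p. (\<lambda>p. gauss_series (fst p) (snd p)) (fst p, lin (snd p)))"
      by (rule continuous_on_compose2) (use R in \<open>auto intro!: continuous_intros\<close>)
    then show "continuous_on ({l. a < Re l} \<times> cbox 0 1) (\<lambda>(l, x). gauss_series l (lin x))"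
      by (simp add: case_prod_unfold)
    show "(\<lambda>l. gauss_series l (lin x)) holomorphic_on {l. a < Re l}" if "x \<in> cbox 0 1" for x
      unfolding gauss_series_def
    proof (intro gauss_dominated_holo op)
      have "gauss_dominated (\<lambda>\<epsilon> (l, z). gauss_fun l (z + \<epsilon>)) ({l. a < Re l} \<times> ball 0 R)" using a by (rule gauss_fun_dominated)
      from gauss_dominated_compose[OF this, of "{l. a < Re l}" "\<lambda>l. (l, lin x)"] R[OF that]
      show "gauss_dominated (\<lambda>\<epsilon> l. gauss_fun l (lin x + \<epsilon>)) {l. a < Re l}" by simp
      show "(\<lambda>l. gauss_fun l (lin x + \<epsilon>)) holomorphic_on {l. a < Re l}" for \<epsilon>
        unfolding gauss_fun_def by (intro holomorphic_intros)
    qed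
  qed
  then have "gauss_mean holomorphic_on (\<Union>a\<in>{0<..}. {l. a < Re l})"
    by (intro holomorphic_on_UN_open op) auto
  moreover have "(\<Union>a\<in>{0<..}. {l. a < Re l}) = {l. 0 < Re l}"
  proof (intro equalityI subsetI)
    fix l assume "l \<in> {l. 0 < Re l}"
    then show "l \<in> (\<Union>a\<in>{0<..}. {l. a < Re l})" by (intro UN_I[of "Re l / 2"]) simp_all
  qed auto
  ultimately show ?thesis by simp
qed

subsection \<open>Representatives modulo a multiple of the lattice\<close>

text \<open>Representatives of the lattice modulo its multiple by \<open>\<alpha>\<close>, expressed
  as a bijection because this is the form in which an infinite sum is split into classes.\<close>

definition reps :: "complex \<Rightarrow> 'i set \<Rightarrow> ('i \<Rightarrow> complex ^ 'n) \<Rightarrow> bool" where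
  "reps \<alpha> I d \<longleftrightarrow> finite I \<and> bij_betw (\<lambda>(j, \<epsilon>). d j + \<alpha> *s \<epsilon>) (I \<times> \<Gamma>) \<Gamma>"

lemma infsum_reps:
  fixes f :: "complex ^ 'n \<Rightarrow> complex"
  assumes r: "reps \<alpha> I d" and f: "f summable_on \<Gamma>"
  shows "(\<Sum>\<^sub>\<infinity>\<gamma>\<in>\<Gamma>. f \<gamma>) = (\<Sum>j\<in>I. \<Sum>\<^sub>\<infinity>\<epsilon>\<in>\<Gamma>. f (d j + \<alpha> *s \<epsilon>))"
proof -
  have bij: "bij_betw (\<lambda>(j, \<epsilon>). d j + \<alpha> *s \<epsilon>) (I \<times> \<Gamma>) \<Gamma>" and fin: "finite I"
    using r by (auto simp: reps_def)
  have s: "(\<lambda>(j, \<epsilon>). f (d j + \<alpha> *s \<epsilon>)) summable_on I \<times> \<Gamma>"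
    using f summable_on_reindex_bij_betw[OF bij, of f] by (simp add: case_prod_unfold)
  have "(\<Sum>\<^sub>\<infinity>\<gamma>\<in>\<Gamma>. f \<gamma>) = (\<Sum>\<^sub>\<infinity>(j, \<epsilon>)\<in>I \<times> \<Gamma>. f (d j + \<alpha> *s \<epsilon>))"
    using infsum_reindex_bij_betw[OF bij, of f] by (simp add: case_prod_unfold)
  also have "\<dots> = (\<Sum>\<^sub>\<infinity>j\<in>I. \<Sum>\<^sub>\<infinity>\<epsilon>\<in>\<Gamma>. f (d j + \<alpha> *s \<epsilon>))"
    using infsum_Sigma'_banach[OF s] by simp
  finally show ?thesis using fin by simp
qed

definition int_reps :: "nat \<Rightarrow> ('n + 'n \<Rightarrow> nat) set" where
  "int_reps N = PiE UNIV (\<lambda>_. {..<N})"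

lemma card_int_reps: "card (int_reps N) = N ^ (2 * CARD('n))"
  by (simp add: int_reps_def card_PiE mult_2)

lemma reps_int:
  assumes N: "0 < N"
  shows "reps (of_nat N) (int_reps N) (\<lambda>h. lin (\<chi> k. real (h k)))"
  unfolding reps_def
proof (intro conjI bij_betw_imageI)
  have sm: "of_nat N *s lin x = lin (real N *\<^sub>R x)" for x
    unfolding lin_scale scaleR_vec_smult by simp
  let ?F = "\<lambda>(h, \<epsilon>). lin (\<chi> k. real (h k)) + of_nat N *s \<epsilon>"
  have coF: "coo (?F (h, \<epsilon>)) $ k = real (h k) + real N * coo \<epsilon> $ k" for h \<epsilon> k
  proof -
    have "?F (h, \<epsilon>) = lin ((\<chi> k. real (h k)) + real N *\<^sub>R coo \<epsilon>)"
      using sm[of "coo \<epsilon>"] by (simp add: lin_add)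
    then show ?thesis by simp
  qed
  show "finite (int_reps N)" unfolding int_reps_def by (intro finite_PiE) auto
  show "inj_on ?F (int_reps N \<times> \<Gamma>)"
  proof (rule inj_onI)
    fix p p' assume p: "p \<in> int_reps N \<times> \<Gamma>" "p' \<in> int_reps N \<times> \<Gamma>" and eq: "?F p = ?F p'"
    obtain h \<epsilon> h' \<epsilon>' where pp: "p = (h, \<epsilon>)" "p' = (h', \<epsilon>')" by (cases p, cases p')
    have main: "h k = h' k \<and> coo \<epsilon> $ k = coo \<epsilon>' $ k" for k
    proof -
      obtain m m' where m: "coo \<epsilon> $ k = of_int m" "coo \<epsilon>' $ k = of_int m'"
        using p pp Gamma_iff by (metis Ints_cases mem_Sigma_iff)
      have hl: "h k < N" "h' k < N" using p pp by (auto simp: int_reps_def PiE_iff)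
      have "real (h k) + real N * coo \<epsilon> $ k = real (h' k) + real N * coo \<epsilon>' $ k"
        unfolding coF[symmetric] using eq pp by simp
      then have "real_of_int (int (h k) + int N * m) = real_of_int (int (h' k) + int N * m')" by (simp add: m)
      then have e: "int (h k) + int N * m = int (h' k) + int N * m'" by (simp only: of_int_eq_iff)
      then have "(int (h k) + int N * m) mod int N = (int (h' k) + int N * m') mod int N" by simp
      then have "h k = h' k" using hl by simp
      then show ?thesis using e N by (simp add: m)
    qed
    have "h = h'" using main by blast
    moreover have "coo \<epsilon> = coo \<epsilon>'" using main by (simp add: vec_eq_iff)
    then have "\<epsilon> = \<epsilon>'" by (metis lin_coo)
    ultimately show "p = p'" using pp by simp
  qed
  show "?F ` (int_reps N \<times> \<Gamma>) = \<Gamma>"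
  proof (intro equalityI subsetI)
    fix y assume "y \<in> ?F ` (int_reps N \<times> \<Gamma>)"
    then obtain h \<epsilon> where "y = ?F (h, \<epsilon>)" "\<epsilon> \<in> \<Gamma>" by auto
    then show "y \<in> \<Gamma>" unfolding Gamma_iff using coF[of h \<epsilon>] by simp
  next
    fix y assume y: "y \<in> \<Gamma>"
    define m where "m k = \<lfloor>coo y $ k\<rfloor>" for k
    have m: "coo y $ k = of_int (m k)" for k
    proof -
      have "coo y $ k \<in> \<int>" using y Gamma_iff by blast
      then show ?thesis unfolding m_def by (auto elim!: Ints_cases)
    qed
    define h where "h k = nat (m k mod int N)" for k
    define \<epsilon> where "\<epsilon> = lin (\<chi> k. of_int (m k div int N))"
    have "\<epsilon> \<in> \<Gamma>" by (simp add: Gamma_iff \<epsilon>_def)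
    moreover have "h \<in> int_reps N" using N by (auto simp: int_reps_def h_def nat_less_iff)
    moreover have "?F (h, \<epsilon>) = y"
    proof -
      have "coo (?F (h, \<epsilon>)) $ k = coo y $ k" for k
      proof -
        have "real_of_int (m k mod int N) + real N * real_of_int (m k div int N) = real_of_int (m k mod int N + int N * (m k div int N))"
          by (simp only: of_int_add of_int_mult of_int_of_nat_eq)
        also have "\<dots> = of_int (m k)" by (simp only: mod_mult_div_eq)
        finally show ?thesis unfolding coF m using N by (simp add: \<epsilon>_def h_def)
      qed
      then have "coo (?F (h, \<epsilon>)) = coo y" by (simp add: vec_eq_iff)
      then show ?thesis by (metis lin_coo)
    qed
    ultimately show "y \<in> ?F ` (int_reps N \<times> \<Gamma>)" by force
  qed
qed

text \<open>Splitting the lattice modulo \<open>N\<close> writes the series for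
  \<open>l / N^2\<close> at \<open>N z\<close> as a sum of translates of the series for
  \<open>l\<close>, one for each of the \<open>N^(2 g)\<close> classes. Neither the translations nor
  the factor \<open>N\<close> affect the means.\<close>

lemma gauss_mean_scale:
  assumes N: "0 < N" and l: "0 < Re l"
  shows "of_nat N ^ (2 * CARD('n)) * gauss_mean l = gauss_mean (l / of_nat N ^ 2)"
proof -
  let ?d = "\<lambda>h::'n+'n\<Rightarrow>nat. lin (\<chi> k. real (h k))" and ?i = "inverse (of_nat N) :: complex" and ?l = "l / of_nat N ^ 2"
  have l': "0 < Re ?l" using l N
    by (metis Re_divide_of_nat of_nat_power divide_pos_pos of_nat_0_less_iff zero_less_power)
  have gfs: "gauss_fun l (z + ?i *s y) = gauss_fun ?l (of_nat N *s z + y)" for z y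
  proof -
    define w where "w = z + ?i *s y"
    have w: "of_nat N *s z + y = of_nat N *s w"
      unfolding w_def using N by (simp add: vector_add_ldistrib vector_smult_assoc)
    have "of_real pi * ?l * H (of_nat N *s w) (of_nat N *s w) = of_real pi * l * H w w"
      using N by (simp add: H_simps power2_eq_square)
    then show ?thesis unfolding gauss_fun_def w w_def[symmetric] by simp
  qed
  have eq: "(\<Sum>h\<in>int_reps N. gauss_series l (z + ?i *s ?d h)) = gauss_series ?l (of_nat N *s z)" for z
  proof -
    have "gauss_series ?l (of_nat N *s z) = (\<Sum>\<^sub>\<infinity>\<gamma>\<in>\<Gamma>. gauss_fun ?l (of_nat N *s z + \<gamma>))" by (simp add: gauss_series_def)
    also have "\<dots> = (\<Sum>h\<in>int_reps N. \<Sum>\<^sub>\<infinity>\<epsilon>\<in>\<Gamma>. gauss_fun ?l (of_nat N *s z + (?d h + of_nat N *s \<epsilon>)))"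
      by (rule infsum_reps[OF reps_int[OF N] gauss_fun_summable[OF l']])
    also have "\<dots> = (\<Sum>h\<in>int_reps N. gauss_series l (z + ?i *s ?d h))"
      unfolding gauss_series_def gfs[symmetric] using N
      by (simp add: vector_add_ldistrib vector_smult_assoc add.assoc)
    finally show ?thesis by simp
  qed
  have fin: "finite (int_reps N)" using reps_int[OF N] by (simp add: reps_def)
  have "gauss_mean ?l = mean (\<lambda>z. gauss_series ?l (of_nat N *s z))"
    unfolding gauss_mean_def by (rule mean_cmult_arg[symmetric, OF continuous_gauss_series[OF l'] periodic_gauss_series N])
  also have "\<dots> = (\<Sum>h\<in>int_reps N. mean (\<lambda>z. gauss_series l (z + ?i *s ?d h)))"
    unfolding eq[symmetric]
    by (rule mean_sum[OF fin]) (auto intro!: continuous_on_compose2[OF continuous_gauss_series[OF l]] continuous_intros)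
  also have "\<dots> = of_nat (card (int_reps N)) * gauss_mean l" by (simp add: mean_gauss_series_shift[OF l])
  finally show ?thesis by (simp add: card_int_reps)
qed

text \<open>At parameter 1 the series has positive real terms. The size of \<open>r\<close> is found
  later, in \<open>gauss_mean_value\<close>.\<close>

lemma gauss_mean_one: obtains r where "0 \<le> r" "gauss_mean 1 = of_real r"
proof -
  have gf1: "gauss_fun 1 z = of_real (exp (- (pi * Re (H z z))))" for z
  proof -
    have "gauss_fun 1 z = exp (of_real (- (pi * Re (H z z))))" using H_self_real(2)[of z] by (simp add: gauss_fun_def)
    then show ?thesis by (simp only: exp_of_real)
  qed
  have gauss_series_re: "0 \<le> Re (gauss_series 1 z)" and gauss_series_im: "Im (gauss_series 1 z) = 0" for z
  proof -
    have s: "(\<lambda>\<epsilon>. gauss_fun 1 (z + \<epsilon>)) summable_on \<Gamma>" by (rule gauss_fun_summable) simp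
    show "0 \<le> Re (gauss_series 1 z)" "Im (gauss_series 1 z) = 0"
      using infsumI[OF has_sum_bounded_linear[OF bounded_linear_Re has_sum_infsum[OF s]]]
        infsumI[OF has_sum_bounded_linear[OF bounded_linear_Im has_sum_infsum[OF s]]]
      by (simp_all add: gauss_series_def gf1 o_def flip: infsum_nonneg) (metis (no_types, lifting) exp_ge_zero infsum_nonneg)
  qed
  have "Re (gauss_mean 1) = integral (cbox 0 1) (\<lambda>x. Re (gauss_series 1 (lin x)))" "Im (gauss_mean 1) = integral (cbox 0 1) (\<lambda>x. Im (gauss_series 1 (lin x)))"
    unfolding gauss_mean_def mean_def
    using integral_linear[OF mean_integrable[OF continuous_gauss_series] bounded_linear_Re, of 1 0 1]
      integral_linear[OF mean_integrable[OF continuous_gauss_series] bounded_linear_Im, of 1 0 1] by (simp_all add: o_def)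
  moreover have "0 \<le> integral (cbox 0 1) (\<lambda>x. Re (gauss_series 1 (lin x)))"
    using integrable_linear[OF mean_integrable[OF continuous_gauss_series] bounded_linear_Re, of 1 0 1] gauss_series_re
    by (intro integral_nonneg) (auto simp: o_def)
  ultimately have "0 \<le> Re (gauss_mean 1)" "gauss_mean 1 = of_real (Re (gauss_mean 1))" by (simp_all add: gauss_series_im complex_eq_iff)
  then show ?thesis by (rule that)
qed

lemma gauss_mean_eq:
  assumes l: "0 < Re l"
  shows "l ^ CARD('n) * gauss_mean l = gauss_mean 1"
proof -
  let ?n = "CARD('n)"
  \<comment> \<open>\<open>u\<close> is invariant under division by squares of integers, hence constant on the squares of
    the rationals, on the positive reals by continuity, and on the half plane by the identity theorem.\<close>
  define u where "u l = l ^ ?n * gauss_mean l" for l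
  have usc: "u (l / of_nat N ^ 2) = u l" if "0 < N" "0 < Re l" for N l
  proof -
    have "u (l / of_nat N ^ 2) = l ^ ?n / (of_nat N ^ 2) ^ ?n * (of_nat N ^ (2 * ?n) * gauss_mean l)"
      using gauss_mean_scale[OF that] by (simp add: u_def power_divide)
    then show ?thesis using that(1) by (simp add: u_def power_mult)
  qed
  have hu: "u holomorphic_on {l. 0 < Re l}"
    unfolding u_def[abs_def] by (intro holomorphic_intros holomorphic_gauss_mean)
  have rat: "u (of_real (x ^ 2)) = u 1" if x: "0 < x" "x \<in> \<rat>" for x
  proof -
    obtain p q :: int where pq: "0 < q" "x = of_int p / of_int q" using x(2) by (auto elim!: Rats_cases')
    then have "0 < p" using x(1) by (simp add: zero_less_divide_iff)
    define P Q where "P = nat p" and "Q = nat q"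
    have PQ: "0 < P" "0 < Q" "x = real P / real Q" using pq \<open>0 < p\<close> by (auto simp: P_def Q_def)
    \<comment> \<open>Both \<open>x ^ 2\<close> and 1 arise from the square of the numerator, on
      division by the square of the denominator and by itself.\<close>
    have "u (of_real (x ^ 2)) = u (of_nat P ^ 2 / of_nat Q ^ 2)" by (simp add: PQ(3) power_divide)
    also have "\<dots> = u (of_nat P ^ 2)"
      using PQ by (intro usc) (auto simp: of_nat_power[symmetric] simp del: of_nat_power)
    also have "\<dots> = u (of_nat P ^ 2 / of_nat P ^ 2)"
      using PQ by (intro usc[symmetric]) (auto simp: of_nat_power[symmetric] simp del: of_nat_power)
    also have "\<dots> = u 1" using PQ by simp
    finally show ?thesis .
  qed
  have pos: "u (of_real (x ^ 2)) = u 1" if x: "0 < x" for x :: real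
  proof -
    have c: "continuous_on {0<..} (\<lambda>x::real. u (of_real (x ^ 2)))"
      by (rule continuous_on_compose2[OF holomorphic_on_imp_continuous_on[OF hu]])
         (auto intro!: continuous_intros simp: of_real_power[symmetric] simp del: of_real_power)
    have "\<exists>f. (\<forall>n. f n \<in> {x<..<x + inverse (real (Suc n))} \<inter> \<rat>)"
    proof (intro choice allI)
      fix n
      obtain r where "r \<in> \<rat>" "x < r" "r < x + inverse (real (Suc n))"
        using Rats_dense_in_real[of x "x + inverse (real (Suc n))"] by auto
      then show "\<exists>y. y \<in> {x<..<x + inverse (real (Suc n))} \<inter> \<rat>" by auto
    qed
    then obtain f where f: "\<And>n. f n \<in> {x<..<x + inverse (real (Suc n))} \<inter> \<rat>" by blast
    have "f \<longlonglongrightarrow> x"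
    proof (rule tendsto_sandwich[of "\<lambda>_. x" _ _ "\<lambda>n. x + inverse (real (Suc n))"])
      show "(\<lambda>n. x + inverse (real (Suc n))) \<longlonglongrightarrow> x"
        using tendsto_add[OF tendsto_const LIMSEQ_inverse_real_of_nat, of x] by simp
    qed (use f in \<open>auto intro!: always_eventually less_imp_le\<close>)
    then have "(\<lambda>n. u (of_real ((f n) ^ 2))) \<longlonglongrightarrow> u (of_real (x ^ 2))"
      using f x by (intro continuous_on_tendsto_compose[OF c]) (auto intro!: always_eventually less_trans[OF x])
    moreover have "u (of_real ((f n) ^ 2)) = u 1" for n using f[of n] x by (intro rat) auto
    ultimately show ?thesis by (simp add: LIMSEQ_const_iff)
  qed
  have "(\<lambda>l. u l - u 1) l = 0"
  proof (rule analytic_continuation[of "\<lambda>l. u l - u 1" "{l. 0 < Re l}" "complex_of_real ` {0<..}" 1])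
    show "(\<lambda>l. u l - u 1) holomorphic_on {l. 0 < Re l}" by (intro holomorphic_intros hu)
    show "open {l. 0 < Re l}" by (intro open_Collect_less continuous_intros)
    show "connected {l. 0 < Re l}" by (intro convex_connected convex_halfspace_Re_gt)
    show "1 islimpt complex_of_real ` {0<..}"
      unfolding islimpt_approachable
    proof (intro allI impI)
      fix e :: real assume e: "0 < e"
      then show "\<exists>x'\<in>complex_of_real ` {0<..}. x' \<noteq> 1 \<and> dist x' 1 < e"
        by (intro bexI[of _ "of_real (1 + e / 2)"] conjI imageI) (auto simp: dist_norm complex_eq_iff)
    qed
    show "u z - u 1 = 0" if z: "z \<in> complex_of_real ` {0<..}" for z
    proof -
      obtain t where t: "0 < t" "z = of_real t" using z by auto
      then show ?thesis using pos[of "sqrt t"] by simp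
    qed
  qed (use l in auto)
  then show ?thesis by (simp add: u_def)
qed

end

lemma minus_one_powi_add: "(-1 :: complex) powi (m + n) = (-1) powi m * (-1) powi n"
  by (simp add: power_int_add)

context unimodular_lattice
begin

section \<open>Complex coordinates and reduction modulo 1 - i\<close>

definition ccoo :: "complex ^ 'n \<Rightarrow> 'n \<Rightarrow> complex" where
  "ccoo z k = of_real (coo z $ Inl k) + \<i> * of_real (coo z $ Inr k)"

lemma sum_ccoo: "(\<Sum>k\<in>UNIV. ccoo z k *s b k) = z"
  using lin_complex[of "coo z"] by (simp add: ccoo_def)

lemma ccoo_inject: "ccoo x = ccoo y \<Longrightarrow> x = y"
  by (metis sum_ccoo)

lemma ccoo_unique: assumes "z = (\<Sum>k\<in>UNIV. c k *s b k)" shows "ccoo z k = c k"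
proof -
  have "(\<Sum>k\<in>UNIV. (ccoo z k - c k) *s b k) = (\<Sum>k\<in>UNIV. ccoo z k *s b k) - (\<Sum>k\<in>UNIV. c k *s b k)"
    by (simp add: sum_subtractf[symmetric] vec_eq_iff left_diff_distrib)
  also have "\<dots> = 0" using assms sum_ccoo[of z] by simp
  finally have "ccoo z k - c k = 0" by (rule basis_unique)
  then show ?thesis by simp
qed

lemma ccoo_add: "ccoo (z + w) k = ccoo z k + ccoo w k"
  by (simp add: ccoo_def coo_add algebra_simps)

lemma ccoo_smult: "ccoo (c *s z) k = c * ccoo z k"
proof (rule ccoo_unique)
  have "c *s z = c *s (\<Sum>k\<in>UNIV. ccoo z k *s b k)" by (simp add: sum_ccoo)
  also have "\<dots> = (\<Sum>k\<in>UNIV. (c * ccoo z k) *s b k)"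
    by (simp add: vec_eq_iff sum_distrib_left mult.assoc)
  finally show "c *s z = (\<Sum>k\<in>UNIV. (c * ccoo z k) *s b k)" .
qed

lemma ccoo_sum_b: "ccoo (\<Sum>k\<in>B. b k) j = (if j \<in> B then 1 else 0)"
proof (rule ccoo_unique)
  have "(\<Sum>k\<in>UNIV. (if k \<in> B then 1 else 0) *s b k) = (\<Sum>k\<in>UNIV. if k \<in> B then b k else 0)"
    by (intro sum.cong) auto
  then show "(\<Sum>k\<in>B. b k) = (\<Sum>k\<in>UNIV. (if k \<in> B then 1 else 0) *s b k)"
    by (simp add: sum.If_cases)
qed

lemma Gamma_ccoo: "z \<in> \<Gamma> \<longleftrightarrow> (\<forall>k. ccoo z k \<in> gaussian_ints)"
proof
  assume "z \<in> \<Gamma>"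
  then show "\<forall>k. ccoo z k \<in> gaussian_ints" by (simp add: Gamma_iff ccoo_def gaussian_ints_def)
next
  assume "\<forall>k. ccoo z k \<in> gaussian_ints"
  then have "coo z $ Inl k \<in> \<int>" "coo z $ Inr k \<in> \<int>" for k by (simp_all add: ccoo_def gaussian_ints_def)
  then show "z \<in> \<Gamma>" unfolding Gamma_iff by (metis old.sum.exhaust)
qed

lemma exp_pi_int: "exp (- (of_real pi * \<i> * of_int k)) = (-1 :: complex) powi k"
  using minus_one_powi_floor(1)[of "of_int k"] by simp

lemma Gamma_i: "\<gamma> \<in> \<Gamma> \<Longrightarrow> \<i> *s \<gamma> \<in> \<Gamma>"
  by (rule Gamma_smult) simp_all

end

text \<open>The class of a Gaussian integer modulo \<open>1 - \<i>\<close>, as a parity.\<close>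

definition par :: "complex \<Rightarrow> int" where "par z = \<lfloor>Re z\<rfloor> + \<lfloor>Im z\<rfloor>"

lemma par_of_int: "par (of_int x + \<i> * of_int y) = x + y"
  by (simp add: par_def)

lemma par_add: "z \<in> gaussian_ints \<Longrightarrow> w \<in> gaussian_ints \<Longrightarrow> par (z + w) = par z + par w"
  by (auto simp: gaussian_ints_def par_def elim!: Ints_cases)

lemma par_0 [simp]: "par 0 = 0" and par_1 [simp]: "par 1 = 1"
  by (simp_all add: par_def)

lemma par_minus_1 [simp]: "par (-1) = -1"
  using par_of_int[of "-1" 0] by simp

lemma even_par_mult:
  assumes "z \<in> gaussian_ints" "w \<in> gaussian_ints"
  shows "even (par (z * w)) \<longleftrightarrow> even (par z * par w)"
proof -
  obtain x y u v where z: "z = of_int x + \<i> * of_int y" and w: "w = of_int u + \<i> * of_int v"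
    using assms unfolding gaussian_ints_iff by blast
  have "z * w = of_int (x * u - y * v) + \<i> * of_int (x * v + y * u)"
    by (simp add: z w algebra_simps)
  then have "par (z * w) = (x * u - y * v) + (x * v + y * u)" by (simp only: par_of_int)
  moreover have "par z = x + y" "par w = u + v" unfolding z w by (rule par_of_int)+
  ultimately show ?thesis by auto
qed

lemma even_par_cnj: "z \<in> gaussian_ints \<Longrightarrow> even (par (cnj z)) \<longleftrightarrow> even (par z)"
  by (auto simp: gaussian_ints_def par_def elim!: Ints_cases)

lemma even_par_i: "z \<in> gaussian_ints \<Longrightarrow> even (par (\<i> * z)) \<longleftrightarrow> even (par z)"
  using even_par_mult[of \<i> z] by (simp add: par_def)

lemma even_par_iff:
  assumes "z \<in> gaussian_ints"
  shows "even (par z) \<longleftrightarrow> (\<exists>w\<in>gaussian_ints. z = (1 - \<i>) * w)"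
proof
  assume ev: "even (par z)"
  obtain x y where z: "z = of_int x + \<i> * of_int y" using assms unfolding gaussian_ints_iff by blast
  have "even (x + y)" using ev unfolding z par_of_int .
  then obtain s where s: "x + y = 2 * s" by blast
  then have y: "y = 2 * s - x" by simp
  \<comment> \<open>Half the sum of the two parts of \<open>z\<close> is the imaginary part of its
    quotient by \<open>1 - \<i>\<close>.\<close>
  have "z = (1 - \<i>) * (of_int (x - s) + \<i> * of_int s)"
    by (simp add: z y algebra_simps complex_eq_iff)
  moreover have "of_int (x - s) + \<i> * of_int s \<in> gaussian_ints" unfolding gaussian_ints_iff by blast
  ultimately show "\<exists>w\<in>gaussian_ints. z = (1 - \<i>) * w" by blast
next
  assume "\<exists>w\<in>gaussian_ints. z = (1 - \<i>) * w"
  then obtain w where w: "w \<in> gaussian_ints" "z = (1 - \<i>) * w" by blast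
  have "even (par (1 - \<i>))" using par_of_int[of 1 "-1"] by simp
  then show "even (par z)" unfolding w(2) using even_par_mult[of "1 - \<i>" w] w(1) by simp
qed

context unimodular_lattice
begin

text \<open>The residue ring modulo \<open>1 - \<i>\<close> consists of the classes of 0 and 1, so
  the subset sums of the basis represent all classes; the subset belonging to a vector is the set of
  its odd coordinates.\<close>

lemma reps_one_minus_i: "reps (1 - \<i>) UNIV (\<lambda>B. \<Sum>k\<in>B. b k)"
  unfolding reps_def
proof (intro conjI bij_betw_imageI)
  let ?F = "\<lambda>(B, \<epsilon>). (\<Sum>k\<in>B. b k) + (1 - \<i>) *s \<epsilon>"
  have cF: "ccoo (?F (B, \<epsilon>)) k = (if k \<in> B then 1 else 0) + (1 - \<i>) * ccoo \<epsilon> k" for B \<epsilon> k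
    by (simp only: case_prod_conv ccoo_add ccoo_smult ccoo_sum_b)
  have nz: "1 - \<i> \<noteq> 0" by (simp add: complex_eq_iff)
  show "inj_on ?F (UNIV \<times> \<Gamma>)"
  proof (rule inj_onI)
    fix p p' assume p: "p \<in> UNIV \<times> \<Gamma>" "p' \<in> UNIV \<times> \<Gamma>" and eq: "?F p = ?F p'"
    obtain B \<epsilon> B' \<epsilon>' where pp: "p = (B, \<epsilon>)" "p' = (B', \<epsilon>')" by (cases p, cases p')
    have main: "(k \<in> B \<longleftrightarrow> k \<in> B') \<and> ccoo \<epsilon> k = ccoo \<epsilon>' k" for k
    proof -
      let ?x = "if k \<in> B then 1 else 0 :: complex" and ?x' = "if k \<in> B' then 1 else 0 :: complex"
      have g: "ccoo \<epsilon> k \<in> gaussian_ints" "ccoo \<epsilon>' k \<in> gaussian_ints" using p pp Gamma_ccoo by auto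
      have e: "?x + (1 - \<i>) * ccoo \<epsilon> k = ?x' + (1 - \<i>) * ccoo \<epsilon>' k"
        unfolding cF[symmetric] using eq pp by simp
      then have "?x + - ?x' = (1 - \<i>) * (ccoo \<epsilon>' k - ccoo \<epsilon> k)" by (simp add: algebra_simps)
      moreover have "?x + - ?x' \<in> gaussian_ints" by simp
      moreover have "ccoo \<epsilon>' k - ccoo \<epsilon> k \<in> gaussian_ints" using g by simp
      ultimately have "even (par (?x + - ?x'))" using even_par_iff[of "?x + - ?x'"] by blast
      then have "k \<in> B \<longleftrightarrow> k \<in> B'" by (auto simp: par_def split: if_splits)
      then have "?x = ?x'" by simp
      then have "(1 - \<i>) * ccoo \<epsilon> k = (1 - \<i>) * ccoo \<epsilon>' k" using e by (simp only: add_left_cancel)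
      then show ?thesis using nz \<open>k \<in> B \<longleftrightarrow> k \<in> B'\<close> mult_left_cancel[OF nz] by blast
    qed
    have "B = B'" using main by blast
    moreover have "ccoo \<epsilon> = ccoo \<epsilon>'" using main by blast
    then have "\<epsilon> = \<epsilon>'" by (rule ccoo_inject)
    ultimately show "p = p'" using pp by simp
  qed
  show "?F ` (UNIV \<times> \<Gamma>) = \<Gamma>"
  proof (intro equalityI subsetI)
    fix y assume "y \<in> ?F ` (UNIV \<times> \<Gamma>)"
    then obtain B \<epsilon> where "y = ?F (B, \<epsilon>)" "\<epsilon> \<in> \<Gamma>" by auto
    moreover from this have "(1 - \<i>) *s \<epsilon> \<in> \<Gamma>" by (intro Gamma_smult) simp_all
    ultimately show "y \<in> \<Gamma>" by (simp only: case_prod_conv) (intro Gamma_add Gamma_sum b_in_Gamma)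
  next
    fix y assume y: "y \<in> \<Gamma>"
    define B where "B = {k. odd (par (ccoo y k))}"
    have "\<exists>w\<in>gaussian_ints. ccoo y k + (if k \<in> B then -1 else 0) = (1 - \<i>) * w" for k
    proof -
      have g: "ccoo y k \<in> gaussian_ints" using y Gamma_ccoo by blast
      have "(if k \<in> B then -1 else 0) \<in> gaussian_ints" by simp
      then have "even (par (ccoo y k + (if k \<in> B then -1 else 0)))"
        using par_add[OF g, of "-1"] by (cases "k \<in> B") (simp_all add: B_def)
      then show ?thesis using even_par_iff g by (simp add: even_par_iff split: if_splits)
    qed
    then obtain w where w: "\<And>k. w k \<in> gaussian_ints" "\<And>k. ccoo y k + (if k \<in> B then -1 else 0) = (1 - \<i>) * w k"
      by metis
    define \<epsilon> where "\<epsilon> = (\<Sum>k\<in>UNIV. w k *s b k)"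
    have ce: "ccoo \<epsilon> k = w k" for k by (rule ccoo_unique[OF \<epsilon>_def])
    have "\<epsilon> \<in> \<Gamma>" unfolding Gamma_ccoo ce using w by blast
    moreover have "ccoo (?F (B, \<epsilon>)) k = ccoo y k" for k
      unfolding cF ce w(2)[symmetric] by simp
    then have "ccoo (?F (B, \<epsilon>)) = ccoo y" by (rule ext)
    then have "?F (B, \<epsilon>) = y" by (rule ccoo_inject)
    ultimately show "y \<in> ?F ` (UNIV \<times> \<Gamma>)" by (intro image_eqI[of _ _ "(B, \<epsilon>)"]) simp_all
  qed
qed simp

definition i_char :: "(complex ^ 'n \<Rightarrow> complex) \<Rightarrow> bool" where
  "i_char \<psi> \<longleftrightarrow> semicharacter \<Gamma> H \<psi> \<and> (\<forall>\<gamma>\<in>\<Gamma>. \<psi> (\<i> *s \<gamma>) = \<psi> \<gamma>)"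

lemma i_char_semichar: "i_char \<psi> \<Longrightarrow> semicharacter \<Gamma> H \<psi>"
  by (simp add: i_char_def)

lemma i_char_i: "i_char \<psi> \<Longrightarrow> \<gamma> \<in> \<Gamma> \<Longrightarrow> \<psi> (\<i> *s \<gamma>) = \<psi> \<gamma>"
  by (simp add: i_char_def)

lemma i_char_minus: "i_char \<psi> \<Longrightarrow> \<gamma> \<in> \<Gamma> \<Longrightarrow> \<psi> (- \<gamma>) = \<psi> \<gamma>"
  using i_char_i[of \<psi> "\<i> *s \<gamma>"] i_char_i[of \<psi> \<gamma>] Gamma_i[of \<gamma>]
  by (simp add: vector_smult_assoc vector_sneg_minus1[symmetric])

text \<open>Applying the invariance twice equates the values at a vector and its negative. These
  multiply to the value 1 at their sum 0, without a sign because \<open>E\<close> vanishes on the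
  two.\<close>

lemma i_char_square: assumes \<psi>: "i_char \<psi>" and \<gamma>: "\<gamma> \<in> \<Gamma>" shows "\<psi> \<gamma> * \<psi> \<gamma> = 1"
proof -
  have "\<psi> (\<gamma> + - \<gamma>) = \<psi> \<gamma> * \<psi> (- \<gamma>) * (-1) powi \<lfloor>E \<gamma> (- \<gamma>)\<rfloor>"
    by (rule semicharD(2)[OF i_char_semichar[OF \<psi>] \<gamma> Gamma_minus[OF \<gamma>]])
  then show ?thesis
    using i_char_minus[OF \<psi> \<gamma>] semicharD(3)[OF i_char_semichar[OF \<psi>]] by (simp add: H_self_real(1))
qed

lemma i_char_pm: "i_char \<psi> \<Longrightarrow> \<gamma> \<in> \<Gamma> \<Longrightarrow> \<psi> \<gamma> = 1 \<or> \<psi> \<gamma> = -1"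
  using i_char_square[of \<psi> \<gamma>] square_eq_1_iff by blast

text \<open>
  This is \<open>\<i>\<^sup>r\<close> for a \<open>\<int>/4\<close>-valued quadratic form \<open>r\<close> on \<open>\<Gamma>/(1 - \<i>)\<Gamma>\<close>, which
  contributes the term of the fixed point \<open>\<gamma>/(1 - \<i>)\<close> to the Lefschetz formula.
\<close>

definition gterm :: "(complex ^ 'n \<Rightarrow> complex) \<Rightarrow> complex ^ 'n \<Rightarrow> complex" where
  "gterm \<psi> \<gamma> = cnj (\<psi> \<gamma>) * exp (- (of_real pi * \<i> / 2 * H \<gamma> \<gamma>))"

text \<open>Both factors change by signs. With \<open>H \<gamma> \<epsilon> = a + \<i> b\<close> and
  \<open>H \<epsilon> \<epsilon> = s\<close> the exponents are \<open>s + b - a\<close> and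
  \<open>a + b + s\<close>, whose sum is even.\<close>

lemma gterm_mod:
  assumes \<psi>: "i_char \<psi>" and \<gamma>: "\<gamma> \<in> \<Gamma>" and \<epsilon>: "\<epsilon> \<in> \<Gamma>"
  shows "gterm \<psi> (\<gamma> + (1 - \<i>) *s \<epsilon>) = gterm \<psi> \<gamma>"
proof -
  note sc = semicharD(2)[OF i_char_semichar[OF \<psi>]]
  obtain a b where h: "H \<gamma> \<epsilon> = of_int a + \<i> * of_int b"
    using H_int[OF \<gamma> \<epsilon>] unfolding gaussian_ints_iff by blast
  obtain s t where s': "H \<epsilon> \<epsilon> = of_int s + \<i> * of_int t"
    using H_int[OF \<epsilon> \<epsilon>] unfolding gaussian_ints_iff by blast
  then have "t = 0" using H_self_real(1)[of \<epsilon>] by simp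
  then have s: "H \<epsilon> \<epsilon> = of_int s" using s' by simp
  have g: "(1 - \<i>) *s \<epsilon> \<in> \<Gamma>" using \<epsilon> by (intro Gamma_smult) auto
  have split: "(1 - \<i>) *s \<epsilon> = \<epsilon> + - (\<i> *s \<epsilon>)" by (simp add: vec_eq_iff algebra_simps)
  have "\<psi> ((1 - \<i>) *s \<epsilon>) = \<psi> \<epsilon> * \<psi> (- (\<i> *s \<epsilon>)) * (-1) powi \<lfloor>E \<epsilon> (- (\<i> *s \<epsilon>))\<rfloor>"
    unfolding split by (intro sc \<epsilon> Gamma_minus Gamma_i)
  also have "\<psi> (- (\<i> *s \<epsilon>)) = \<psi> \<epsilon>" using i_char_minus[OF \<psi> Gamma_i[OF \<epsilon>]] i_char_i[OF \<psi> \<epsilon>] by simp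
  also have "E \<epsilon> (- (\<i> *s \<epsilon>)) = of_int (- s)" by (simp add: H_smult_right s)
  finally have 1: "\<psi> ((1 - \<i>) *s \<epsilon>) = (-1) powi s"
    using i_char_square[OF \<psi> \<epsilon>] by (simp only: floor_of_int) (simp add: minus_one_powi)
  have "H \<gamma> ((1 - \<i>) *s \<epsilon>) = of_int (a + b) + \<i> * of_int (b - a)"
    unfolding H_smult_right h by (simp add: algebra_simps)
  then have "E \<gamma> ((1 - \<i>) *s \<epsilon>) = of_int (b - a)" by (simp only:) simp
  then have 2: "\<psi> (\<gamma> + (1 - \<i>) *s \<epsilon>) = \<psi> \<gamma> * (-1) powi s * (-1) powi (b - a)"
    using sc[OF \<gamma> g] 1 by (simp only: floor_of_int)
  have "H (\<gamma> + (1 - \<i>) *s \<epsilon>) (\<gamma> + (1 - \<i>) *s \<epsilon>) = H \<gamma> \<gamma> + 2 * of_int (a + b + s)"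
  proof -
    have hc: "H \<epsilon> \<gamma> = of_int a - \<i> * of_int b" using H_cnj[of \<epsilon> \<gamma>] h by simp
    show ?thesis unfolding H_add_left H_add_right H_smult_left H_smult_right h hc s
      by (simp add: algebra_simps)
  qed
  then have 3: "exp (- (of_real pi * \<i> / 2 * H (\<gamma> + (1 - \<i>) *s \<epsilon>) (\<gamma> + (1 - \<i>) *s \<epsilon>)))
      = exp (- (of_real pi * \<i> / 2 * H \<gamma> \<gamma>)) * (-1) powi (a + b + s)"
    unfolding exp_pi_int[symmetric] exp_add[symmetric] by (simp add: algebra_simps)
  have "(-1 :: complex) powi s * (-1) powi (b - a) * (-1) powi (a + b + s) = 1"
    by (simp add: minus_one_powi)
  then show ?thesis unfolding gterm_def 2 3 by (simp add: minus_one_powi split: if_splits)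
qed

lemma theta_space_i:
  assumes \<psi>: "i_char \<psi>" and f: "f \<in> theta_space \<psi>"
  shows "(\<lambda>z. f (\<i> *s z)) \<in> theta_space \<psi>"
proof -
  have "f (\<i> *s (z + \<gamma>)) = automorphy_factor H \<psi> \<gamma> z * f (\<i> *s z)" if \<gamma>: "\<gamma> \<in> \<Gamma>" for z \<gamma>
    using theta_shift[OF f Gamma_i[OF \<gamma>], of "\<i> *s z"] i_char_i[OF \<psi> \<gamma>]
    by (simp add: vector_add_ldistrib automorphy_factor_eq H_smult_left H_smult_right mult.assoc[symmetric])
  then show ?thesis using gentire_smult_arg[OF theta_gentire[OF f]] by (simp add: theta_space_def)
qed

lemma trace_formula:
  assumes \<psi>: "i_char \<psi>" and c: "\<And>f z. f \<in> theta_space \<psi> \<Longrightarrow> f (\<i> *s z) = c * f z"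
  shows "c = (\<Sum>B\<in>UNIV. gterm \<psi> (\<Sum>k\<in>B. b k)) * gauss_mean (1 - \<i>)"
proof -
  \<comment> \<open>\<open>?q\<close> is the inverse of \<open>1 - \<i>\<close>, so the squares are
    centred at lifts of the fixed points of \<open>\<i>\<close> on the torus.\<close>
  let ?p = "of_real pi :: complex" and ?q = "(1 + \<i>) / 2" and ?d = "\<lambda>B. \<Sum>k\<in>B. b k"
  note sc = i_char_semichar[OF \<psi>]
  have re: "0 < Re (1 - \<i>)" by simp
  have q: "?q * (1 - \<i>) = 1" by (simp add: algebra_simps)
  \<comment> \<open>completing the square\<close>
  have tm: "kernel_term \<psi> z \<gamma> (\<i> *s z) * exp (- (?p * H z z)) = gterm \<psi> \<gamma> * gauss_fun (1 - \<i>) (z + - (?q *s \<gamma>))" for z \<gamma>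
  proof -
    have Hw: "H (z + - (?q *s \<gamma>)) (z + - (?q *s \<gamma>)) = H z z - ?q * H z \<gamma> - (1 - \<i>) / 2 * H \<gamma> z + H \<gamma> \<gamma> / 2"
      unfolding H_add_left H_add_right H_minus H_smult_left H_smult_right
      by (simp add: algebra_simps add_divide_distrib diff_divide_distrib)
    have "?p * (\<i> * H z z + H z \<gamma> - \<i> * H \<gamma> z) - ?p / 2 * H \<gamma> \<gamma> + - (?p * H z z)
       = - (?p * \<i> / 2 * H \<gamma> \<gamma>) + - (?p * (1 - \<i>) * H (z + - (?q *s \<gamma>)) (z + - (?q *s \<gamma>)))"
      unfolding Hw by (simp add: algebra_simps add_divide_distrib diff_divide_distrib)
    then show ?thesis
      unfolding kernel_term_def gterm_def gauss_fun_def H_smult_right mult.assoc exp_add[symmetric] by (simp only: mult.assoc)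
  qed
  have dG: "?d B \<in> \<Gamma>" for B by (intro Gamma_sum b_in_Gamma)
  have eq: "kernel \<psi> z (\<i> *s z) * exp (- (?p * H z z)) = (\<Sum>B\<in>UNIV. gterm \<psi> (?d B) * gauss_series (1 - \<i>) (z + - (?q *s ?d B)))" for z
  proof -
    let ?f = "\<lambda>\<gamma>. gterm \<psi> \<gamma> * gauss_fun (1 - \<i>) (z + - (?q *s \<gamma>))"
    have s: "?f summable_on \<Gamma>" unfolding tm[symmetric]
      by (intro summable_on_cmult_left kernel_summable semicharD(1)[OF sc])
    have "kernel \<psi> z (\<i> *s z) * exp (- (?p * H z z)) = (\<Sum>\<^sub>\<infinity>\<gamma>\<in>\<Gamma>. ?f \<gamma>)"
      unfolding kernel_def tm[symmetric] by (rule infsum_cmult_left'[symmetric])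
    also have "\<dots> = (\<Sum>B\<in>UNIV. \<Sum>\<^sub>\<infinity>\<epsilon>\<in>\<Gamma>. ?f (?d B + (1 - \<i>) *s \<epsilon>))"
      by (rule infsum_reps[OF reps_one_minus_i s])
    also have "\<dots> = (\<Sum>B\<in>UNIV. gterm \<psi> (?d B) * gauss_series (1 - \<i>) (z + - (?q *s ?d B)))"
    proof (intro sum.cong refl)
      fix B
      have "?f (?d B + (1 - \<i>) *s \<epsilon>) = gterm \<psi> (?d B) * gauss_fun (1 - \<i>) ((z + - (?q *s ?d B)) + - \<epsilon>)" if "\<epsilon> \<in> \<Gamma>" for \<epsilon>
      proof -
        \<comment> \<open>Within a class, \<open>?q\<close> turns multiples of
          \<open>1 - \<i>\<close> into lattice vectors, so the sum over the class is a complete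
          \<open>gauss_series\<close>.\<close>
        have "?q *s (?d B + (1 - \<i>) *s \<epsilon>) = ?q *s ?d B + \<epsilon>"
          unfolding vector_add_ldistrib vector_smult_assoc q by simp
        then show ?thesis unfolding gterm_mod[OF \<psi> dG that] by (simp add: algebra_simps)
      qed
      then have "(\<Sum>\<^sub>\<infinity>\<epsilon>\<in>\<Gamma>. ?f (?d B + (1 - \<i>) *s \<epsilon>)) = (\<Sum>\<^sub>\<infinity>\<epsilon>\<in>\<Gamma>. gterm \<psi> (?d B) * gauss_fun (1 - \<i>) ((z + - (?q *s ?d B)) + - \<epsilon>))"
        by (intro infsum_cong)
      also have "\<dots> = gterm \<psi> (?d B) * (\<Sum>\<^sub>\<infinity>\<epsilon>\<in>\<Gamma>. gauss_fun (1 - \<i>) ((z + - (?q *s ?d B)) + - \<epsilon>))"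
        by (rule infsum_cmult_right')
      also have "(\<Sum>\<^sub>\<infinity>\<epsilon>\<in>\<Gamma>. gauss_fun (1 - \<i>) ((z + - (?q *s ?d B)) + - \<epsilon>)) = gauss_series (1 - \<i>) (z + - (?q *s ?d B))"
        unfolding gauss_series_def by (rule infsum_reindex_bij_betw[OF Gamma_minus_bij])
      finally show "(\<Sum>\<^sub>\<infinity>\<epsilon>\<in>\<Gamma>. ?f (?d B + (1 - \<i>) *s \<epsilon>)) = gterm \<psi> (?d B) * gauss_series (1 - \<i>) (z + - (?q *s ?d B))" .
    qed
    finally show ?thesis .
  qed
  \<comment> \<open>The diagonal mean 1 normalises the kernel, so the mean with the first argument
    rotated is the eigenvalue itself.\<close>
  have "c = c * mean (\<lambda>z. kernel \<psi> z z * exp (- (?p * H z z)))" by (simp add: mean_kernel_diagonal[OF sc])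
  also have "\<dots> = mean (\<lambda>z. kernel \<psi> z (\<i> *s z) * exp (- (?p * H z z)))"
    unfolding mean_cmult[symmetric] c[OF kernel_theta_space[OF sc]] by (simp add: mult.assoc)
  also have "\<dots> = (\<Sum>B\<in>UNIV. mean (\<lambda>z. gterm \<psi> (?d B) * gauss_series (1 - \<i>) (z + - (?q *s ?d B))))"
    unfolding eq
    by (rule mean_sum) (auto intro!: continuous_intros continuous_on_compose2[OF continuous_gauss_series[OF re]])
  also have "\<dots> = (\<Sum>B\<in>UNIV. gterm \<psi> (?d B)) * gauss_mean (1 - \<i>)"
    unfolding mean_cmult mean_gauss_series_shift[OF re] by (simp add: sum_distrib_right)
  finally show ?thesis .
qed

lemma theta_i_eigen:
  assumes \<psi>: "i_char \<psi>" and f: "f \<in> theta_space \<psi>"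
  shows "f (\<i> *s z) = (\<Sum>B\<in>UNIV. gterm \<psi> (\<Sum>k\<in>B. b k)) * gauss_mean (1 - \<i>) * f z"
proof -
  note sc = i_char_semichar[OF \<psi>]
  obtain \<theta> v where \<theta>: "\<theta> \<in> theta_space \<psi>" "\<theta> v \<noteq> 0"
    using theta_function_exists[OF sc] by (auto simp: theta_function_iff)
  obtain c where c: "\<And>z. \<theta> (\<i> *s z) = c * \<theta> z"
    using theta_space_one_dimensional[OF \<theta> theta_space_i[OF \<psi> \<theta>(1)] semicharD(1)[OF sc]] by blast
  have all: "g (\<i> *s z) = c * g z" if g: "g \<in> theta_space \<psi>" for g z
  proof -
    obtain a where "\<And>z. g z = a * \<theta> z"
      using theta_space_one_dimensional[OF \<theta> g semicharD(1)[OF sc]] by blast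
    then show ?thesis by (simp add: c)
  qed
  show ?thesis using all[OF f] trace_formula[OF \<psi> all] by simp
qed

end

section \<open>The i-invariant semicharacters\<close>

lemma sum_sets_prod:
  fixes f :: "'n::finite \<Rightarrow> complex"
  shows "(\<Sum>A\<in>UNIV. \<Prod>k\<in>A. f k) = (\<Prod>k\<in>UNIV. f k + 1)"
  using prod_add[of "UNIV :: 'n set" f "\<lambda>_. 1"] by simp

lemma i_powi_4 [simp]: "\<i> powi (4 * k) = 1"
proof -
  have "\<i> powi (4 * k) = (\<i> ^ 4) powi k" using power_int_mult[of \<i> 4 k] by simp
  also have "\<i> ^ 4 = 1" by (simp add: numeral_eq_Suc)
  finally show ?thesis by simp
qed

lemma i_powi_mod4: assumes "[m = n] (mod 4)" shows "\<i> powi m = \<i> powi n"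
proof -
  obtain k where "n = m + 4 * k" using assms unfolding cong_iff_lin by blast
  then show ?thesis by (simp add: power_int_add)
qed

lemma i_powi_2: "\<i> powi (2 * k) = (-1) powi k"
  using power_int_mult[of \<i> 2 k] by simp

lemma norm_i_powi [simp]: "norm (\<i> powi k) = 1"
  by (simp add: norm_power_int)

lemma exp_i_powi: "exp (- (of_real pi * \<i> / 2 * of_int k)) = \<i> powi (- k)"
proof -
  have "exp (of_real pi * \<i> / 2) = cis (pi / 2)" by (simp add: cis_conv_exp mult.commute)
  then have ei: "exp (of_real pi * \<i> / 2) = \<i>" by simp
  have "exp (- (of_real pi * \<i> / 2 * of_int k)) = exp (of_real pi * \<i> / 2) powi (- k)"
    by (simp add: exp_power_int mult_ac)
  then show ?thesis unfolding ei .
qed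

context unimodular_lattice
begin

text \<open>An integral lift, additive on the lattice, of the class of a coordinate modulo
  \<open>1 - \<i>\<close>.\<close>

definition cpar :: "complex ^ 'n \<Rightarrow> 'n \<Rightarrow> int" where "cpar \<gamma> k = par (ccoo \<gamma> k)"

lemma ccoo_int: "\<gamma> \<in> \<Gamma> \<Longrightarrow> ccoo \<gamma> k \<in> gaussian_ints"
  using Gamma_ccoo by blast

lemma cpar_add: "\<gamma> \<in> \<Gamma> \<Longrightarrow> \<delta> \<in> \<Gamma> \<Longrightarrow> cpar (\<gamma> + \<delta>) k = cpar \<gamma> k + cpar \<delta> k"
  by (simp add: cpar_def ccoo_add par_add ccoo_int)

lemma even_cpar_i: "\<gamma> \<in> \<Gamma> \<Longrightarrow> even (cpar (\<i> *s \<gamma>) k) \<longleftrightarrow> even (cpar \<gamma> k)"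
  by (simp add: cpar_def ccoo_smult even_par_i ccoo_int)

lemma cpar_sum_b: "cpar (\<Sum>k\<in>B. b k) j = (if j \<in> B then 1 else 0)"
  by (simp add: cpar_def ccoo_sum_b)

lemma cpar_b: "cpar (b k) j = (if j = k then 1 else 0)"
  using cpar_sum_b[of "{k}" j] by simp

text \<open>The last two hypotheses on \<open>w\<close> make it trivial on \<open>(1 - \<i>)\<Gamma>\<close>.\<close>

lemma sign_hom_eq:
  assumes add: "\<And>\<gamma> \<delta>. \<gamma> \<in> \<Gamma> \<Longrightarrow> \<delta> \<in> \<Gamma> \<Longrightarrow> w (\<gamma> + \<delta>) = w \<gamma> * (w \<delta> :: complex)"
    and inv: "\<And>\<gamma>. \<gamma> \<in> \<Gamma> \<Longrightarrow> w (\<i> *s \<gamma>) = w \<gamma>"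
    and sq: "\<And>\<gamma>. \<gamma> \<in> \<Gamma> \<Longrightarrow> w \<gamma> * w \<gamma> = 1"
    and \<gamma>: "\<gamma> \<in> \<Gamma>"
  shows "w \<gamma> = (\<Prod>k\<in>UNIV. w (b k) powi cpar \<gamma> k)"
proof -
  have nz: "w \<gamma> \<noteq> 0" if "\<gamma> \<in> \<Gamma>" for \<gamma> using sq[OF that] by auto
  have zero: "w 0 = 1" using add[of 0 0] nz[of 0] by simp
  have neg: "w (- \<gamma>) = w \<gamma>" if "\<gamma> \<in> \<Gamma>" for \<gamma>
  proof -
    have "w \<gamma> * w (- \<gamma>) = w \<gamma> * w \<gamma>" using add[OF that Gamma_minus[OF that]] zero sq[OF that] by simp
    then show ?thesis using nz[OF that] by simp
  qed
  have sums: "w (\<Sum>k\<in>A. f k) = (\<Prod>k\<in>A. w (f k))" if "finite A" "\<And>k. k \<in> A \<Longrightarrow> f k \<in> \<Gamma>" for f and A :: "'n set"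
    using that by (induction A rule: finite_induct) (simp_all add: zero add Gamma_sum)
  have nat_mult: "w (of_nat m *s \<delta>) = w \<delta> ^ m" if "\<delta> \<in> \<Gamma>" for m \<delta>
  proof (induction m)
    case 0
    then show ?case by (simp add: zero)
  next
    case (Suc m)
    have "of_nat (Suc m) *s \<delta> = \<delta> + of_nat m *s \<delta>" by (simp add: vec_eq_iff algebra_simps)
    moreover have "of_nat m *s \<delta> \<in> \<Gamma>" using that by (intro Gamma_smult) auto
    ultimately show ?case using add[OF that] Suc by simp
  qed
  have int_mult: "w (of_int m *s \<delta>) = w \<delta> powi m" if "\<delta> \<in> \<Gamma>" for m \<delta>
  proof (cases "0 \<le> m")
    case True
    then obtain n where "m = int n" using nonneg_int_cases by blast
    then show ?thesis using nat_mult[OF that, of n] by simp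
  next
    case False
    then obtain n where n: "m = - int n" by (metis int_cases4 linorder_not_le less_le_not_le nle_le of_nat_0_le_iff neg_le_0_iff_le)
    have "w (of_int m *s \<delta>) = w (- (of_nat n *s \<delta>))" by (simp add: n vec_eq_iff)
    also have "\<dots> = w (of_nat n *s \<delta>)" using that by (intro neg Gamma_smult) auto
    also have "\<dots> = w \<delta> ^ n" by (rule nat_mult[OF that])
    also have "\<dots> = inverse (w \<delta> ^ n)"
    proof -
      have "inverse (w \<delta>) = w \<delta>" using sq[OF that] by (rule inverse_unique)
      then show ?thesis by (metis power_inverse)
    qed
    finally show ?thesis by (simp add: n power_int_minus)
  qed
  have "w (ccoo \<gamma> k *s b k) = w (b k) powi cpar \<gamma> k" for k
  proof -
    obtain x y where c: "ccoo \<gamma> k = of_int x + \<i> * of_int y"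
      using ccoo_int[OF \<gamma>, of k] unfolding gaussian_ints_iff by blast
    have split: "ccoo \<gamma> k *s b k = of_int x *s b k + \<i> *s (of_int y *s b k)"
      by (simp add: c vec_eq_iff algebra_simps)
    have g: "of_int x *s b k \<in> \<Gamma>" "of_int y *s b k \<in> \<Gamma>" by (intro Gamma_smult b_in_Gamma; simp)+
    have "w (ccoo \<gamma> k *s b k) = w (b k) powi x * w (b k) powi y"
      unfolding split using add[OF g(1) Gamma_i[OF g(2)]] inv[OF g(2)] int_mult[OF b_in_Gamma] by simp
    also have "\<dots> = w (b k) powi (x + y)" using nz[OF b_in_Gamma] by (simp add: power_int_add)
    also have "x + y = cpar \<gamma> k" by (simp only: cpar_def c par_of_int)
    finally show ?thesis .
  qed
  moreover have "w \<gamma> = (\<Prod>k\<in>UNIV. w (ccoo \<gamma> k *s b k))"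
    using sums[of UNIV "\<lambda>k. ccoo \<gamma> k *s b k"] Gamma_smult[OF ccoo_int[OF \<gamma>] b_in_Gamma]
    by (simp add: sum_ccoo)
  ultimately show ?thesis by simp
qed

text \<open>
  A symmetric integer matrix congruent to \<open>S + E\<close> modulo 2, which is the reduction of \<open>H\<close>
  modulo \<open>1 - \<i>\<close>.
\<close>

definition bform :: "'n \<Rightarrow> 'n \<Rightarrow> int" where
  "bform j k = \<lfloor>Re (H (b j) (b k))\<rfloor> + \<bar>\<lfloor>E (b j) (b k)\<rfloor>\<bar>"

text \<open>The matrix is symmetric, so even changes of the coordinates change the value by
  multiples of 4. This is a \<open>\<int>/4\<close>-valued quadratic form on the lattice modulo
  \<open>1 - \<i>\<close>, an explicit base point of the torsor of forms \<open>r\<close>.\<close>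

definition rform :: "complex ^ 'n \<Rightarrow> int" where
  "rform \<gamma> = (\<Sum>j\<in>UNIV. \<Sum>k\<in>UNIV. bform j k * (cpar \<gamma> j * cpar \<gamma> k))"

text \<open>\<open>E\<close> changes sign under exchange; the absolute value in \<open>bform\<close>
  undoes this without altering the parity.\<close>

lemma bform_sym: "bform j k = bform k j"
proof -
  obtain x y where h: "H (b j) (b k) = of_int x + \<i> * of_int y"
    using H_int[OF b_in_Gamma b_in_Gamma] unfolding gaussian_ints_iff by blast
  have "H (b k) (b j) = of_int x - \<i> * of_int y" using H_cnj[of "b k" "b j"] h by simp
  then show ?thesis by (simp add: bform_def h floor_minus)
qed

lemma even_bform: "even (bform j k) \<longleftrightarrow> even (par (H (b j) (b k)))"
  by (simp add: bform_def par_def)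

lemma H_sum_left: "finite A \<Longrightarrow> H (\<Sum>k\<in>A. f k) y = (\<Sum>k\<in>A. H (f k) y)"
  and H_sum_right: "finite A \<Longrightarrow> H y (\<Sum>k\<in>A. f k) = (\<Sum>k\<in>A. H y (f k))"
  by (induction A rule: finite_induct) (simp_all add: H_add_left H_add_right)

lemma gaussian_ints_sum: "(\<And>k. k \<in> A \<Longrightarrow> f k \<in> gaussian_ints) \<Longrightarrow> sum f A \<in> gaussian_ints"
  by (induction A rule: infinite_finite_induct) simp_all

lemma par_sum: "(\<And>k. k \<in> A \<Longrightarrow> f k \<in> gaussian_ints) \<Longrightarrow> par (sum f A) = (\<Sum>k\<in>A. par (f k))"
  by (induction A rule: infinite_finite_induct) (simp_all add: par_add gaussian_ints_sum)

lemma even_sum_cong: "(\<And>k. k \<in> A \<Longrightarrow> even (f k) \<longleftrightarrow> even (g k)) \<Longrightarrow> even (sum f A :: int) \<longleftrightarrow> even (sum g A)"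
  by (induction A rule: infinite_finite_induct) auto

text \<open>Conjugation is trivial modulo \<open>1 - \<i>\<close>, so there \<open>H\<close> becomes
  a symmetric bilinear form over the field with two elements, with matrix
  \<open>bform\<close>.\<close>

lemma even_par_H:
  assumes \<gamma>: "\<gamma> \<in> \<Gamma>" and \<delta>: "\<delta> \<in> \<Gamma>"
  shows "even (par (H \<gamma> \<delta>)) \<longleftrightarrow> even (\<Sum>j\<in>UNIV. \<Sum>k\<in>UNIV. bform j k * (cpar \<gamma> j * cpar \<delta> k))"
proof -
  have "H \<gamma> \<delta> = H (\<Sum>j\<in>UNIV. ccoo \<gamma> j *s b j) (\<Sum>k\<in>UNIV. ccoo \<delta> k *s b k)" by (simp add: sum_ccoo)
  also have "\<dots> = (\<Sum>j\<in>UNIV. \<Sum>k\<in>UNIV. cnj (ccoo \<gamma> j) * (ccoo \<delta> k * H (b j) (b k)))"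
    unfolding H_sum_left[OF finite] H_smult_left
    unfolding H_sum_right[OF finite] H_smult_right sum_distrib_left by (rule refl)
  finally have H: "H \<gamma> \<delta> = (\<Sum>j\<in>UNIV. \<Sum>k\<in>UNIV. cnj (ccoo \<gamma> j) * (ccoo \<delta> k * H (b j) (b k)))" .
  have g: "H (b j) (b k) \<in> gaussian_ints" for j k by (intro H_int b_in_Gamma)
  have t: "cnj (ccoo \<gamma> j) * (ccoo \<delta> k * H (b j) (b k)) \<in> gaussian_ints" for j k
    using g ccoo_int[OF \<gamma>] ccoo_int[OF \<delta>] by simp
  have "par (H \<gamma> \<delta>) = (\<Sum>j\<in>UNIV. \<Sum>k\<in>UNIV. par (cnj (ccoo \<gamma> j) * (ccoo \<delta> k * H (b j) (b k))))"
    unfolding H by (simp add: par_sum gaussian_ints_sum t)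
  also have "even \<dots> \<longleftrightarrow> even (\<Sum>j\<in>UNIV. \<Sum>k\<in>UNIV. bform j k * (cpar \<gamma> j * cpar \<delta> k))"
    by (intro even_sum_cong)
       (auto simp: even_par_mult even_par_cnj g ccoo_int[OF \<gamma>] ccoo_int[OF \<delta>] even_bform cpar_def)
  finally show ?thesis .
qed

lemma rform_add:
  assumes "\<gamma> \<in> \<Gamma>" "\<delta> \<in> \<Gamma>"
  shows "rform (\<gamma> + \<delta>) = rform \<gamma> + rform \<delta> + 2 * (\<Sum>j\<in>UNIV. \<Sum>k\<in>UNIV. bform j k * (cpar \<gamma> j * cpar \<delta> k))"
proof -
  have sym: "(\<Sum>j\<in>UNIV. \<Sum>k\<in>UNIV. bform j k * (cpar \<delta> j * cpar \<gamma> k)) = (\<Sum>j\<in>UNIV. \<Sum>k\<in>UNIV. bform j k * (cpar \<gamma> j * cpar \<delta> k))"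
    by (subst sum.swap) (simp add: bform_sym mult.commute)
  have "rform (\<gamma> + \<delta>) = rform \<gamma> + rform \<delta> + ((\<Sum>j\<in>UNIV. \<Sum>k\<in>UNIV. bform j k * (cpar \<gamma> j * cpar \<delta> k)) +
      (\<Sum>j\<in>UNIV. \<Sum>k\<in>UNIV. bform j k * (cpar \<delta> j * cpar \<gamma> k)))"
    unfolding rform_def sum.distrib[symmetric] using assms
    by (intro sum.cong refl) (simp add: cpar_add algebra_simps)
  then show ?thesis by (simp add: sym)
qed

lemma rform_even_cpar:
  assumes "\<And>k. even (cpar \<gamma> k)" shows "[rform \<gamma> = 0] (mod 4)"
proof -
  have "4 dvd bform j k * (cpar \<gamma> j * cpar \<gamma> k)" for j k
    using mult_dvd_mono[of 2 "cpar \<gamma> j" 2 "cpar \<gamma> k"] assms by simp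
  then show ?thesis unfolding rform_def cong_0_iff by (intro dvd_sum)
qed

text \<open>\<open>\<i>\<close> acts trivially modulo \<open>1 - \<i>\<close>: the two vectors
  differ by one with even coordinates, which contributes a multiple of 4.\<close>

lemma rform_i:
  assumes \<gamma>: "\<gamma> \<in> \<Gamma>" shows "[rform (\<i> *s \<gamma>) = rform \<gamma>] (mod 4)"
proof -
  let ?\<delta> = "\<i> *s \<gamma> + - \<gamma>"
  have d: "?\<delta> \<in> \<Gamma>" by (intro Gamma_add Gamma_i Gamma_minus \<gamma>)
  have e: "even (cpar ?\<delta> k)" for k
  proof -
    have "cpar (- \<gamma>) k = - cpar \<gamma> k" using cpar_add[OF \<gamma> Gamma_minus[OF \<gamma>], of k]
      by (simp add: cpar_def ccoo_def)
    then show ?thesis using cpar_add[OF Gamma_i[OF \<gamma>] Gamma_minus[OF \<gamma>], of k] even_cpar_i[OF \<gamma>, of k] by simp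
  qed
  have "rform (?\<delta> + \<gamma>) = rform ?\<delta> + rform \<gamma> + 2 * (\<Sum>j\<in>UNIV. \<Sum>k\<in>UNIV. bform j k * (cpar ?\<delta> j * cpar \<gamma> k))"
    by (rule rform_add[OF d \<gamma>])
  moreover have "even (\<Sum>j\<in>UNIV. \<Sum>k\<in>UNIV. bform j k * (cpar ?\<delta> j * cpar \<gamma> k))"
    by (intro dvd_sum dvd_mult dvd_mult2 e)
  then have "4 dvd 2 * (\<Sum>j\<in>UNIV. \<Sum>k\<in>UNIV. bform j k * (cpar ?\<delta> j * cpar \<gamma> k))" by auto
  moreover have "4 dvd rform ?\<delta>" using rform_even_cpar[OF e] by (simp add: cong_0_iff)
  moreover have "?\<delta> + \<gamma> = \<i> *s \<gamma>" by simp
  ultimately show ?thesis by (simp add: cong_iff_dvd_diff)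
qed

definition chi :: "'n set \<Rightarrow> complex ^ 'n \<Rightarrow> int" where "chi A \<gamma> = (\<Sum>k\<in>A. cpar \<gamma> k)"

text \<open>In the notation of the overview, \<open>r = rform + 2 chi A\<close>, and the exponent of
  \<open>\<i>\<close> is \<open>q = r + H\<close>. The signs given by \<open>chi A\<close> are the
  characters of the lattice modulo \<open>1 - \<i>\<close>.\<close>

definition psi :: "'n set \<Rightarrow> complex ^ 'n \<Rightarrow> complex" where
  "psi A \<gamma> = \<i> powi (rform \<gamma> + \<lfloor>Re (H \<gamma> \<gamma>)\<rfloor>) * (-1) powi chi A \<gamma>"

lemma chi_add: "\<gamma> \<in> \<Gamma> \<Longrightarrow> \<delta> \<in> \<Gamma> \<Longrightarrow> chi A (\<gamma> + \<delta>) = chi A \<gamma> + chi A \<delta>"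
  by (simp add: chi_def cpar_add sum.distrib)

lemma H_self_int: "\<gamma> \<in> \<Gamma> \<Longrightarrow> H \<gamma> \<gamma> = of_int \<lfloor>Re (H \<gamma> \<gamma>)\<rfloor>"
  using H_int[of \<gamma> \<gamma>] H_self_real(1)[of \<gamma>] by (auto simp: gaussian_ints_def complex_eq_iff elim!: Ints_cases)

text \<open>Under addition \<open>rform\<close> contributes twice the real plus imaginary part of
  \<open>H \<gamma> \<delta>\<close> modulo 4, and the diagonal value of \<open>H\<close>
  contributes twice the real part. Twice the imaginary part remains, as the semicharacter law
  demands.\<close>

lemma i_char_psi: "i_char (psi A)"
  unfolding i_char_def semicharacter_def form_E_def
proof (intro conjI ballI)
  fix \<gamma> assume \<gamma>: "\<gamma> \<in> \<Gamma>"
  show "norm (psi A \<gamma>) = 1" by (simp add: psi_def norm_mult norm_power_int)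
  have "even (chi A (\<i> *s \<gamma>)) \<longleftrightarrow> even (chi A \<gamma>)"
    unfolding chi_def by (intro even_sum_cong even_cpar_i \<gamma>)
  moreover have "H (\<i> *s \<gamma>) (\<i> *s \<gamma>) = H \<gamma> \<gamma>" by (simp add: H_smult_left H_smult_right)
  moreover have "\<i> powi (rform (\<i> *s \<gamma>) + \<lfloor>Re (H \<gamma> \<gamma>)\<rfloor>) = \<i> powi (rform \<gamma> + \<lfloor>Re (H \<gamma> \<gamma>)\<rfloor>)"
    by (intro i_powi_mod4 cong_add rform_i \<gamma> cong_refl)
  ultimately show "psi A (\<i> *s \<gamma>) = psi A \<gamma>" by (simp add: psi_def minus_one_powi)
  fix \<delta> assume \<delta>: "\<delta> \<in> \<Gamma>"
  obtain x y where h: "H \<gamma> \<delta> = of_int x + \<i> * of_int y"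
    using H_int[OF \<gamma> \<delta>] unfolding gaussian_ints_iff by blast
  have hc: "H \<delta> \<gamma> = of_int x - \<i> * of_int y" using H_cnj[of \<delta> \<gamma>] h by simp
  define s where "s = (\<Sum>j\<in>UNIV. \<Sum>k\<in>UNIV. bform j k * (cpar \<gamma> j * cpar \<delta> k))"
  have "par (H \<gamma> \<delta>) = x + y" unfolding h by (rule par_of_int)
  then have es: "even s \<longleftrightarrow> even (x + y)" using even_par_H[OF \<gamma> \<delta>] by (simp add: s_def)
  have "Re (H (\<gamma> + \<delta>) (\<gamma> + \<delta>)) = Re (H \<gamma> \<gamma>) + Re (H \<delta> \<delta>) + of_int (2 * x)"
    by (simp add: H_add_left H_add_right h hc)
  also have "\<dots> = of_int (\<lfloor>Re (H \<gamma> \<gamma>)\<rfloor> + \<lfloor>Re (H \<delta> \<delta>)\<rfloor> + 2 * x)"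
    using H_self_int[OF \<gamma>] H_self_int[OF \<delta>] by (simp add: complex_eq_iff)
  finally have f: "\<lfloor>Re (H (\<gamma> + \<delta>) (\<gamma> + \<delta>))\<rfloor> = \<lfloor>Re (H \<gamma> \<gamma>)\<rfloor> + \<lfloor>Re (H \<delta> \<delta>)\<rfloor> + 2 * x"
    by (simp only: floor_of_int)
  have "rform (\<gamma> + \<delta>) + \<lfloor>Re (H (\<gamma> + \<delta>) (\<gamma> + \<delta>))\<rfloor>
     = (rform \<gamma> + \<lfloor>Re (H \<gamma> \<gamma>)\<rfloor>) + ((rform \<delta> + \<lfloor>Re (H \<delta> \<delta>)\<rfloor>) + 2 * (s + x))"
    unfolding f rform_add[OF \<gamma> \<delta>] s_def[symmetric] by simp
  then have "\<i> powi (rform (\<gamma> + \<delta>) + \<lfloor>Re (H (\<gamma> + \<delta>) (\<gamma> + \<delta>))\<rfloor>)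
     = \<i> powi (rform \<gamma> + \<lfloor>Re (H \<gamma> \<gamma>)\<rfloor>) * (\<i> powi (rform \<delta> + \<lfloor>Re (H \<delta> \<delta>)\<rfloor>) * (-1) powi (s + x))"
    by (simp only: power_int_add i_powi_2 complex_i_not_zero simp_thms)
  moreover have "(-1 :: complex) powi (s + x) = (-1) powi \<lfloor>E \<gamma> \<delta>\<rfloor>"
    using es by (auto simp: minus_one_powi h)
  ultimately show "psi A (\<gamma> + \<delta>) = psi A \<gamma> * psi A \<delta> * (-1) powi \<lfloor>Im (H \<gamma> \<delta>)\<rfloor>"
    unfolding psi_def chi_add[OF \<gamma> \<delta>] minus_one_powi_add by (simp only: mult_ac)
qed

text \<open>The product with the base point \<open>psi {}\<close> is a sign homomorphism trivial on
  multiples of \<open>1 - \<i>\<close>, hence determined on the basis; \<open>A\<close> collects the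
  basis vectors of value -1.\<close>

lemma i_char_eq_psi:
  assumes \<psi>: "i_char \<psi>"
  obtains A where "\<And>\<gamma>. \<gamma> \<in> \<Gamma> \<Longrightarrow> \<psi> \<gamma> = psi A \<gamma>"
proof -
  define w where "w \<gamma> = \<psi> \<gamma> * psi {} \<gamma>" for \<gamma>
  define A where "A = {k. w (b k) = -1}"
  note p0 = i_char_psi[of "{}"]
  have pm: "w \<gamma> = 1 \<or> w \<gamma> = -1" if "\<gamma> \<in> \<Gamma>" for \<gamma>
    using i_char_pm[OF \<psi> that] i_char_pm[OF p0 that] by (auto simp: w_def)
  have "w \<gamma> = (-1) powi chi A \<gamma>" if \<gamma>: "\<gamma> \<in> \<Gamma>" for \<gamma>
  proof -
    have "w \<gamma> = (\<Prod>k\<in>UNIV. w (b k) powi cpar \<gamma> k)"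
    proof (rule sign_hom_eq[OF _ _ _ \<gamma>])
      show "w (\<gamma> + \<delta>) = w \<gamma> * w \<delta>" if "\<gamma> \<in> \<Gamma>" "\<delta> \<in> \<Gamma>" for \<gamma> \<delta>
        unfolding w_def semicharD(2)[OF i_char_semichar[OF \<psi>] that] semicharD(2)[OF i_char_semichar[OF p0] that]
        by (simp add: minus_one_powi)
      show "w (\<i> *s \<gamma>) = w \<gamma>" if "\<gamma> \<in> \<Gamma>" for \<gamma>
        by (simp add: w_def i_char_i[OF \<psi> that] i_char_i[OF p0 that])
      show "w \<gamma> * w \<gamma> = 1" if "\<gamma> \<in> \<Gamma>" for \<gamma> using pm[OF that] by auto
    qed
    also have "\<dots> = (\<Prod>k\<in>UNIV. if k \<in> A then (-1) powi cpar \<gamma> k else 1)"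
    proof (intro prod.cong refl)
      fix k show "w (b k) powi cpar \<gamma> k = (if k \<in> A then (-1) powi cpar \<gamma> k else 1)"
        using pm[OF b_in_Gamma, of k] by (auto simp: A_def)
    qed
    also have "\<dots> = (\<Prod>k\<in>A. (-1) powi cpar \<gamma> k)" by (simp add: prod.If_cases)
    also have "\<dots> = (-1) powi chi A \<gamma>"
      unfolding chi_def using finite[of A]
      by (induction A rule: finite_induct) (simp_all add: minus_one_powi_add)
    finally show ?thesis .
  qed
  moreover have "\<psi> \<gamma> = psi {} \<gamma> * w \<gamma>" if "\<gamma> \<in> \<Gamma>" for \<gamma>
    using i_char_square[OF p0 that] by (simp add: w_def mult_ac)
  ultimately have "\<psi> \<gamma> = psi A \<gamma>" if "\<gamma> \<in> \<Gamma>" for \<gamma> using that by (simp add: psi_def chi_def)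
  then show ?thesis by (rule that)
qed

lemma psi_inj:
  assumes "\<And>\<gamma>. \<gamma> \<in> \<Gamma> \<Longrightarrow> psi A \<gamma> = psi B \<gamma>" shows "A = B"
proof -
  have "k \<in> A \<longleftrightarrow> k \<in> B" for k
  proof -
    define u where "u = \<i> powi (rform (b k) + \<lfloor>Re (H (b k) (b k))\<rfloor>)"
    have "u \<noteq> 0" by (simp add: u_def)
    have p: "psi C (b k) = u * (if k \<in> C then -1 else 1)" for C
      unfolding psi_def u_def[symmetric] chi_def cpar_b by (simp add: minus_one_powi)
    have "u * (if k \<in> A then -1 else 1) = u * (if k \<in> B then -1 else 1)"
      using assms[OF b_in_Gamma, of k] unfolding p .
    then have "(if k \<in> A then -1 else 1 :: complex) = (if k \<in> B then -1 else 1)"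
      using \<open>u \<noteq> 0\<close> mult_left_cancel by blast
    then show ?thesis by (simp split: if_splits)
  qed
  then show ?thesis by blast
qed

text \<open>Orthogonality of characters: the sum over subsets factors over the coordinates, and an
  odd coordinate contributes the factor \<open>1 - 1\<close>.\<close>

lemma sum_sign_chi:
  "(\<Sum>A\<in>UNIV. (-1 :: complex) powi chi A \<gamma>) = (if \<forall>k. even (cpar \<gamma> k) then 2 ^ CARD('n) else 0)"
proof -
  have "(-1 :: complex) powi chi A \<gamma> = (\<Prod>k\<in>A. (-1) powi cpar \<gamma> k)" for A
    unfolding chi_def using finite[of A]
    by (induction A rule: finite_induct) (simp_all add: minus_one_powi_add)
  then have "(\<Sum>A\<in>UNIV. (-1 :: complex) powi chi A \<gamma>) = (\<Prod>k\<in>UNIV. (-1) powi cpar \<gamma> k + 1)"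
    by (simp add: sum_sets_prod)
  also have "\<dots> = (if \<forall>k. even (cpar \<gamma> k) then 2 ^ CARD('n) else 0)"
    by (auto simp: minus_one_powi intro!: prod_zero)
  finally show ?thesis .
qed

end

section \<open>Counting the eigenvalues\<close>

lemma one_plus_i_power: "(1 + \<i>) ^ n = of_real (2 powr (real n / 2)) * cis (pi * real n / 4)"
proof -
  have "1 + \<i> = of_real (sqrt 2) * cis (pi / 4)"
    by (simp add: complex_eq_iff cos_45 sin_45)
  then have "(1 + \<i>) ^ n = of_real (sqrt 2 ^ n) * cis (real n * (pi / 4))"
    by (simp only: power_mult_distrib Complex.DeMoivre of_real_power)
  moreover have "sqrt 2 ^ n = 2 powr (real n / 2)"
    by (simp add: powr_half_sqrt[symmetric] powr_powr powr_realpow[symmetric])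
  ultimately show ?thesis by (simp add: mult.commute)
qed

lemma has_sum_finite_sum:
  fixes f :: "'i \<Rightarrow> 'a \<Rightarrow> complex"
  shows "finite I \<Longrightarrow> (\<And>i. i \<in> I \<Longrightarrow> (f i has_sum s i) A) \<Longrightarrow> ((\<lambda>x. \<Sum>i\<in>I. f i x) has_sum (\<Sum>i\<in>I. s i)) A"
  by (induction I rule: finite_induct) (auto intro: has_sum_add)

lemma i_power_eq_1_iff: "\<i> ^ n = 1 \<longleftrightarrow> 4 dvd n"
proof -
  have i4: "\<i> ^ 4 = 1" by (simp add: numeral_eq_Suc)
  show ?thesis
  proof
  assume "4 dvd n"
  then obtain m where "n = 4 * m" by blast
  then show "\<i> ^ n = 1" by (simp only: power_mult i4 power_one)
next
  assume a: "\<i> ^ n = 1"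
  have "\<i> ^ n = \<i> ^ (4 * (n div 4) + n mod 4)" by simp
  also have "\<dots> = \<i> ^ (n mod 4)" unfolding power_add power_mult i4 by simp
  finally have "\<i> ^ (n mod 4) = 1" using a by simp
  moreover have "n mod 4 = 0 \<or> n mod 4 = 1 \<or> n mod 4 = 2 \<or> n mod 4 = 3" by linarith
  moreover have "\<i> ^ 1 \<noteq> 1" "\<i> ^ 2 \<noteq> 1" "\<i> ^ 3 \<noteq> 1"
    by (simp_all add: complex_eq_iff power3_eq_cube)
  ultimately have "n mod 4 = 0" by metis
  then show "4 dvd n" by auto
  qed
qed

context unimodular_lattice
begin

text \<open>By \<open>gterm_psi\<close> this is the quadratic Gauss sum of \<open>r\<close> over the
  lattice modulo \<open>1 - \<i>\<close>.\<close>

definition gsum :: "'n set \<Rightarrow> complex" where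
  "gsum A = (\<Sum>B\<in>UNIV. gterm (psi A) (\<Sum>k\<in>B. b k))"

definition eig :: "'n set \<Rightarrow> complex" where "eig A = gsum A * gauss_mean (1 - \<i>)"

lemma eig: "f \<in> theta_space (psi A) \<Longrightarrow> f (\<i> *s z) = eig A * f z"
  unfolding eig_def gsum_def by (rule theta_i_eigen[OF i_char_psi])

lemma theta_psi_exists: obtains \<theta> v where "\<theta> \<in> theta_space (psi A)" "\<theta> v \<noteq> 0"
  using theta_function_exists[OF i_char_semichar[OF i_char_psi, of A]] by (auto simp: theta_function_iff)

lemma eig_pow4: "eig A ^ 4 = 1"
proof -
  obtain \<theta> v where t: "\<theta> \<in> theta_space (psi A)" "\<theta> v \<noteq> 0" by (rule theta_psi_exists)
  have "\<theta> (\<i> *s (\<i> *s (\<i> *s (\<i> *s v)))) = eig A * (eig A * (eig A * (eig A * \<theta> v)))"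
    unfolding eig[OF t(1)] ..
  moreover have "\<i> *s (\<i> *s (\<i> *s (\<i> *s v))) = v" by (simp add: vec_eq_iff)
  ultimately show ?thesis using t(2) by (simp add: numeral_eq_Suc mult.assoc)
qed

lemma norm_eig: "norm (eig A) = 1"
proof -
  have "norm (eig A) ^ 4 = 1" using eig_pow4[of A] by (metis norm_one norm_power)
  then show ?thesis using power_eq_imp_eq_base[of "norm (eig A)" 4 1] by simp
qed

lemma eig_cases: "eig A = 1 \<or> eig A = -1 \<or> eig A = \<i> \<or> eig A = - \<i>"
proof -
  have "(eig A - 1) * (eig A + 1) * (eig A - \<i>) * (eig A + \<i>) = 0"
    using eig_pow4[of A] by (simp add: algebra_simps numeral_eq_Suc)
  then show ?thesis by (auto simp: eq_neg_iff_add_eq_0)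
qed

definition rep :: "'n set \<Rightarrow> complex ^ 'n" where "rep B = (\<Sum>k\<in>B. b k)"

lemma rep_in_Gamma: "rep B \<in> \<Gamma>"
  unfolding rep_def by (intro Gamma_sum b_in_Gamma)

lemma cpar_rep: "cpar (rep B) k = (if k \<in> B then 1 else 0)"
  by (simp add: rep_def cpar_sum_b)

text \<open>The exponential in \<open>gterm\<close> cancels the power of \<open>\<i>\<close> that
  comes from \<open>H\<close> in \<open>psi A\<close>; conjugation has no effect since the values of
  \<open>psi A\<close> are signs.\<close>

lemma gterm_psi:
  assumes \<gamma>: "\<gamma> \<in> \<Gamma>"
  shows "gterm (psi A) \<gamma> = \<i> powi rform \<gamma> * (-1) powi chi A \<gamma>"
proof -
  have "cnj (psi A \<gamma>) = psi A \<gamma>" using i_char_pm[OF i_char_psi \<gamma>, of A] by auto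
  moreover have "exp (- (of_real pi * \<i> / 2 * H \<gamma> \<gamma>)) = \<i> powi (- \<lfloor>Re (H \<gamma> \<gamma>)\<rfloor>)"
    using exp_i_powi[of "\<lfloor>Re (H \<gamma> \<gamma>)\<rfloor>"] H_self_int[OF \<gamma>] by simp
  ultimately show ?thesis by (simp add: gterm_def psi_def power_int_add power_int_minus)
qed

lemma gsum_eq: "gsum A = (\<Sum>B\<in>UNIV. \<i> powi rform (rep B) * (-1) powi chi A (rep B))"
  unfolding gsum_def rep_def[symmetric] by (simp add: gterm_psi rep_in_Gamma)

lemma rform_0 [simp]: "rform 0 = 0"
  by (simp add: rform_def cpar_def ccoo_def)

lemma sum_chi_rep: "(\<Sum>A\<in>UNIV. (-1 :: complex) powi chi A (rep B)) = (if B = {} then 2 ^ CARD('n) else 0)"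
  unfolding sum_sign_chi by (auto simp: cpar_rep)

lemma sum_chi_rep2: "(\<Sum>A\<in>UNIV. (-1 :: complex) powi chi A (rep B) * (-1) powi chi A (rep B')) = (if B = B' then 2 ^ CARD('n) else 0)"
proof -
  have "(\<forall>k. even (cpar (rep B + rep B') k)) \<longleftrightarrow> B = B'"
    by (auto simp: cpar_add rep_in_Gamma cpar_rep split: if_splits)
  then show ?thesis
    using sum_sign_chi[of "rep B + rep B'"] by (simp add: chi_add rep_in_Gamma minus_one_powi_add)
qed

lemma sum_gsum: "(\<Sum>A\<in>UNIV. gsum A) = 2 ^ CARD('n)"
proof -
  have "(\<Sum>A\<in>UNIV. gsum A) = (\<Sum>B\<in>UNIV. \<i> powi rform (rep B) * (\<Sum>A\<in>UNIV. (-1) powi chi A (rep B)))"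
    unfolding gsum_eq sum_distrib_left by (rule sum.swap)
  also have "\<dots> = (\<Sum>B\<in>(UNIV::'n set set). if B = {} then 2 ^ CARD('n) else 0)"
    unfolding sum_chi_rep by (intro sum.cong refl) (simp add: rep_def)
  finally show ?thesis by simp
qed

text \<open>Taken with the identity for \<open>u\<close> it serves the sum of squares, with
  conjugation the sum of squared norms.\<close>

lemma sum_gsum_bilinear:
  fixes u :: "complex \<Rightarrow> complex"
  assumes u: "\<And>f. u (\<Sum>B\<in>(UNIV::'n set set). f B) = (\<Sum>B\<in>UNIV. u (f B))" "\<And>x k. u (x * (-1) powi k) = u x * (-1) powi k"
  shows "(\<Sum>A\<in>UNIV. gsum A * u (gsum A)) = 2 ^ CARD('n) * (\<Sum>B\<in>UNIV. \<i> powi rform (rep B) * u (\<i> powi rform (rep B)))"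
proof -
  let ?r = "\<lambda>B. \<i> powi rform (rep B)" and ?s = "\<lambda>A B. (-1 :: complex) powi chi A (rep B)"
  have "gsum A * u (gsum A) = (\<Sum>B\<in>UNIV. \<Sum>B'\<in>UNIV. ?r B * u (?r B') * (?s A B * ?s A B'))" for A
    unfolding gsum_eq u sum_product by (simp add: mult_ac)
  then have "(\<Sum>A\<in>UNIV. gsum A * u (gsum A)) = (\<Sum>A\<in>UNIV. \<Sum>B\<in>UNIV. \<Sum>B'\<in>UNIV. ?r B * u (?r B') * (?s A B * ?s A B'))"
    by simp
  also have "\<dots> = (\<Sum>B\<in>UNIV. \<Sum>A\<in>UNIV. \<Sum>B'\<in>UNIV. ?r B * u (?r B') * (?s A B * ?s A B'))"
    by (rule sum.swap)
  also have "\<dots> = (\<Sum>B\<in>UNIV. \<Sum>B'\<in>UNIV. \<Sum>A\<in>UNIV. ?r B * u (?r B') * (?s A B * ?s A B'))"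
    by (intro sum.cong refl sum.swap)
  also have "\<dots> = (\<Sum>B\<in>UNIV. \<Sum>B'\<in>UNIV. if B = B' then 2 ^ CARD('n) * (?r B * u (?r B)) else 0)"
    unfolding sum_distrib_left[symmetric] sum_chi_rep2 by (intro sum.cong refl) simp
  also have "\<dots> = 2 ^ CARD('n) * (\<Sum>B\<in>UNIV. ?r B * u (?r B))"
    by (simp add: sum_distrib_left)
  finally show ?thesis .
qed

text \<open>The modulus comes from two evaluations of a sum of squared norms: each
  \<open>eig A\<close> has norm 1, while orthogonality gives \<open>4^g\<close> for the Gauss sums.
  The argument comes from \<open>gauss_mean_eq\<close>, by which \<open>(1 - \<i>)^g\<close> times
  the value is nonnegative.\<close>

lemma gauss_mean_value: "gauss_mean (1 - \<i>) * (1 - \<i>) ^ CARD('n) = 1"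
proof -
  let ?n = "CARD('n)"
  have "(\<Sum>A\<in>(UNIV::'n set set). gsum A * cnj (gsum A)) = 2 ^ ?n * (\<Sum>B\<in>(UNIV::'n set set). \<i> powi rform (rep B) * cnj (\<i> powi rform (rep B)))"
    by (rule sum_gsum_bilinear) (simp_all add: minus_one_powi)
  also have "\<dots> = 2 ^ ?n * 2 ^ ?n"
  proof -
    have "\<i> powi k * cnj (\<i> powi k) = 1" for k using complex_norm_square[of "\<i> powi k"] by simp
    then show ?thesis by (simp add: card_UNIV_set)
  qed
  finally have 1: "(\<Sum>A\<in>(UNIV::'n set set). gsum A * cnj (gsum A)) = 2 ^ ?n * 2 ^ ?n" .
  have "(\<Sum>A\<in>(UNIV::'n set set). eig A * cnj (eig A)) = 2 ^ ?n"
  proof -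
    have "eig A * cnj (eig A) = 1" for A using complex_norm_square[of "eig A"] norm_eig[of A] by simp
    then show ?thesis by (simp add: card_UNIV_set)
  qed
  moreover have "(\<Sum>A\<in>(UNIV::'n set set). eig A * cnj (eig A)) = (\<Sum>A\<in>(UNIV::'n set set). gsum A * cnj (gsum A)) * (gauss_mean (1 - \<i>) * cnj (gauss_mean (1 - \<i>)))"
    unfolding sum_distrib_right by (intro sum.cong refl) (simp add: eig_def mult_ac)
  ultimately have M2: "2 ^ ?n * (gauss_mean (1 - \<i>) * cnj (gauss_mean (1 - \<i>))) = 1" using 1 by simp
  obtain r where r: "0 \<le> r" "gauss_mean 1 = of_real r" by (rule gauss_mean_one)
  have e: "(1 - \<i>) ^ ?n * gauss_mean (1 - \<i>) = of_real r" using gauss_mean_eq[of "1 - \<i>"] r by simp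
  have "(1 - \<i>) * cnj (1 - \<i>) = 2" by (simp add: algebra_simps)
  then have P: "(1 - \<i>) ^ ?n * cnj ((1 - \<i>) ^ ?n) = 2 ^ ?n" by (simp only: complex_cnj_power power_mult_distrib[symmetric])
  have "((1 - \<i>) ^ ?n * gauss_mean (1 - \<i>)) * cnj ((1 - \<i>) ^ ?n * gauss_mean (1 - \<i>))
      = ((1 - \<i>) ^ ?n * cnj ((1 - \<i>) ^ ?n)) * (gauss_mean (1 - \<i>) * cnj (gauss_mean (1 - \<i>)))"
    by (simp only: complex_cnj_mult mult_ac)
  then have "((1 - \<i>) ^ ?n * gauss_mean (1 - \<i>)) * cnj ((1 - \<i>) ^ ?n * gauss_mean (1 - \<i>)) = 1"
    unfolding P M2 .
  then have "complex_of_real (r * r) = of_real 1" unfolding e by simp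
  then have "r * r = 1" by (simp only: of_real_eq_iff)
  then have "r = 1" using r(1) square_eq_1_iff[of r] by auto
  then show ?thesis using e by (simp add: mult.commute)
qed

lemma gauss_mean_value': "2 ^ CARD('n) * gauss_mean (1 - \<i>) = (1 + \<i>) ^ CARD('n)"
proof -
  have "(1 + \<i>) ^ CARD('n) * (1 - \<i>) ^ CARD('n) = 2 ^ CARD('n)"
    unfolding power_mult_distrib[symmetric] by (simp add: algebra_simps)
  then have "2 ^ CARD('n) * gauss_mean (1 - \<i>) = (1 + \<i>) ^ CARD('n) * (gauss_mean (1 - \<i>) * (1 - \<i>) ^ CARD('n))"
    by (simp add: mult_ac)
  then show ?thesis by (simp add: gauss_mean_value)
qed

lemma sum_eig: "(\<Sum>A\<in>UNIV. eig A) = (1 + \<i>) ^ CARD('n)"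
  unfolding eig_def sum_distrib_right[symmetric] sum_gsum by (rule gauss_mean_value')

definition hdiag :: "'n \<Rightarrow> int" where "hdiag k = \<lfloor>Re (H (b k) (b k))\<rfloor>"

text \<open>The cross term in \<open>rform_add\<close> is even, so the parity of
  \<open>rform\<close> is additive and determined by the diagonal of the Gram matrix.\<close>

lemma minus_one_powi_rform: "\<gamma> \<in> \<Gamma> \<Longrightarrow> (-1 :: complex) powi rform \<gamma> = (\<Prod>k\<in>UNIV. ((-1) powi hdiag k) powi cpar \<gamma> k)"
proof -
  assume \<gamma>: "\<gamma> \<in> \<Gamma>"
  have rb: "rform (b k) = hdiag k" for k
  proof -
    have "rform (b k) = (\<Sum>i\<in>UNIV. \<Sum>j\<in>UNIV. if i = k then (if j = k then bform i j else 0) else 0)"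
      unfolding rform_def cpar_b by (intro sum.cong refl) auto
    also have "\<dots> = (\<Sum>i\<in>UNIV. if i = k then bform i k else 0)"
      by (intro sum.cong refl) simp
    also have "\<dots> = bform k k" by simp
    finally show ?thesis by (simp add: bform_def hdiag_def H_self_real(1))
  qed
  have "(-1 :: complex) powi rform \<gamma> = (\<Prod>k\<in>UNIV. ((-1) powi rform (b k)) powi cpar \<gamma> k)"
  proof (rule sign_hom_eq[OF _ _ _ \<gamma>])
    show "(-1 :: complex) powi rform (\<gamma> + \<delta>) = (-1) powi rform \<gamma> * (-1) powi rform \<delta>" if "\<gamma> \<in> \<Gamma>" "\<delta> \<in> \<Gamma>" for \<gamma> \<delta>
      by (simp add: rform_add[OF that] minus_one_powi)
    show "(-1 :: complex) powi rform (\<i> *s \<gamma>) = (-1) powi rform \<gamma>" if "\<gamma> \<in> \<Gamma>" for \<gamma>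
    proof -
      have "[rform (\<i> *s \<gamma>) = rform \<gamma>] (mod 2)" using rform_i[OF that] by (rule cong_dvd_modulus) simp
      then have "even (rform (\<i> *s \<gamma>)) \<longleftrightarrow> even (rform \<gamma>)" by (simp add: cong_def even_iff_mod_2_eq_zero)
      then show ?thesis by (simp add: minus_one_powi)
    qed
    show "(-1 :: complex) powi rform \<gamma> * (-1) powi rform \<gamma> = 1" for \<gamma> by (simp add: minus_one_powi)
  qed
  then show ?thesis by (simp add: rb)
qed

lemma even_rform_H: "\<gamma> \<in> \<Gamma> \<Longrightarrow> even (rform \<gamma>) \<longleftrightarrow> even \<lfloor>Re (H \<gamma> \<gamma>)\<rfloor>"
proof -
  assume \<gamma>: "\<gamma> \<in> \<Gamma>"
  have "even (rform \<gamma>) \<longleftrightarrow> even (par (H \<gamma> \<gamma>))" using even_par_H[OF \<gamma> \<gamma>] by (simp add: rform_def)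
  then show ?thesis by (simp add: par_def H_self_real(1))
qed

lemma even_lattice_iff: "even_lattice \<Gamma> H \<longleftrightarrow> (\<forall>\<gamma>\<in>\<Gamma>. even (rform \<gamma>))"
proof -
  have "(\<exists>k::int. form_S H x x = 2 * of_int k) \<longleftrightarrow> even (rform x)" if x: "x \<in> \<Gamma>" for x
  proof
    assume "\<exists>k::int. form_S H x x = 2 * of_int k"
    then obtain k :: int where "Re (H x x) = of_int (2 * k)" by (auto simp: form_S_def)
    then have "\<lfloor>Re (H x x)\<rfloor> = 2 * k" by (simp only: floor_of_int)
    then show "even (rform x)" by (simp add: even_rform_H[OF x])
  next
    assume "even (rform x)"
    then obtain k where "\<lfloor>Re (H x x)\<rfloor> = 2 * k" using even_rform_H[OF x] by blast
    then have "Re (H x x) = 2 * of_int k" using H_self_int[OF x] by (metis Re_complex_of_real of_int_mult of_int_numeral of_real_of_int_eq)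
    then show "\<exists>k::int. form_S H x x = 2 * of_int k" by (auto simp: form_S_def)
  qed
  then show ?thesis by (simp add: even_lattice_def)
qed

lemma sum_gsum_square: "(\<Sum>A\<in>UNIV. gsum A * gsum A) = 2 ^ CARD('n) * (\<Sum>B\<in>UNIV. (-1) powi rform (rep B))"
proof -
  have "\<i> powi k * \<i> powi k = (-1) powi k" for k
    unfolding power_int_mult_distrib[symmetric] by simp
  then show ?thesis using sum_gsum_bilinear[of "\<lambda>x. x"] by simp
qed

text \<open>For an odd lattice the parity of \<open>rform\<close> is a nontrivial character modulo
  \<open>1 - \<i>\<close>, whose sum over all classes vanishes.\<close>

lemma sum_eig_square_odd:
  assumes "\<not> even_lattice \<Gamma> H"
  shows "(\<Sum>A\<in>UNIV. eig A * eig A) = 0"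
proof -
  obtain \<gamma> where \<gamma>: "\<gamma> \<in> \<Gamma>" "odd (rform \<gamma>)" using assms even_lattice_iff by blast
  have "\<exists>k. odd (hdiag k)"
  proof (rule ccontr)
    assume "\<not> ?thesis"
    then have "(-1 :: complex) powi rform \<gamma> = 1" unfolding minus_one_powi_rform[OF \<gamma>(1)] by (simp add: minus_one_powi)
    then show False using \<gamma>(2) by (simp add: minus_one_powi)
  qed
  then obtain k0 where k0: "odd (hdiag k0)" by blast
  have "(-1 :: complex) powi rform (rep B) = (\<Prod>k\<in>B. (-1) powi hdiag k)" for B
  proof -
    have "(-1 :: complex) powi rform (rep B) = (\<Prod>k\<in>UNIV. if k \<in> B then (-1) powi hdiag k else 1)"
      unfolding minus_one_powi_rform[OF rep_in_Gamma] cpar_rep by (intro prod.cong refl) auto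
    then show ?thesis by (simp add: prod.If_cases)
  qed
  then have "(\<Sum>B\<in>UNIV. (-1 :: complex) powi rform (rep B)) = (\<Prod>k\<in>UNIV. (-1) powi hdiag k + 1)"
    by (simp add: sum_sets_prod)
  also have "\<dots> = 0" using k0 by (intro prod_zero) (auto simp: minus_one_powi)
  finally have "(\<Sum>A\<in>UNIV. gsum A * gsum A) = 0" by (simp add: sum_gsum_square)
  moreover have "(\<Sum>A\<in>UNIV. eig A * eig A) = (\<Sum>A\<in>UNIV. gsum A * gsum A) * (gauss_mean (1 - \<i>) * gauss_mean (1 - \<i>))"
    unfolding sum_distrib_right by (intro sum.cong refl) (simp add: eig_def mult_ac)
  ultimately show ?thesis by simp
qed

text \<open>
  For an even lattice the values at 0 of the kernels \<open>kernel (psi A)\<close> add up to a positive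
  theta series, so that some theta function does not vanish at 0.
\<close>

lemma exists_eig_1:
  assumes ev: "even_lattice \<Gamma> H"
  shows "\<exists>A. eig A = 1"
proof (rule ccontr)
  assume "\<not> ?thesis"
  then have ne: "eig A \<noteq> 1" for A by blast
  have n1: "norm (psi A \<gamma>) = 1" if "\<gamma> \<in> \<Gamma>" for A \<gamma> by (rule semicharD(1)[OF i_char_semichar[OF i_char_psi] that])
  \<comment> \<open>An eigenvalue different from 1 forces vanishing at the fixed point 0.\<close>
  have K0: "kernel (psi A) 0 0 = 0" for A
    using eig[OF kernel_theta_space[OF i_char_semichar[OF i_char_psi]], of A 0 0] ne[of A] by simp
  define g where "g \<gamma> = (if \<forall>k. even (cpar \<gamma> k) then 2 ^ CARD('n) * exp (- (pi / 2 * Re (H \<gamma> \<gamma>))) else 0)" for \<gamma>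
  have kg: "(\<Sum>A\<in>UNIV. kernel_term (psi A) 0 \<gamma> 0) = of_real (g \<gamma>)" if \<gamma>: "\<gamma> \<in> \<Gamma>" for \<gamma>
  proof -
    have "kernel_term (psi A) 0 \<gamma> 0 = (\<i> powi (rform \<gamma> + \<lfloor>Re (H \<gamma> \<gamma>)\<rfloor>) * of_real (exp (- (pi / 2 * Re (H \<gamma> \<gamma>))))) * (-1) powi chi A \<gamma>" for A
    proof -
      have "cnj (psi A \<gamma>) = psi A \<gamma>" using i_char_pm[OF i_char_psi \<gamma>, of A] by auto
      moreover have "exp (- (of_real pi / 2 * H \<gamma> \<gamma>)) = of_real (exp (- (pi / 2 * Re (H \<gamma> \<gamma>))))"
        by (subst H_self_real(2)) (simp add: exp_of_real[symmetric])
      ultimately show ?thesis by (simp add: kernel_term_def psi_def mult_ac)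
    qed
    then have s: "(\<Sum>A\<in>UNIV. kernel_term (psi A) 0 \<gamma> 0) = (\<i> powi (rform \<gamma> + \<lfloor>Re (H \<gamma> \<gamma>)\<rfloor>) * of_real (exp (- (pi / 2 * Re (H \<gamma> \<gamma>))))) *
        (if \<forall>k. even (cpar \<gamma> k) then 2 ^ CARD('n) else 0)"
      by (simp add: sum_distrib_left[symmetric] sum_sign_chi)
    show ?thesis
    proof (cases "\<forall>k. even (cpar \<gamma> k)")
      case True
      \<comment> \<open>A vector with even coordinates is \<open>1 - \<i>\<close> times some
        \<open>\<epsilon>\<close>, which gives a factor 2 in \<open>H\<close>, and evenness of the
        lattice gives another one. With \<open>rform_even_cpar\<close> no power of
        \<open>\<i>\<close> is left, and the term is positive.\<close>
      have "[\<lfloor>Re (H \<gamma> \<gamma>)\<rfloor> = 0] (mod 4)"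
      proof -
        have "\<forall>k. \<exists>w\<in>gaussian_ints. ccoo \<gamma> k = (1 - \<i>) * w"
          using True even_par_iff[OF ccoo_int[OF \<gamma>]] by (simp add: cpar_def)
        then obtain w where w: "\<And>k. w k \<in> gaussian_ints" "\<And>k. ccoo \<gamma> k = (1 - \<i>) * w k" by metis
        define \<epsilon> where "\<epsilon> = (\<Sum>k\<in>UNIV. w k *s b k)"
        have ce: "ccoo \<epsilon> k = w k" for k by (rule ccoo_unique[OF \<epsilon>_def])
        have \<epsilon>: "\<epsilon> \<in> \<Gamma>" unfolding Gamma_ccoo ce using w by blast
        have "ccoo \<gamma> = ccoo ((1 - \<i>) *s \<epsilon>)" by (rule ext) (simp only: ccoo_smult ce w)
        then have "\<gamma> = (1 - \<i>) *s \<epsilon>" by (rule ccoo_inject)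
        then have "H \<gamma> \<gamma> = 2 * H \<epsilon> \<epsilon>" by (simp only: H_smult_left H_smult_right) (simp add: algebra_simps)
        obtain m where "\<lfloor>Re (H \<epsilon> \<epsilon>)\<rfloor> = 2 * m"
          using ev even_lattice_iff even_rform_H[OF \<epsilon>] \<epsilon> by blast
        then have "H \<epsilon> \<epsilon> = of_int (2 * m)" using H_self_int[OF \<epsilon>] by simp
        then have "H \<gamma> \<gamma> = of_int (4 * m)" using \<open>H \<gamma> \<gamma> = 2 * H \<epsilon> \<epsilon>\<close> by simp
        then have "Re (H \<gamma> \<gamma>) = of_int (4 * m)" by simp
        then have "\<lfloor>Re (H \<gamma> \<gamma>)\<rfloor> = 4 * m" by (simp only: floor_of_int)
        then show ?thesis by (simp add: cong_def)
      qed
      then have "[rform \<gamma> + \<lfloor>Re (H \<gamma> \<gamma>)\<rfloor> = 0 + 0] (mod 4)"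
        using rform_even_cpar True by (intro cong_add) auto
      then have "\<i> powi (rform \<gamma> + \<lfloor>Re (H \<gamma> \<gamma>)\<rfloor>) = \<i> powi 0" by (intro i_powi_mod4) simp
      then show ?thesis unfolding s using True by (simp add: g_def)
    next
      case False
      then show ?thesis unfolding s g_def by (simp only: if_False) simp
    qed
  qed
  have hs: "((\<lambda>\<gamma>. kernel_term (psi A) 0 \<gamma> 0) has_sum 0) \<Gamma>" for A
    using has_sum_infsum[OF kernel_summable[of "psi A" 0 0], OF n1] K0[of A] by (simp add: kernel_def)
  have "((\<lambda>\<gamma>. \<Sum>A\<in>(UNIV::'n set set). kernel_term (psi A) 0 \<gamma> 0) has_sum (\<Sum>A\<in>(UNIV::'n set set). 0)) \<Gamma>"
    by (intro has_sum_finite_sum hs) auto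
  then have "((\<lambda>\<gamma>. \<Sum>A\<in>(UNIV::'n set set). kernel_term (psi A) 0 \<gamma> 0) has_sum 0) \<Gamma>" by simp
  then have "((\<lambda>\<gamma>. complex_of_real (g \<gamma>)) has_sum of_real 0) \<Gamma>" by (subst has_sum_cong[OF kg[symmetric]]) simp_all
  then have g0: "(g has_sum 0) \<Gamma>" by (simp only: has_sum_of_real_iff)
  \<comment> \<open>Nonnegative terms with sum 0 all vanish, whereas the term at the origin is
    \<open>2^g\<close>.\<close>
  have "g 0 = 0"
    by (rule nonneg_infsum_le_0D[of g \<Gamma>]) (use g0 in \<open>auto simp: infsumI summable_on_def g_def\<close>)
  then show False by (simp add: g_def cpar_def ccoo_def)
qed

lemma gsum_real_even:
  assumes ev: "even_lattice \<Gamma> H" shows "cnj (gsum A) = gsum A"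
proof -
  have c1: "cnj (\<i> powi rform (rep B)) = \<i> powi rform (rep B)" for B
  proof -
    obtain m where "rform (rep B) = 2 * m" using ev even_lattice_iff rep_in_Gamma by blast
    then show ?thesis by (simp add: i_powi_2 minus_one_powi)
  qed
  have c2: "cnj ((-1) powi k) = (-1) powi k" for k by (simp add: minus_one_powi)
  show ?thesis by (simp only: gsum_eq cnj_sum complex_cnj_mult c1 c2)
qed

text \<open>Evenness makes the Gauss sums real, so their squares are squared norms, equal to
  \<open>2^g\<close> because \<open>eig A\<close> has norm 1. The Gaussian factor squares to
  \<open>(2 \<i>)^g / 4^g\<close>. Hence \<open>eig A\<close> squares to \<open>\<i>^g\<close> for
  every \<open>A\<close>, and \<open>exists_eig_1\<close> makes this 1.\<close>

lemma even_dvd_4: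
  assumes ev: "even_lattice \<Gamma> H" shows "4 dvd CARD('n)" "eig A * eig A = 1"
proof -
  let ?n = "CARD('n)"
  have sq: "eig A * eig A * 4 ^ ?n = (gsum A * cnj (gsum A)) * (2 ^ ?n * \<i> ^ ?n)" for A
  proof -
    have "eig A * eig A * 4 ^ ?n = gsum A * gsum A * ((2 ^ ?n * gauss_mean (1 - \<i>)) * (2 ^ ?n * gauss_mean (1 - \<i>)))"
      by (simp add: eig_def mult_ac power_mult_distrib[symmetric])
    also have "(2 ^ ?n * gauss_mean (1 - \<i>)) * (2 ^ ?n * gauss_mean (1 - \<i>)) = ((1 + \<i>) * (1 + \<i>)) ^ ?n"
      unfolding gauss_mean_value' power_mult_distrib ..
    also have "(1 + \<i>) * (1 + \<i>) = 2 * \<i>" by (simp add: algebra_simps)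
    finally show ?thesis by (simp add: gsum_real_even[OF ev] power_mult_distrib)
  qed
  have ns: "norm (gsum A) ^ 2 = 2 ^ ?n" for A
  proof -
    have "norm (eig A * eig A * 4 ^ ?n) = norm (gsum A) ^ 2 * 2 ^ ?n"
      unfolding sq by (simp add: norm_mult norm_power power2_eq_square)
    then have "(2 ^ ?n :: real) * 2 ^ ?n = norm (gsum A) ^ 2 * 2 ^ ?n"
      by (simp add: norm_mult norm_power norm_eig power_mult_distrib[symmetric])
    then show ?thesis by simp
  qed
  have eq: "eig A * eig A = \<i> ^ ?n" for A
  proof -
    have "gsum A * cnj (gsum A) = 2 ^ ?n" using ns[of A] complex_norm_square[of "gsum A"] by (metis of_real_numeral of_real_power)
    then have "eig A * eig A * 4 ^ ?n = \<i> ^ ?n * (2 ^ ?n * 2 ^ ?n)" unfolding sq by simp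
    also have "(2 ^ ?n * 2 ^ ?n :: complex) = 4 ^ ?n" by (simp add: power_mult_distrib[symmetric])
    finally show ?thesis by simp
  qed
  obtain A0 where "eig A0 = 1" using exists_eig_1[OF ev] by blast
  then have "\<i> ^ ?n = 1" using eq[of A0] by simp
  then show "4 dvd CARD('n)" "eig A * eig A = 1" using i_power_eq_1_iff eq by auto
qed

text \<open>The indicator of -1 among the fourth roots of unity is
  \<open>(1 - c + c^2 - c^3) / 4\<close>, and \<open>c^3\<close> is the conjugate of
  \<open>c\<close>.\<close>

lemma card_eig_minus_1:
  "4 * of_nat (card {A. eig A = -1}) = 2 ^ CARD('n) - 2 * complex_of_real (Re ((1 + \<i>) ^ CARD('n))) + (\<Sum>A\<in>UNIV. eig A * eig A)"
proof -
  have ind: "(if eig A = -1 then 4 else 0) = 1 - eig A - cnj (eig A) + eig A * eig A" for A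
    using eig_cases[of A] by (auto simp: complex_eq_iff)
  have "4 * of_nat (card {A. eig A = -1}) = (\<Sum>A\<in>UNIV. if eig A = -1 then 4 else 0 :: complex)"
    by (simp add: sum.If_cases)
  also have "\<dots> = (\<Sum>A\<in>(UNIV::'n set set). 1) - (\<Sum>A\<in>UNIV. eig A) - cnj (\<Sum>A\<in>UNIV. eig A) + (\<Sum>A\<in>UNIV. eig A * eig A)"
    unfolding ind by (simp add: sum.distrib sum_subtractf)
  also have "\<dots> = 2 ^ CARD('n) - ((1 + \<i>) ^ CARD('n) + cnj ((1 + \<i>) ^ CARD('n))) + (\<Sum>A\<in>UNIV. eig A * eig A)"
    unfolding sum_eig by (simp add: card_UNIV_set)
  finally show ?thesis unfolding complex_add_cnj by simp
qed

section \<open>The counts for odd and even lattices\<close>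

lemma card_eig_odd:
  assumes "\<not> even_lattice \<Gamma> H"
  shows "real (card {A. eig A = -1}) = 2 powr (real CARD('n) - 2) - 2 powr (real CARD('n) / 2 - 1) * cos (pi * real CARD('n) / 4)"
proof -
  let ?n = "CARD('n)"
  have "complex_of_real (4 * real (card {A. eig A = -1})) = of_real (2 ^ ?n - 2 * Re ((1 + \<i>) ^ ?n))"
    using card_eig_minus_1 sum_eig_square_odd[OF assms] by simp
  then have "4 * real (card {A. eig A = -1}) = 2 ^ ?n - 2 * Re ((1 + \<i>) ^ ?n)" by (simp only: of_real_eq_iff)
  also have "Re ((1 + \<i>) ^ ?n) = 2 powr (real ?n / 2) * cos (pi * real ?n / 4)" by (simp add: one_plus_i_power)
  finally have "real (card {A. eig A = -1}) = 2 ^ ?n / 4 - 2 powr (real ?n / 2) / 2 * cos (pi * real ?n / 4)" by simp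
  moreover have "2 powr (real ?n - 2) = 2 ^ ?n / 4" by (simp add: powr_diff powr_realpow)
  moreover have "2 powr (real ?n / 2 - 1) = 2 powr (real ?n / 2) / 2" by (simp add: powr_diff)
  ultimately show ?thesis by (simp only:)
qed

lemma card_eig_even:
  assumes ev: "even_lattice \<Gamma> H"
  shows "real (card {A. eig A = -1}) = 2 powr (real CARD('n) / 2 - 1) * (2 powr (real CARD('n) / 2) - (-1) ^ (CARD('n) div 4))"
proof -
  let ?n = "CARD('n)"
  obtain m where m: "?n = 4 * m" using even_dvd_4(1)[OF ev] by blast
  have "complex_of_real (4 * real (card {A. eig A = -1})) = of_real (2 * 2 ^ ?n - 2 * Re ((1 + \<i>) ^ ?n))"
    using card_eig_minus_1 even_dvd_4(2)[OF ev] by (simp add: card_UNIV_set)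
  then have "4 * real (card {A. eig A = -1}) = 2 * 2 ^ ?n - 2 * Re ((1 + \<i>) ^ ?n)" by (simp only: of_real_eq_iff)
  also have "Re ((1 + \<i>) ^ ?n) = 2 powr (real ?n / 2) * cos (pi * real m)" by (simp add: one_plus_i_power m)
  also have "cos (pi * real m) = (-1) ^ m" by (simp add: cos_npi mult.commute)
  also have "(2::real) ^ ?n = 2 powr (real ?n / 2) * 2 powr (real ?n / 2)"
    by (simp add: powr_add[symmetric] powr_realpow)
  finally have "real (card {A. eig A = -1}) = 2 powr (real ?n / 2) / 2 * (2 powr (real ?n / 2) - (-1) ^ m)"
    by (simp add: right_diff_distrib)
  moreover have "2 powr (real ?n / 2 - 1) = 2 powr (real ?n / 2) / 2" by (simp add: powr_diff)
  moreover have "?n div 4 = m" by (simp add: m)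
  ultimately show ?thesis by (simp only:)
qed

end

section \<open>Divisors\<close>

lemma gentire_translate: "gentire f \<Longrightarrow> gentire (\<lambda>z. f (z + a))"
  unfolding gentire_def
proof (intro conjI allI; elim conjE)
  assume "continuous_on UNIV f"
  then show "continuous_on UNIV (\<lambda>z. f (z + a))" by (rule continuous_on_compose2) (auto intro!: continuous_intros)
next
  fix z v assume "\<forall>z v. (\<lambda>t. f (z + t *s v)) holomorphic_on UNIV"
  then have "(\<lambda>t. f ((z + a) + t *s v)) holomorphic_on UNIV" by blast
  then show "(\<lambda>t. f (z + t *s v + a)) holomorphic_on UNIV" by (simp add: add_ac)
qed

lemma divisor_of_iff: "g \<in> divisor_of f \<longleftrightarrow> (\<exists>u. gentire u \<and> (\<forall>z. u z \<noteq> 0) \<and> g = (\<lambda>z. u z * f z))"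
  by (auto simp: divisor_of_def entire_iff_gentire)

lemma divisor_of_self: "f \<in> divisor_of f"
  unfolding divisor_of_iff by (intro exI[of _ "\<lambda>z. 1"]) (auto intro: gentire_const)

lemma divisor_of_unit_mult:
  assumes u: "gentire u" "\<And>z. u z \<noteq> 0"
  shows "divisor_of (\<lambda>z. u z * f z) = divisor_of f"
proof (intro equalityI subsetI)
  fix g assume "g \<in> divisor_of (\<lambda>z. u z * f z)"
  then obtain w where "gentire w" "\<And>z. w z \<noteq> 0" "g = (\<lambda>z. w z * (u z * f z))" by (auto simp: divisor_of_iff)
  then show "g \<in> divisor_of f" unfolding divisor_of_iff using u
    by (intro exI[of _ "\<lambda>z. w z * u z"]) (auto intro: gentire_mult)
next
  fix g assume "g \<in> divisor_of f"
  then obtain w where w: "gentire w" "\<And>z. w z \<noteq> 0" "g = (\<lambda>z. w z * f z)" by (auto simp: divisor_of_iff)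
  then have "g = (\<lambda>z. w z / u z * (u z * f z))" using u by simp
  then show "g \<in> divisor_of (\<lambda>z. u z * f z)" unfolding divisor_of_iff using u w
    by (intro exI[of _ "\<lambda>z. w z / u z"]) (auto intro: gentire_divide)
qed

lemma pullback_divisor_of:
  assumes "\<And>u. gentire u \<Longrightarrow> gentire (\<lambda>z. u (\<phi> z))" "\<And>u. gentire u \<Longrightarrow> gentire (\<lambda>z. u (\<phi>' z))"
    and inv: "\<And>z. \<phi>' (\<phi> z) = z"
  shows "pullback_divisor \<phi> (divisor_of f) = divisor_of (\<lambda>z. f (\<phi> z))"
proof (intro equalityI subsetI)
  fix g assume "g \<in> pullback_divisor \<phi> (divisor_of f)"
  then obtain u where "gentire u" "\<And>z. u z \<noteq> 0" "g = (\<lambda>z. u z * f z) \<circ> \<phi>"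
    by (auto simp: pullback_divisor_def divisor_of_iff)
  then show "g \<in> divisor_of (\<lambda>z. f (\<phi> z))" unfolding divisor_of_iff
    using assms(1) by (intro exI[of _ "\<lambda>z. u (\<phi> z)"]) (auto simp: o_def)
next
  fix g assume "g \<in> divisor_of (\<lambda>z. f (\<phi> z))"
  then obtain u where u: "gentire u" "\<And>z. u z \<noteq> 0" "g = (\<lambda>z. u z * f (\<phi> z))" by (auto simp: divisor_of_iff)
  have m: "(\<lambda>z. u (\<phi>' z) * f z) \<in> divisor_of f" unfolding divisor_of_iff
    using u assms(2) by (intro exI[of _ "\<lambda>z. u (\<phi>' z)"]) auto
  have e: "g = (\<lambda>z. u (\<phi>' z) * f z) \<circ> \<phi>" by (simp add: u(3) o_def inv)
  show "g \<in> pullback_divisor \<phi> (divisor_of f)" unfolding pullback_divisor_def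
    by (rule image_eqI[of _ "\<lambda>h. h \<circ> \<phi>", OF e m])
qed

lemma pullback_translate: "pullback_divisor (\<lambda>z. z + a) (divisor_of f) = divisor_of (\<lambda>z. f (z + a))"
  by (rule pullback_divisor_of[OF gentire_translate gentire_translate[where a = "- a"]]) simp_all

lemma pullback_i: "pullback_divisor (\<lambda>z. \<i> *s z) (divisor_of f) = divisor_of (\<lambda>z. f (\<i> *s z))"
  by (rule pullback_divisor_of[OF gentire_smult_arg gentire_smult_arg[where c = "- \<i>"]])
     (simp_all add: vector_smult_assoc)

text \<open>\<open>mult_at_origin\<close> picks an arbitrary equation \<open>u f\<close> of the
  divisor. The quotient of the rotated unit by \<open>u\<close> is 1 at the origin and serves as
  \<open>w\<close> in \<open>vanishing_order_semi_invariant\<close>.\<close>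

lemma mult_at_origin_eigen:
  assumes f: "gentire f" "f v \<noteq> 0" and c: "\<And>z. f (\<i> *s z) = c * f z"
  shows "\<i> ^ mult_at_origin (divisor_of f) = c"
proof -
  define g where "g = (SOME g. g \<in> divisor_of f)"
  have "g \<in> divisor_of f" unfolding g_def by (rule someI[of _ f]) (rule divisor_of_self)
  then obtain u where u: "gentire u" "\<And>z. u z \<noteq> 0" "g = (\<lambda>z. u z * f z)" by (auto simp: divisor_of_iff)
  have "c = \<i> ^ vanishing_order g 0"
  proof (rule vanishing_order_semi_invariant)
    show "gentire g" unfolding u(3) by (intro gentire_mult u f)
    show "g v \<noteq> 0" using u f by simp
    show "gentire (\<lambda>z. u (\<i> *s z) / u z)" by (intro gentire_divide gentire_smult_arg u)
    show "u (\<i> *s 0) / u 0 = 1" using u by simp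
    show "g (\<i> *s z) = c * (u (\<i> *s z) / u z * g z)" for z using u(2)[of z] by (simp add: u(3) c)
  qed
  then show ?thesis by (simp add: mult_at_origin_def g_def)
qed

lemma i_power_eq_minus_1_iff: "\<i> ^ m = -1 \<longleftrightarrow> m mod 4 = 2"
proof -
  have i4: "\<i> ^ 4 = 1" by (simp add: numeral_eq_Suc)
  have "\<i> ^ m = \<i> ^ (4 * (m div 4) + m mod 4)" by simp
  also have "\<dots> = \<i> ^ (m mod 4)" unfolding power_add power_mult i4 by simp
  finally have "\<i> ^ m = \<i> ^ (m mod 4)" .
  moreover have "m mod 4 = 0 \<or> m mod 4 = 1 \<or> m mod 4 = 2 \<or> m mod 4 = 3" by linarith
  moreover have "\<i> ^ 0 \<noteq> -1" "\<i> ^ 1 \<noteq> -1" "\<i> ^ 2 = -1" "\<i> ^ 3 \<noteq> -1"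
    by (simp_all add: complex_eq_iff power3_eq_cube)
  ultimately show ?thesis by (elim disjE) simp_all
qed

context unimodular_lattice
begin

text \<open>The modulus is bounded by a bound on the fundamental cube, so Liouville's theorem
  applies on each line through 0.\<close>

lemma abs_periodic_imp_const:
  assumes u: "gentire u" and p: "\<And>\<gamma> z. \<gamma> \<in> \<Gamma> \<Longrightarrow> norm (u (z + \<gamma>)) = norm (u z)"
  shows "u z = u 0"
proof -
  have "continuous_on (cbox 0 1) (\<lambda>x. u (lin x))"
    by (rule continuous_on_compose2[OF gentire_cont[OF u, of UNIV] continuous_on_lin[OF continuous_on_id]]) simp
  from compact_imp_bounded[OF compact_continuous_image[OF this compact_cbox]]
  obtain B where B: "\<And>x. x \<in> cbox 0 1 \<Longrightarrow> norm (u (lin x)) \<le> B"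
    unfolding bounded_iff by blast
  have bd: "norm (u z) \<le> B" for z
  proof -
    define x where "x = (\<chi> k. frac (coo z $ k))"
    have xc: "x \<in> cbox 0 1" by (simp add: x_def mem_box_cart less_imp_le[OF frac_lt_1])
    have "z - lin x = lin (coo z - x)" by (simp add: lin_diff)
    then have "z - lin x \<in> \<Gamma>" by (simp add: Gamma_iff x_def frac_def)
    then have "norm (u (lin x + (z - lin x))) = norm (u (lin x))" by (rule p)
    then show ?thesis using B[OF xc] by simp
  qed
  have "(\<lambda>t. u (0 + t *s z)) constant_on UNIV"
  proof (rule Liouville_theorem)
    show "(\<lambda>t. u (0 + t *s z)) holomorphic_on UNIV" by (rule gentire_holo[OF u])
    show "bounded (range (\<lambda>t. u (0 + t *s z)))" unfolding bounded_iff using bd by blast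
  qed
  then obtain c where "\<And>t. u (0 + t *s z) = c" unfolding constant_on_def by blast
  from this[of 0] this[of 1] show ?thesis by simp
qed

text \<open>Lattice translations multiply \<open>u\<close> by constants of norm 1, so its modulus is
  periodic and \<open>u\<close> is constant; then these constants are 1.\<close>

lemma theta_unit_quotient:
  assumes f: "f \<in> theta_space \<psi>" "f v \<noteq> 0" and g: "g \<in> theta_space \<psi>'"
    and n: "\<And>\<gamma>. \<gamma> \<in> \<Gamma> \<Longrightarrow> norm (\<psi> \<gamma>) = 1" "\<And>\<gamma>. \<gamma> \<in> \<Gamma> \<Longrightarrow> norm (\<psi>' \<gamma>) = 1"
    and u: "gentire u" "\<And>z. u z \<noteq> 0" "\<And>z. g z = u z * f z"
  shows "\<gamma> \<in> \<Gamma> \<Longrightarrow> \<psi>' \<gamma> = \<psi> \<gamma>"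
proof -
  have sh: "\<psi> \<gamma> * u (z + \<gamma>) + (- \<psi>' \<gamma>) * u z = 0" if \<gamma>: "\<gamma> \<in> \<Gamma>" for \<gamma> z
  \<comment> \<open>The functional equations give the relation only after multiplication by
    \<open>f\<close>; the identity theorem removes this factor, also at the zeros of
    \<open>f\<close>.\<close>
  proof (rule gentire_mult_eq_0[OF theta_gentire[OF f(1)] _ _ f(2)])
    show "gentire (\<lambda>z. \<psi> \<gamma> * u (z + \<gamma>) + (- \<psi>' \<gamma>) * u z)"
      by (intro gentire_add gentire_mult gentire_const gentire_translate u)
    fix z
    define e where "e = exp (of_real pi * H \<gamma> z + of_real pi / 2 * H \<gamma> \<gamma>)"
    have "u (z + \<gamma>) * (\<psi> \<gamma> * e * f z) = \<psi>' \<gamma> * e * (u z * f z)"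
    proof -
      have "u (z + \<gamma>) * (\<psi> \<gamma> * e * f z) = u (z + \<gamma>) * f (z + \<gamma>)"
        using theta_shift[OF f(1) \<gamma>, of z] by (simp only: e_def)
      also have "\<dots> = g (z + \<gamma>)" by (simp only: u(3))
      also have "\<dots> = \<psi>' \<gamma> * e * g z" using theta_shift[OF g \<gamma>, of z] by (simp only: e_def)
      finally show ?thesis by (simp only: u(3))
    qed
    then have "e * (f z * (\<psi> \<gamma> * u (z + \<gamma>) + (- \<psi>' \<gamma>) * u z)) = 0" by (simp add: algebra_simps)
    moreover have "e \<noteq> 0" by (simp add: e_def)
    ultimately show "f z * (\<psi> \<gamma> * u (z + \<gamma>) + (- \<psi>' \<gamma>) * u z) = 0" by simp
  qed
  have "u z = u 0" for z
  proof (rule abs_periodic_imp_const[OF u(1)])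
    fix \<gamma> z assume \<gamma>: "\<gamma> \<in> \<Gamma>"
    have "\<psi> \<gamma> * u (z + \<gamma>) = \<psi>' \<gamma> * u z" using sh[OF \<gamma>, of z] by simp
    then have "norm (\<psi> \<gamma>) * norm (u (z + \<gamma>)) = norm (\<psi>' \<gamma>) * norm (u z)" by (metis norm_mult)
    then show "norm (u (z + \<gamma>)) = norm (u z)" using n[OF \<gamma>] by simp
  qed
  then have "u \<gamma> = u 0" .
  moreover assume "\<gamma> \<in> \<Gamma>"
  then have "\<psi> \<gamma> * u (0 + \<gamma>) + (- \<psi>' \<gamma>) * u 0 = 0" by (rule sh)
  ultimately show "\<psi>' \<gamma> = \<psi> \<gamma>" using u(2)[of 0] by simp
qed

lemma theta_space_cong: "(\<And>\<gamma>. \<gamma> \<in> \<Gamma> \<Longrightarrow> \<psi> \<gamma> = \<psi>' \<gamma>) \<Longrightarrow> theta_space \<psi> = theta_space \<psi>'"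
  by (auto simp: theta_space_def automorphy_factor_def)

lemma theta_divisor_inj:
  assumes f: "f \<in> theta_space \<psi>" "f v \<noteq> 0" and g: "g \<in> theta_space \<psi>'"
    and n: "\<And>\<gamma>. \<gamma> \<in> \<Gamma> \<Longrightarrow> norm (\<psi> \<gamma>) = 1" "\<And>\<gamma>. \<gamma> \<in> \<Gamma> \<Longrightarrow> norm (\<psi>' \<gamma>) = 1"
    and eq: "divisor_of f = divisor_of g" and \<gamma>: "\<gamma> \<in> \<Gamma>"
  shows "\<psi>' \<gamma> = \<psi> \<gamma>"
proof -
  have "g \<in> divisor_of f" using eq divisor_of_self by blast
  then obtain u where "gentire u" "\<And>z. u z \<noteq> 0" "g = (\<lambda>z. u z * f z)" by (auto simp: divisor_of_iff)
  then show ?thesis using theta_unit_quotient[OF f g n, of u] \<gamma> by simp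
qed

text \<open>Rotation carries \<open>f\<close> to a theta function of the rotated semicharacter. By
  invariance both have the same divisor, and the divisor determines the semicharacter.\<close>

lemma i_invariant_imp_i_char:
  assumes \<psi>: "semicharacter \<Gamma> H \<psi>" and f: "f \<in> theta_space \<psi>" "f v \<noteq> 0" and i: "i_invariant (divisor_of f)"
  shows "i_char \<psi>"
proof -
  note n = semicharD(1)[OF \<psi>]
  let ?\<psi> = "\<lambda>\<gamma>. \<psi> (\<i> *s \<gamma>)" and ?f = "\<lambda>z. f (\<i> *s z)"
  have "?f (z + \<gamma>) = automorphy_factor H ?\<psi> \<gamma> z * ?f z" if \<gamma>: "\<gamma> \<in> \<Gamma>" for z \<gamma>
    using theta_shift[OF f(1) Gamma_i[OF \<gamma>], of "\<i> *s z"]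
    by (simp add: vector_add_ldistrib automorphy_factor_eq H_smult_left H_smult_right mult.assoc[symmetric])
  then have fi: "?f \<in> theta_space ?\<psi>"
    using gentire_smult_arg[OF theta_gentire[OF f(1)]] by (simp add: theta_space_def)
  have "divisor_of f = divisor_of ?f" using i pullback_i[of f] by (simp add: i_invariant_def)
  then have "?\<psi> \<gamma> = \<psi> \<gamma>" if "\<gamma> \<in> \<Gamma>" for \<gamma>
    using theta_divisor_inj[OF f fi n n[OF Gamma_i] _ that] by blast
  then show ?thesis using \<psi> by (simp add: i_char_def)
qed

lemma theta_divisor_psi:
  assumes f: "f \<in> theta_space (psi A)" "f v \<noteq> 0"
  shows "theta_divisor \<Gamma> H (divisor_of f)" "i_invariant (divisor_of f)"
    "mult_at_origin (divisor_of f) mod 4 = 2 \<longleftrightarrow> eig A = -1"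
proof -
  have e0: "eig A \<noteq> 0" using norm_eig[of A] by auto
  have "pullback_divisor (\<lambda>z. z + \<gamma>) (divisor_of f) = divisor_of f" if \<gamma>: "\<gamma> \<in> \<Gamma>" for \<gamma>
  proof -
    have "(\<lambda>z. f (z + \<gamma>)) = (\<lambda>z. (psi A \<gamma> * exp (H (of_real pi *s \<gamma>) z + of_real pi / 2 * H \<gamma> \<gamma>)) * f z)"
      unfolding theta_shift[OF f(1) \<gamma>] by (simp add: H_smult_left)
    moreover have "psi A \<gamma> \<noteq> 0" using i_char_pm[OF i_char_psi \<gamma>, of A] by auto
    ultimately show ?thesis unfolding pullback_translate
      by (simp only:) (rule divisor_of_unit_mult; simp add: gentire_mult gentire_const gentire_exp gentire_add gentire_H)
  qed
  note inv = this
  have "effective_divisor \<Gamma> (divisor_of f)"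
    unfolding effective_divisor_def entire_iff_gentire
    by (intro conjI exI[of _ f] exI[of _ v] theta_gentire[OF f(1)] f(2) refl ballI inv)
  then show "theta_divisor \<Gamma> H (divisor_of f)"
    unfolding theta_divisor_def theta_function_iff
    by (intro conjI exI[of _ "psi A"] exI[of _ f] i_char_semichar i_char_psi f(1) exI[of _ v] f(2) refl)
  show "i_invariant (divisor_of f)"
    unfolding i_invariant_def pullback_i eig[OF f(1)] by (rule divisor_of_unit_mult) (auto simp: e0 gentire_const)
  show "mult_at_origin (divisor_of f) mod 4 = 2 \<longleftrightarrow> eig A = -1"
    unfolding i_power_eq_minus_1_iff[symmetric] mult_at_origin_eigen[OF theta_gentire[OF f(1)] f(2) eig[OF f(1)]]
    by (rule refl)
qed

text \<open>The eigenvalue -1 gives both properties: applying \<open>\<i>\<close> twice multiplies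
  by 1, and at the fixed point 0 the value equals its negative.\<close>

lemma vanishing_thetanull_psi:
  assumes f: "f \<in> theta_space (psi A)" "f v \<noteq> 0" and e: "eig A = -1"
  shows "vanishing_thetanull \<Gamma> H (divisor_of f)"
proof -
  \<comment> \<open>The values 1 and -1 of \<open>psi A\<close> are \<open>\<i>\<close> to the
    powers 0 and 2.\<close>
  define q :: "complex ^ 'n \<Rightarrow> int" where "q \<gamma> = (if psi A \<gamma> = 1 then 0 else 2)" for \<gamma>
  note sc = semicharD(2)[OF i_char_semichar[OF i_char_psi, of A]]
  have qp: "\<i> powi q \<gamma> = psi A \<gamma>" if "\<gamma> \<in> \<Gamma>" for \<gamma>
    using i_char_pm[OF i_char_psi that, of A] by (auto simp: q_def)
  have q2: "psi A (x + (y + y)) = psi A x" if xy: "x \<in> \<Gamma>" "y \<in> \<Gamma>" for x y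
  proof -
    obtain m :: int where m: "E x y = of_int m" using E_int[OF xy] by (auto elim: Ints_cases)
    have "E x (y + y) = of_int (2 * m)" unfolding H_add_right plus_complex.sel m by simp
    then have "\<lfloor>E x (y + y)\<rfloor> = 2 * m" by (simp only: floor_of_int)
    moreover have "psi A (y + y) = 1"
      using sc[OF xy(2) xy(2)] i_char_square[OF i_char_psi xy(2), of A] by (simp add: H_self_real(1))
    ultimately show ?thesis using sc[OF xy(1) Gamma_add[OF xy(2) xy(2)]] by (simp add: minus_one_powi)
  qed
  have "quadratic_form_A2 \<Gamma> H q"
    unfolding quadratic_form_A2_def form_E_def
  proof (intro conjI ballI)
    fix x y assume xy: "x \<in> \<Gamma>" "y \<in> \<Gamma>"
    show "[q (x + (y + y)) = q x] (mod 4)" unfolding q_def q2[OF xy] by (rule cong_refl)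
    define k where "k = \<lfloor>E x y\<rfloor>"
    have qv: "psi A z = 1 \<and> q z = 0 \<or> psi A z = -1 \<and> q z = 2" if "z \<in> \<Gamma>" for z
      using i_char_pm[OF i_char_psi that, of A] by (auto simp: q_def)
    have pk: "psi A (x + y) = psi A x * psi A y * (if even k then 1 else -1)"
      using sc[OF xy] by (simp add: minus_one_powi k_def)
    note cases = qv[OF xy(1)] qv[OF xy(2)] qv[OF Gamma_add[OF xy]]
    have "[q (x + y) = q x + q y + 2 * k] (mod 4)"
    proof (cases "even k")
      case True
      then obtain m where "k = 2 * m" by blast
      then show ?thesis using cases pk by (elim disjE conjE) (simp_all add: cong_def)
    next
      case False
      then obtain m where "k = 2 * m + 1" by (rule oddE)
      then show ?thesis using cases pk by (elim disjE conjE) (simp_all add: cong_def)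
    qed
    then show "[q (x + y) = q x + q y + 2 * \<lfloor>E x y\<rfloor>] (mod 4)" by (simp add: k_def)
  qed
  moreover have "theta_function \<Gamma> H (\<lambda>\<gamma>. \<i> powi q \<gamma>) f"
  proof -
    have "theta_space (\<lambda>\<gamma>. \<i> powi q \<gamma>) = theta_space (psi A)" by (rule theta_space_cong) (rule qp)
    then show ?thesis unfolding theta_function_iff using f by blast
  qed
  moreover have "f (- z) = f z" for z
  proof -
    have "f (\<i> *s (\<i> *s z)) = f z" unfolding eig[OF f(1)] e by simp
    moreover have "\<i> *s (\<i> *s z) = - z" by (simp add: vec_eq_iff)
    ultimately show ?thesis by simp
  qed
  moreover have "f 0 = 0"
  proof -
    have "f (\<i> *s 0) = - f 0" unfolding eig[OF f(1)] e by simp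
    then have "f 0 = - f 0" by simp
    then show ?thesis by (simp add: eq_neg_iff_add_eq_0)
  qed
  ultimately show ?thesis unfolding vanishing_thetanull_def by blast
qed

section \<open>The divisors indexed by the forms with eigenvalue -1\<close>

definition theta :: "'n set \<Rightarrow> complex ^ 'n \<Rightarrow> complex" where
  "theta A = (SOME f. f \<in> theta_space (psi A) \<and> (\<exists>v. f v \<noteq> 0))"

lemma theta: "theta A \<in> theta_space (psi A)" "\<exists>v. theta A v \<noteq> 0"
proof -
  have "\<exists>f. f \<in> theta_space (psi A) \<and> (\<exists>v. f v \<noteq> 0)" using theta_psi_exists[of A] by blast
  from someI_ex[OF this] show "theta A \<in> theta_space (psi A)" "\<exists>v. theta A v \<noteq> 0" by (simp_all add: theta_def)
qed

text \<open>An invariant theta divisor belongs to some \<open>psi A\<close>; its theta function is a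
  nonzero multiple of the chosen \<open>theta A\<close>, so the divisors agree, and the condition
  modulo 4 becomes one on the eigenvalue.\<close>

lemma theta_divisors_eq:
  "{\<Theta>. theta_divisor \<Gamma> H \<Theta> \<and> i_invariant \<Theta> \<and> mult_at_origin \<Theta> mod 4 = 2} = (\<lambda>A. divisor_of (theta A)) ` {A. eig A = -1}"
proof (intro equalityI subsetI)
  fix \<Theta> assume "\<Theta> \<in> {\<Theta>. theta_divisor \<Gamma> H \<Theta> \<and> i_invariant \<Theta> \<and> mult_at_origin \<Theta> mod 4 = 2}"
  then have a: "theta_divisor \<Gamma> H \<Theta>" "i_invariant \<Theta>" "mult_at_origin \<Theta> mod 4 = 2" by auto
  obtain \<psi> f v where f: "semicharacter \<Gamma> H \<psi>" "f \<in> theta_space \<psi>" "f v \<noteq> 0" "\<Theta> = divisor_of f"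
    using a(1) unfolding theta_divisor_def theta_function_iff by blast
  have "i_char \<psi>" using i_invariant_imp_i_char[OF f(1-3)] a(2) f(4) by simp
  then obtain A where A: "\<And>\<gamma>. \<gamma> \<in> \<Gamma> \<Longrightarrow> \<psi> \<gamma> = psi A \<gamma>" using i_char_eq_psi by blast
  have fA: "f \<in> theta_space (psi A)" using f(2) theta_space_cong[OF A] by simp
  obtain v' where v': "theta A v' \<noteq> 0" using theta(2) by blast
  obtain c where c: "\<And>z. f z = c * theta A z"
    using theta_space_one_dimensional[OF theta(1) v' fA semicharD(1)[OF i_char_semichar[OF i_char_psi]]] by blast
  have "c \<noteq> 0" using c f(3) by auto
  have "f = (\<lambda>z. c * theta A z)" using c by blast
  then have "\<Theta> = divisor_of (theta A)" unfolding f(4)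
    using divisor_of_unit_mult[of "\<lambda>z. c" "theta A"] \<open>c \<noteq> 0\<close> by (simp add: gentire_const)
  moreover have "eig A = -1" using theta_divisor_psi(3)[OF fA f(3)] a(3) f(4) by simp
  ultimately show "\<Theta> \<in> (\<lambda>A. divisor_of (theta A)) ` {A. eig A = -1}" by blast
next
  fix \<Theta> assume "\<Theta> \<in> (\<lambda>A. divisor_of (theta A)) ` {A. eig A = -1}"
  then obtain A where A: "\<Theta> = divisor_of (theta A)" "eig A = -1" by blast
  obtain v where "theta A v \<noteq> 0" using theta(2) by blast
  then show "\<Theta> \<in> {\<Theta>. theta_divisor \<Gamma> H \<Theta> \<and> i_invariant \<Theta> \<and> mult_at_origin \<Theta> mod 4 = 2}"
    using theta_divisor_psi[OF theta(1)] A by auto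
qed

lemma inj_theta_divisor: "inj (\<lambda>A. divisor_of (theta A))"
proof (rule injI)
  fix A B assume eq: "divisor_of (theta A) = divisor_of (theta B)"
  obtain v where v: "theta A v \<noteq> 0" using theta(2) by blast
  note n = semicharD(1)[OF i_char_semichar[OF i_char_psi]]
  have "psi B \<gamma> = psi A \<gamma>" if "\<gamma> \<in> \<Gamma>" for \<gamma>
    by (rule theta_divisor_inj[OF theta(1) v theta(1) n n eq that])
  then show "A = B" using psi_inj[of B A] by simp
qed

end

theorem mainTheorem2:
  fixes \<Gamma> :: "(complex ^ 'n) set"
    and H :: "complex ^ 'n \<Rightarrow> complex ^ 'n \<Rightarrow> complex"
    and g :: nat
    and T :: "(complex ^ 'n \<Rightarrow> complex) set set"
  assumes lattice: "gaussian_lattice \<Gamma> H"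
    and unimod: "unimodular \<Gamma> H"
    and rank: "g = CARD('n)"
    and T: "T = {\<Theta>. theta_divisor \<Gamma> H \<Theta> \<and> i_invariant \<Theta> \<and> mult_at_origin \<Theta> mod 4 = 2}"
  shows "finite T \<and>
    (even_lattice \<Gamma> H \<longrightarrow>
       real (card T) = 2 powr (real g / 2 - 1) * (2 powr (real g / 2) - (-1) ^ (g div 4))) \<and>
    (\<not> even_lattice \<Gamma> H \<longrightarrow>
       real (card T) = 2 powr (real g - 2) - 2 powr (real g / 2 - 1) * cos (pi * real g / 4)) \<and>
    (\<forall>\<Theta>\<in>T. vanishing_thetanull \<Gamma> H \<Theta>)"
proof -
  obtain b where b: "gaussian_basis b \<Gamma>" "det (gram (form_E H) (underlying_int_basis b)) = 1"
    using unimod unfolding unimodular_def by blast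
  note H = lattice[unfolded gaussian_lattice_def]
  interpret unimodular_lattice \<Gamma> H b
  proof
    show "H x (y + z) = H x y + H x z" for x y z using H by blast
    show "H x (c *s y) = c * H x y" for c x y using H by blast
    show "H y x = cnj (H x y)" for x y using H by blast
    show "H x y \<in> gaussian_ints" if "x \<in> \<Gamma>" "y \<in> \<Gamma>" for x y using H that by blast
    show "0 < Re (H x x)" if "x \<in> \<Gamma>" "x \<noteq> 0" for x using H that by blast
  qed (rule b)+
  have T': "T = (\<lambda>A. divisor_of (theta A)) ` {A. eig A = -1}" unfolding T by (rule theta_divisors_eq)
  have c: "card T = card {A. eig A = -1}"
    unfolding T' by (rule card_image) (rule inj_on_subset[OF inj_theta_divisor], simp)
  have "finite T" unfolding T' by simp
  moreover have "vanishing_thetanull \<Gamma> H \<Theta>" if \<Theta>: "\<Theta> \<in> T" for \<Theta>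
  proof -
    obtain A where A: "\<Theta> = divisor_of (theta A)" "eig A = -1" using \<Theta> T' by blast
    obtain v where "theta A v \<noteq> 0" using theta(2) by blast
    then show ?thesis unfolding A(1) using A(2) by (rule vanishing_thetanull_psi[OF theta(1)])
  qed
  ultimately show ?thesis
    using card_eig_even card_eig_odd unfolding c rank by blast
qed

end
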